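(* Let $F$ be a free group and $A<F$ a finitely generated subgroup. Then there are at most $\mathrm{rk}(A)$ many conjugacy classes (in $F$) of maximal cyclic subgroups $M<F$ such that $$12\cdot\mathrm{rk}(A)\ \le\ [M:A\cap M]\ <\ \infty.$$
   Context: $\mathrm{rk}(A)$ denotes the rank of the free group $A$. A maximal cyclic subgroup of $F$ is a (nontrivial, hence infinite) cyclic subgroup of $F$ not properly contained in another cyclic subgroup of $F$. *)

theory Defs
  imports "HOL-Algebra.Algebra" "HOL-Library.Extended_Nat"
begin

text \<open>A word is a list of signed letters: \<open>(s, True)\<close> stands for \<open>s\<close> and \<open>(s, False)\<close> for its
  inverse.\<close>

definition letter_val :: "('a, 'm) monoid_scheme \<Rightarrow> 'a \<times> bool \<Rightarrow> 'a"
  where "letter_val G l = (if snd l then fst l else inv\<^bsub>G\<^esub> (fst l))"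

definition word_val :: "('a, 'm) monoid_scheme \<Rightarrow> ('a \<times> bool) list \<Rightarrow> 'a"
  where "word_val G w = foldr (\<lambda>l x. letter_val G l \<otimes>\<^bsub>G\<^esub> x) w \<one>\<^bsub>G\<^esub>"

definition reduced_word :: "('a \<times> bool) list \<Rightarrow> bool"
  where "reduced_word = successively (\<lambda>l l'. \<not> (fst l = fst l' \<and> snd l \<noteq> snd l'))"

text \<open>The group \<open>G\<close> is free on \<open>S\<close> if every element is the value of exactly one reduced word
  over \<open>S\<close>.\<close>

definition free_basis :: "('a, 'm) monoid_scheme \<Rightarrow> 'a set \<Rightarrow> bool"
  where "free_basis G S \<longleftrightarrow> S \<subseteq> carrier G \<and>
    bij_betw (word_val G) {w. set w \<subseteq> S \<times> UNIV \<and> reduced_word w} (carrier G)"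

definition free_group :: "('a, 'm) monoid_scheme \<Rightarrow> bool"
  where "free_group G \<longleftrightarrow> group G \<and> (\<exists>S. free_basis G S)"

text \<open>All bases of a free group are equipotent, so the choice of basis does not matter. The value is
  meaningful only for free groups of finite rank (\<open>card\<close> sends infinite bases to \<open>0\<close>).\<close>

definition free_rank :: "('a, 'm) monoid_scheme \<Rightarrow> nat"
  where "free_rank G = card (SOME S. free_basis G S)"

definition fin_gen_subgroup :: "'a set \<Rightarrow> ('a, 'm) monoid_scheme \<Rightarrow> bool"
  where "fin_gen_subgroup A G \<longleftrightarrow>
    subgroup A G \<and> (\<exists>B. finite B \<and> B \<subseteq> carrier G \<and> A = generate G B)"

definition cyclic_subgroup :: "'a set \<Rightarrow> ('a, 'm) monoid_scheme \<Rightarrow> bool"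
  where "cyclic_subgroup M G \<longleftrightarrow> subgroup M G \<and> cyclic_group (G\<lparr>carrier := M\<rparr>)"

definition maximal_cyclic_subgroup :: "'a set \<Rightarrow> ('a, 'm) monoid_scheme \<Rightarrow> bool"
  where "maximal_cyclic_subgroup M G \<longleftrightarrow> cyclic_subgroup M G \<and> M \<noteq> {\<one>\<^bsub>G\<^esub>} \<and>
    \<not> (\<exists>N. cyclic_subgroup N G \<and> M \<subset> N)"

text \<open>The index \<open>[K : H]\<close> of a subgroup \<open>H\<close> of the subgroup \<open>K\<close> of \<open>G\<close>.\<close>

definition subgroup_index :: "('a, 'm) monoid_scheme \<Rightarrow> 'a set \<Rightarrow> 'a set \<Rightarrow> enat"
  where "subgroup_index G K H =
    (let C = rcosets\<^bsub>G\<lparr>carrier := K\<rparr>\<^esub> H in if finite C then enat (card C) else \<infinity>)"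

definition subgroup_conj_class :: "('a, 'm) monoid_scheme \<Rightarrow> 'a set \<Rightarrow> 'a set set"
  where "subgroup_conj_class G = orbit G (\<lambda>g H. g <#\<^bsub>G\<^esub> H #>\<^bsub>G\<^esub> (inv\<^bsub>G\<^esub> g))"

end

(*
  Let X be the Schreier graph of A with respect to a basis of F. A maximal cyclic subgroup M with
  0 < [M : A \<inter> M] = n < \<infinity> gives a closed path in X that reads w^n, where w is a cyclically reduced
  generator of a conjugate of M. Let E be the union of these paths. Comparing E with a spanning tree
  of X bounds the total excess sum (deg v - 2) over the vertices of E by 2 rk(A) - 2.

  The bi-invariant Magnus order on F orders the rotations of w, and stacks the strands of the path
  of w^n that run over a common edge. A strand can change between being on top and not being on top
  only at a branch vertex, and the excess bounds the number of such changes; likewise at the bottom.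
  Every period of w contains a highest and a lowest rotation. As n >= 12 rk(A), pigeonhole yields a
  stretch of two periods without events: there the path is on top and at the bottom, hence alone, and
  meets no branch vertex. A path with a shorter word w' that crosses an edge of this stretch has to
  follow it for a length |w| + |w'|, so that suitable rotations of w and w' commute and the
  two subgroups are conjugate. Hence the signed crossing counts of these edges form a triangular
  system of homomorphisms A -> Z, which leaves room for at most rk(A) classes.
*)
theory Submission
  imports Defs "HOL-Library.List_Lenlexorder"
begin

section \<open>Words and free groups\<close>

text \<open>Origin of the 12: with r = rk(A), the excess is at most 2r - 2. Each vertex is charged
  its excess three times: for changes at the top, for changes at the bottom, and for visits of a
  strand that runs alone through a branching. This gives at most 6r - 6 events, while the n periods
  contain n div 2 \<ge> 6r disjoint blocks of two periods; so 12 is 2 times 3 times 2. Blocks have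
  two periods because w and w' are shown to commute from an agreement along |w| + |w'| letters,
  which fits into 2|w| when w' is not longer. A longer word may well cross the chosen edge; this is
  why the system is only triangular, ordered by length. Invariance on both sides matters because
  moving along a letter conjugates a rotation by that letter. Edges may also be run through
  backwards. The stack order has to survive that, and a signed count of a line over its own edge
  could cancel; it does not, since a cyclically reduced word is no rotation of its own
  inverse.\<close>

definition flip :: "'a \<times> bool \<Rightarrow> 'a \<times> bool"
  where "flip l = (fst l, \<not> snd l)"

lemma flip_flip [simp]: "flip (flip l) = l"
  by (simp add: flip_def)

lemma fst_flip [simp]: "fst (flip l) = fst l"
  by (simp add: flip_def)

lemma snd_flip [simp]: "snd (flip l) = (\<not> snd l)"
  by (simp add: flip_def)

lemma flip_neq [simp]: "flip l \<noteq> l" "l \<noteq> flip l"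
  by (auto simp: flip_def prod_eq_iff)

lemma flip_eq_iff [simp]: "flip l = flip l' \<longleftrightarrow> l = l'"
  by (auto simp: flip_def prod_eq_iff)

definition inv_word :: "('a \<times> bool) list \<Rightarrow> ('a \<times> bool) list"
  where "inv_word w = rev (map flip w)"

lemma inv_word_simps [simp]:
  "inv_word [] = []" "inv_word (l # w) = inv_word w @ [flip l]"
  "inv_word (x @ y) = inv_word y @ inv_word x" "inv_word (inv_word w) = w"
  "length (inv_word w) = length w"
  by (auto simp: inv_word_def rev_map comp_def)

lemma set_inv_word: "set (inv_word w) = flip ` set w"
  by (simp add: inv_word_def)

lemma set_inv_word_subset [simp]: "set (inv_word w) \<subseteq> S \<times> UNIV \<longleftrightarrow> set w \<subseteq> S \<times> UNIV"
  by (force simp: set_inv_word flip_def)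

lemma reduced_word_iff: "reduced_word w \<longleftrightarrow> successively (\<lambda>l l'. l' \<noteq> flip l) w"
proof -
  have "(\<lambda>l l'. \<not> (fst l = fst l' \<and> snd l \<noteq> snd l')) = (\<lambda>l l'::'a \<times> bool. l' \<noteq> flip l)"
    by (auto simp: fun_eq_iff flip_def prod_eq_iff)
  then show ?thesis
    by (simp add: reduced_word_def)
qed

lemma reduced_word_Nil [simp]: "reduced_word []"
  by (simp add: reduced_word_iff)

lemma reduced_word_Cons: "reduced_word (l # w) \<longleftrightarrow> w = [] \<or> hd w \<noteq> flip l \<and> reduced_word w"
  by (simp add: reduced_word_iff successively_Cons)

lemma reduced_word_append:
  "reduced_word (x @ y) \<longleftrightarrow>
    reduced_word x \<and> reduced_word y \<and> (x \<noteq> [] \<longrightarrow> y \<noteq> [] \<longrightarrow> hd y \<noteq> flip (last x))"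
  by (auto simp: reduced_word_iff successively_append_iff)

text \<open>The reduced word is a stack with its top at the head. On reduced words
  \<open>push l\<close> is a bijection with inverse \<open>push (flip l)\<close>, so letters act on
  reduced words as in van der Waerden's proof of the normal form theorem.\<close>

definition push :: "'a \<times> bool \<Rightarrow> ('a \<times> bool) list \<Rightarrow> ('a \<times> bool) list"
  where "push l u = (if u \<noteq> [] \<and> hd u = flip l then tl u else l # u)"

definition red :: "('a \<times> bool) list \<Rightarrow> ('a \<times> bool) list"
  where "red w = foldr push w []"

lemma red_Nil [simp]: "red [] = []"
  by (simp add: red_def)

lemma red_Cons [simp]: "red (l # w) = push l (red w)"
  by (simp add: red_def)

lemma reduced_push: "reduced_word u \<Longrightarrow> reduced_word (push l u)"
  by (cases u) (auto simp: push_def reduced_word_Cons)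

lemma reduced_red [simp]: "reduced_word (red w)"
  by (induction w) (auto simp: reduced_push)

lemma red_reduced: "reduced_word w \<Longrightarrow> red w = w"
  by (induction w) (auto simp: reduced_word_Cons push_def)

lemma push_push_flip: "reduced_word u \<Longrightarrow> push l (push (flip l) u) = u"
  by (cases u) (auto simp: push_def reduced_word_Cons)

lemma set_push: "set (push l u) \<subseteq> insert l (set u)"
  by (cases u) (auto simp: push_def)

lemma set_red: "set (red w) \<subseteq> set w"
  by (induction w) (use set_push in force)+

lemma red_append: "red (x @ y) = foldr push x (red y)"
  by (induction x) auto

lemma red_cong_append: "red y = red y' \<Longrightarrow> red (x @ y) = red (x @ y')"
  by (simp add: red_append)

text \<open>Whatever respects prepending a letter and ignores a leading cancelling pair descends to
  the free group. Dependence on a context, such as a starting vertex or a monomial, is covered by a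
  function-valued \<open>f\<close>.\<close>

lemma red_invariant:
  assumes "\<And>l u v. f u = f v \<Longrightarrow> f (l # u) = f (l # v)" and "\<And>l u. f (l # flip l # u) = f u"
  shows "f (red w) = f w"
proof (induction w)
  case (Cons l w)
  have "f (push l u) = f (l # u)" for u
  proof (cases "u \<noteq> [] \<and> hd u = flip l")
    case True
    then have "u = flip l # tl u"
      by (metis list.collapse)
    then show ?thesis
      using True assms(2)[of l "tl u"] by (simp add: push_def)
  qed (auto simp: push_def)
  then show ?case
    using Cons assms(1) by (metis red_Cons)
qed simp

lemma red_append_red: "red (red x @ y) = red (x @ y)"
  by (rule red_invariant[of "\<lambda>x. red (x @ y)"]) (auto simp: push_push_flip)

lemma red_inv_word_cancel: "red (w @ inv_word w) = []" "red (inv_word w @ w) = []"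
proof -
  have *: "red (w @ inv_word w) = []" for w :: "('a \<times> bool) list"
  proof (induction w)
    case (Cons l w)
    have "red ((w @ inv_word w) @ [flip l]) = red (red (w @ inv_word w) @ [flip l])"
      by (simp only: red_append_red)
    then show ?case
      using Cons push_push_flip[of "[]" l] by simp
  qed simp
  show "red (w @ inv_word w) = []" by (rule *)
  show "red (inv_word w @ w) = []" using *[of "inv_word w"] by simp
qed

lemma red_inv_word_append_eq_Nil:
  assumes "red (inv_word u @ v) = []"
  shows "red u = red v"
proof -
  have "red v = red ((u @ inv_word u) @ v)"
    by (metis append_Nil red_append_red red_inv_word_cancel(1))
  also have "\<dots> = red (u @ inv_word u @ v)"
    by simp
  also have "\<dots> = red u"
    using red_cong_append[of "inv_word u @ v" "[]" u] assms by simp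
  finally show ?thesis ..
qed

section \<open>Exponent sums and powers of words\<close>

definition esum :: "'a \<Rightarrow> ('a \<times> bool) list \<Rightarrow> int"
  where "esum x w = (\<Sum>l\<leftarrow>w. if fst l = x then if snd l then 1 else -1 else 0)"

lemma esum_simps [simp]:
  "esum x [] = 0" "esum x (l # w) = (if fst l = x then if snd l then 1 else -1 else 0) + esum x w"
  "esum x (u @ v) = esum x u + esum x v"
  by (auto simp: esum_def)

lemma esum_inv_word [simp]: "esum x (inv_word w) = - esum x w"
  by (induction w) auto

lemma esum_red [simp]: "esum x (red w) = esum x w"
  by (rule red_invariant) auto

definition wpow :: "nat \<Rightarrow> 'a list \<Rightarrow> 'a list"
  where "wpow n w = concat (replicate n w)"

lemma wpow_simps [simp]:
  "wpow 0 w = []" "wpow (Suc n) w = w @ wpow n w" "wpow n [] = []"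
  by (auto simp: wpow_def)

lemma wpow_add: "wpow (m + n) w = wpow m w @ wpow n w"
  by (simp add: wpow_def replicate_add)

lemma set_wpow: "set (wpow n w) \<subseteq> set w"
  by (induction n) auto

context group
begin

lemma letter_val_closed: "fst l \<in> carrier G \<Longrightarrow> letter_val G l \<in> carrier G"
  by (simp add: letter_val_def)

lemma letter_val_flip: "fst l \<in> carrier G \<Longrightarrow> letter_val G (flip l) = inv (letter_val G l)"
  by (simp add: letter_val_def)

lemma word_val_Nil [simp]: "word_val G [] = \<one>"
  by (simp add: word_val_def)

lemma word_val_Cons [simp]: "word_val G (l # w) = letter_val G l \<otimes> word_val G w"
  by (simp add: word_val_def)

lemma word_val_closed: "set w \<subseteq> carrier G \<times> UNIV \<Longrightarrow> word_val G w \<in> carrier G"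
  by (induction w) (auto simp: letter_val_closed)

lemma word_val_append:
  "set x \<subseteq> carrier G \<times> UNIV \<Longrightarrow> set y \<subseteq> carrier G \<times> UNIV \<Longrightarrow>
    word_val G (x @ y) = word_val G x \<otimes> word_val G y"
  by (induction x) (auto simp: letter_val_closed word_val_closed m_assoc)

lemma word_val_inv_word:
  "set w \<subseteq> carrier G \<times> UNIV \<Longrightarrow> word_val G (inv_word w) = inv (word_val G w)"
proof (induction w)
  case (Cons l w)
  then have "set (inv_word w) \<subseteq> carrier G \<times> UNIV" "fst l \<in> carrier G"
    by auto
  moreover have "set [flip l] \<subseteq> carrier G \<times> UNIV"
    using Cons.prems by (cases l) (simp add: flip_def)
  ultimately show ?case
    using Cons
    by (simp add: word_val_append letter_val_closed word_val_closed letter_val_flip inv_mult_group)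
qed simp

lemma word_val_wpow:
  "set w \<subseteq> carrier G \<times> UNIV \<Longrightarrow> word_val G (wpow n w) = word_val G w [^] n"
proof (induction n)
  case (Suc n)
  then show ?case
    by (simp only: wpow_simps word_val_append[OF Suc.prems subset_trans[OF set_wpow Suc.prems]]
        nat_pow_Suc2[OF word_val_closed])
qed simp

lemma word_val_push:
  assumes "fst l \<in> carrier G" "set u \<subseteq> carrier G \<times> UNIV"
  shows "word_val G (push l u) = letter_val G l \<otimes> word_val G u"
proof (cases "u \<noteq> [] \<and> hd u = flip l")
  case True
  then have u: "u = flip l # tl u"
    by (metis list.collapse)
  then have "set (tl u) \<subseteq> carrier G \<times> UNIV"
    using assms(2) by (metis set_subset_Cons subset_trans)
  moreover have "word_val G u = inv (letter_val G l) \<otimes> word_val G (tl u)"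
    by (subst u) (simp add: letter_val_flip assms)
  ultimately show ?thesis
    using True assms by (simp add: push_def letter_val_closed word_val_closed flip: m_assoc)
qed (auto simp: push_def)

lemma word_val_red:
  "set w \<subseteq> carrier G \<times> UNIV \<Longrightarrow> word_val G (red w) = word_val G w"
proof (induction w)
  case (Cons l w)
  then have "set (red w) \<subseteq> carrier G \<times> UNIV" "fst l \<in> carrier G"
    using set_red[of w] by auto
  with Cons show ?case
    by (simp add: word_val_push)
qed simp

end

section \<open>Normal forms with respect to a basis\<close>

locale free_on = group F for F :: "('a, 'm) monoid_scheme" (structure) + fixes S :: "'a set"
  assumes basis: "free_basis F S"
begin

abbreviation bword :: "('a \<times> bool) list \<Rightarrow> bool"
  where "bword w \<equiv> set w \<subseteq> S \<times> UNIV"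

lemma S_subset: "S \<subseteq> carrier F"
  using basis by (simp add: free_basis_def)

lemma bword_carrier: "bword w \<Longrightarrow> set w \<subseteq> carrier F \<times> UNIV"
  using S_subset by blast

lemma bword_red: "bword w \<Longrightarrow> bword (red w)"
  using set_red by (rule subset_trans)

lemma word_val_eq_iff:
  assumes "bword u" "bword v"
  shows "word_val F u = word_val F v \<longleftrightarrow> red u = red v"
proof
  assume "word_val F u = word_val F v"
  then have "word_val F (red u) = word_val F (red v)"
    using assms by (simp add: word_val_red bword_carrier)
  moreover have "inj_on (word_val F) {w. bword w \<and> reduced_word w}"
    using basis by (auto simp: free_basis_def bij_betw_def)
  ultimately show "red u = red v"
    using assms bword_red by (auto dest!: inj_onD)
next
  assume "red u = red v"
  then show "word_val F u = word_val F v"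
    using assms by (metis bword_carrier word_val_red)
qed

lemma word_exists:
  assumes "x \<in> carrier F"
  obtains w where "bword w" "reduced_word w" "word_val F w = x"
  using basis assms by (force simp: free_basis_def bij_betw_def)

definition nf :: "'a \<Rightarrow> ('a \<times> bool) list"
  where "nf x = (SOME w. bword w \<and> reduced_word w \<and> word_val F w = x)"

lemma nf:
  assumes "x \<in> carrier F"
  shows "bword (nf x)" "reduced_word (nf x)" "word_val F (nf x) = x"
proof -
  have "bword (nf x) \<and> reduced_word (nf x) \<and> word_val F (nf x) = x"
    unfolding nf_def using assms by (rule_tac someI_ex) (metis word_exists)
  then show "bword (nf x)" "reduced_word (nf x)" "word_val F (nf x) = x"
    by auto
qed

lemma nf_word_val: "bword w \<Longrightarrow> nf (word_val F w) = red w"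
  by (metis nf bword_carrier red_reduced word_val_closed word_val_eq_iff)

end

section \<open>Schreier graphs\<close>

lemma finite_argmax:
  fixes f :: "'b \<Rightarrow> 'c::linorder"
  assumes "finite P" "P \<noteq> {}"
  obtains m where "m \<in> P" "\<And>p. p \<in> P \<Longrightarrow> f p \<le> f m"
proof -
  have "Max (f ` P) \<in> f ` P"
    using assms by (intro Max_in) auto
  then obtain m where "m \<in> P" "f m = Max (f ` P)"
    by auto
  then show thesis
    using assms(1) by (intro that[of m]) auto
qed

text \<open>\<open>step\<close> is total and invertible for all vertices and letters, including
  letters outside \<open>S\<close>, so that walks and their inverses carry no side
  conditions.\<close>

locale schreier_graph =
  fixes S :: "'a set" and V :: "'v set" and step :: "'v \<Rightarrow> 'a \<times> bool \<Rightarrow> 'v" and base :: 'v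
  assumes base_in: "base \<in> V"
    and step_in: "v \<in> V \<Longrightarrow> step v l \<in> V"
    and step_flip [simp]: "step (step v l) (flip l) = v"
    and connected: "v \<in> V \<Longrightarrow> \<exists>w. set w \<subseteq> S \<times> UNIV \<and> foldl step base w = v"
begin

abbreviation walk :: "'v \<Rightarrow> ('a \<times> bool) list \<Rightarrow> 'v"
  where "walk \<equiv> foldl step"

lemma walk_in: "v \<in> V \<Longrightarrow> walk v w \<in> V"
  by (induction w arbitrary: v) (auto simp: step_in)

lemma step_flip' [simp]: "step (step v (flip l)) l = v"
  using step_flip[of v "flip l"] by simp

lemma step_eq_iff: "step v l = u \<longleftrightarrow> v = step u (flip l)"
  by auto

lemma walk_inv_word [simp]: "walk (walk v w) (inv_word w) = v"
  by (induction w arbitrary: v) auto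

text \<open>\<open>edge v l\<close> encodes the passage from \<open>v\<close> along \<open>l\<close> as a positive edge \<open>(v', s)\<close> together with
  the direction in which it is traversed.\<close>

definition edge :: "'v \<Rightarrow> 'a \<times> bool \<Rightarrow> ('v \<times> 'a) \<times> bool"
  where "edge v l = (if snd l then (v, fst l) else (step v l, fst l), snd l)"

lemma edge_flip [simp]: "edge (step v l) (flip l) = flip (edge v l)"
  using step_flip[of v l] by (auto simp: edge_def flip_def simp del: step_flip)

lemma edge_inj: "edge v l = edge v' l' \<longleftrightarrow> v = v' \<and> l = l'"
  by (cases l; cases l') (auto simp: edge_def step_eq_iff split: if_splits)

lemma edge_flip_eq_iff: "edge v l = flip (edge v' l') \<longleftrightarrow> v = step v' l' \<and> l = flip l'"
  by (metis edge_flip edge_inj)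

lemma fst_edge_eq_iff:
  "fst (edge v l) = fst (edge v' l') \<longleftrightarrow> v = v' \<and> l = l' \<or> v = step v' l' \<and> l = flip l'"
proof -
  have "fst e = fst e' \<longleftrightarrow> e = e' \<or> e = flip e'" for e e' :: "('v \<times> 'a) \<times> bool"
    by (auto simp: flip_def prod_eq_iff)
  then show ?thesis
    by (simp add: edge_inj edge_flip_eq_iff)
qed

text \<open>\<open>D\<close> marks the edges to be ignored. Ignoring the tree edges yields the
  rewriting of a walk in Schreier generators; ignoring nothing records every crossing with its
  direction, ready for signed counts.\<close>

fun cross :: "('v \<Rightarrow> 'a \<times> bool \<Rightarrow> bool) \<Rightarrow> 'v \<Rightarrow> ('a \<times> bool) list \<Rightarrow> (('v \<times> 'a) \<times> bool) list"
  where
    "cross D v [] = []"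
  | "cross D v (l # w) = (if D v l then [] else [edge v l]) @ cross D (step v l) w"

lemma cross_append: "cross D v (x @ y) = cross D v x @ cross D (walk v x) y"
  by (induction x arbitrary: v) auto

definition undirected :: "('v \<Rightarrow> 'a \<times> bool \<Rightarrow> bool) \<Rightarrow> bool"
  where "undirected D \<longleftrightarrow> (\<forall>v l. D (step v l) (flip l) = D v l)"

lemma cross_inv_word:
  assumes "undirected D"
  shows "cross D (walk v w) (inv_word w) = inv_word (cross D v w)"
  using assms by (induction w arbitrary: v) (auto simp: cross_append undirected_def)

text \<open>A cancelling pair of letters crosses one edge back and forth. As \<open>D\<close> does
  not see directions, both crossings are ignored or both are kept, and then they cancel too.\<close>

lemma red_cross_red:
  assumes "undirected D"
  shows "red (cross D v (red w)) = red (cross D v w)"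
proof (rule fun_cong[OF red_invariant[of "\<lambda>w v. red (cross D v w)"]])
  show "(\<lambda>v. red (cross D v (l # flip l # u))) = (\<lambda>v. red (cross D v u))" for l u
  proof
    fix v
    have "push (edge v l) (push (flip (edge v l)) (red (cross D v u))) = red (cross D v u)"
      by (simp add: push_push_flip)
    moreover have "D (step v l) (flip l) = D v l"
      using assms unfolding undirected_def by blast
    ultimately show "red (cross D v (l # flip l # u)) = red (cross D v u)"
      by simp
  qed
next
  fix l u w assume "(\<lambda>v. red (cross D v u)) = (\<lambda>v. red (cross D v w))"
  then show "(\<lambda>v. red (cross D v (l # u))) = (\<lambda>v. red (cross D v (l # w)))"
    by (auto simp: fun_eq_iff intro!: red_cong_append)
qed

lemma set_cross:
  assumes "v \<in> V" "set w \<subseteq> S \<times> UNIV" "undirected D" "e \<in> set (cross D v w)"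
  shows "fst (fst e) \<in> V \<and> snd (fst e) \<in> S \<and> \<not> D (fst (fst e)) (snd (fst e), True)"
  using assms
proof (induction w arbitrary: v)
  case (Cons l w)
  have "fst l \<in> S"
    using Cons.prems(2) by auto
  show ?case
  proof (cases "\<not> D v l \<and> e = edge v l")
    case True
    then show ?thesis
    proof (cases "snd l")
      case True
      then show ?thesis
        using \<open>\<not> D v l \<and> e = edge v l\<close> Cons.prems(1) \<open>fst l \<in> S\<close>
        by (cases l) (auto simp: edge_def)
    next
      case False
      then have "flip l = (fst l, True)"
        by (simp add: flip_def)
      moreover have "\<not> D (step v l) (flip l)"
        using True Cons.prems(3) unfolding undirected_def by blast
      ultimately show ?thesis
        using True False Cons.prems(1) \<open>fst l \<in> S\<close> step_in by (auto simp: edge_def)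
    qed
  next
    case False
    then show ?thesis
      using Cons step_in by (auto split: if_splits)
  qed
qed simp

section \<open>A breadth-first spanning tree\<close>

definition dist :: "'v \<Rightarrow> nat"
  where "dist v = (LEAST n. \<exists>w. set w \<subseteq> S \<times> UNIV \<and> length w = n \<and> walk base w = v)"

text \<open>Choosing for each vertex one neighbour nearer to \<open>base\<close> yields a spanning
  tree: \<open>dist\<close> drops along parents, so there are no cycles. \<open>parent base\<close>
  is arbitrary, hence the exclusion of \<open>base\<close> in \<open>tree_edge\<close>.\<close>

definition parent :: "'v \<Rightarrow> 'a \<times> bool"
  where "parent v = (SOME l. fst l \<in> S \<and> step v l \<in> V \<and> dist (step v l) < dist v)"

lemma dist_le: "set w \<subseteq> S \<times> UNIV \<Longrightarrow> walk base w = v \<Longrightarrow> dist v \<le> length w"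
  unfolding dist_def by (rule Least_le) auto

lemma parent:
  assumes "v \<in> V" "v \<noteq> base"
  shows "fst (parent v) \<in> S" "step v (parent v) \<in> V" "dist (step v (parent v)) < dist v"
proof -
  have "\<exists>w. set w \<subseteq> S \<times> UNIV \<and> length w = dist v \<and> walk base w = v"
    unfolding dist_def by (rule LeastI_ex) (use connected[OF assms(1)] in blast)
  then obtain w where w: "set w \<subseteq> S \<times> UNIV" "length w = dist v" "walk base w = v"
    by blast
  then obtain u l where wu: "w = u @ [l]"
    using assms(2) by (cases w rule: rev_cases) auto
  have "step v (flip l) = walk base u"
    using w(3) by (auto simp: wu)
  moreover have "dist (walk base u) \<le> length u"
    by (rule dist_le) (use w wu in auto)
  ultimately have "fst (flip l) \<in> S \<and> step v (flip l) \<in> V \<and> dist (step v (flip l)) < dist v"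
    using w wu walk_in[OF base_in] by auto
  then have "fst (parent v) \<in> S \<and> step v (parent v) \<in> V \<and> dist (step v (parent v)) < dist v"
    unfolding parent_def by (rule someI)
  then show "fst (parent v) \<in> S" "step v (parent v) \<in> V" "dist (step v (parent v)) < dist v"
    by auto
qed

text \<open>The counter is fuel that makes the recursion structural. Since \<open>dist\<close> drops
  at every step, \<open>dist v\<close> units suffice, and more change nothing.\<close>

fun climb :: "nat \<Rightarrow> 'v \<Rightarrow> ('a \<times> bool) list"
  where
    "climb 0 v = []"
  | "climb (Suc n) v =
      (if v = base then [] else climb n (step v (parent v)) @ [flip (parent v)])"

definition tree_path :: "'v \<Rightarrow> ('a \<times> bool) list"
  where "tree_path v = climb (dist v) v"

definition tree_edge :: "'v \<Rightarrow> 'a \<times> bool \<Rightarrow> bool"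
  where "tree_edge v l \<longleftrightarrow>
    v \<in> V \<and> (v \<noteq> base \<and> l = parent v \<or> step v l \<noteq> base \<and> flip l = parent (step v l))"

lemma undirected_tree_edge: "undirected tree_edge"
proof -
  have "step v l \<in> V \<longleftrightarrow> v \<in> V" for v l
    using step_in step_flip by metis
  then show ?thesis
    by (auto simp: undirected_def tree_edge_def)
qed

lemma climb:
  assumes "v \<in> V" "dist v \<le> n"
  shows "set (climb n v) \<subseteq> S \<times> UNIV \<and> walk base (climb n v) = v \<and>
    cross tree_edge base (climb n v) = []"
  using assms
proof (induction n arbitrary: v)
  case 0
  then show ?case
    using parent(3) by fastforce
next
  case (Suc n)
  show ?case
  proof (cases "v = base")
    case False
    note p = parent[OF Suc.prems(1) False]
    let ?u = "step v (parent v)"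
    have IH: "set (climb n ?u) \<subseteq> S \<times> UNIV \<and> walk base (climb n ?u) = ?u \<and>
        cross tree_edge base (climb n ?u) = []"
      using p Suc by (intro Suc.IH) auto
    have "fst (flip (parent v)) \<in> S"
      using p by simp
    then have "flip (parent v) \<in> S \<times> UNIV"
      by (metis SigmaI UNIV_I prod.collapse)
    moreover have "tree_edge ?u (flip (parent v))"
      using False p by (simp add: tree_edge_def)
    ultimately show ?thesis
      using IH False by (simp add: cross_append)
  qed simp
qed

lemma tree_path:
  assumes "v \<in> V"
  shows "set (tree_path v) \<subseteq> S \<times> UNIV" "walk base (tree_path v) = v"
    "cross tree_edge base (tree_path v) = []"
  using climb[OF assms order_refl] by (auto simp: tree_path_def)

lemma tree_path_base [simp]: "tree_path base = []"
  by (cases "dist base") (auto simp: tree_path_def)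

lemma climb_stable:
  assumes "v \<in> V" "dist v \<le> n"
  shows "climb n v = climb (dist v) v"
  using assms
proof (induction n arbitrary: v rule: less_induct)
  case (less n)
  show ?case
  proof (cases "v = base")
    case True
    then show ?thesis
      by (cases n; cases "dist v") auto
  next
    case False
    note p = parent[OF less.prems(1) False]
    let ?u = "step v (parent v)"
    obtain d where d: "dist v = Suc d"
      using p(3) by (cases "dist v") auto
    obtain m where m: "n = Suc m"
      using less.prems(2) d by (cases n) auto
    have "climb m ?u = climb (dist ?u) ?u"
      using less.IH[of m ?u] less.prems(2) p d m by simp
    moreover have "climb d ?u = climb (dist ?u) ?u"
      using less.IH[of d ?u] less.prems(2) p d m by simp
    ultimately show ?thesis
      using False by (simp add: d m)
  qed
qed

lemma tree_path_step:
  assumes "v \<in> V" "v \<noteq> base"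
  shows "tree_path v = tree_path (step v (parent v)) @ [flip (parent v)]"
proof -
  note p = parent[OF assms]
  obtain d where d: "dist v = Suc d"
    using p(3) by (cases "dist v") auto
  have "climb d (step v (parent v)) = climb (dist (step v (parent v))) (step v (parent v))"
    using p d by (intro climb_stable) auto
  then show ?thesis
    using assms(2) by (simp add: tree_path_def d)
qed

section \<open>Chords and Schreier generators\<close>

definition chords :: "('v \<times> 'a) set"
  where "chords = {(v, s). v \<in> V \<and> s \<in> S \<and> \<not> tree_edge v (s, True)}"

definition chord_loop :: "'v \<times> 'a \<Rightarrow> ('a \<times> bool) list"
  where "chord_loop e =
    tree_path (fst e) @ [(snd e, True)] @ inv_word (tree_path (step (fst e) (snd e, True)))"

definition expand :: "(('v \<times> 'a) \<times> bool) list \<Rightarrow> ('a \<times> bool) list"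
  where "expand u = concat (map (\<lambda>l. if snd l then chord_loop (fst l) else inv_word (chord_loop (fst l))) u)"

lemma expand_simps [simp]:
  "expand [] = []"
  "expand (l # u) = (if snd l then chord_loop (fst l) else inv_word (chord_loop (fst l))) @ expand u"
  "expand (u @ u') = expand u @ expand u'"
  by (auto simp: expand_def)

lemma chord_loop:
  assumes "e \<in> chords"
  shows "set (chord_loop e) \<subseteq> S \<times> UNIV" "walk base (chord_loop e) = base"
    "cross tree_edge base (chord_loop e) = [(e, True)]"
proof -
  let ?v = "fst e" and ?l = "(snd e, True)"
  have e: "?v \<in> V" "step ?v ?l \<in> V" "snd e \<in> S" "\<not> tree_edge ?v ?l"
    using assms step_in by (auto simp: chords_def)
  have "walk (step ?v ?l) (inv_word (tree_path (step ?v ?l))) = base"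
    using walk_inv_word[of base "tree_path (step ?v ?l)"] tree_path[OF e(2)] by simp
  moreover have "cross tree_edge (step ?v ?l) (inv_word (tree_path (step ?v ?l))) = []"
    using cross_inv_word[OF undirected_tree_edge, of base "tree_path (step ?v ?l)"]
      tree_path[OF e(2)] by simp
  ultimately show "set (chord_loop e) \<subseteq> S \<times> UNIV" "walk base (chord_loop e) = base"
    "cross tree_edge base (chord_loop e) = [(e, True)]"
    using e tree_path[OF e(1)] tree_path[OF e(2)]
    by (auto simp: chord_loop_def cross_append edge_def)
qed

text \<open>A chord loop crosses a single chord, its own, because the rest of it runs in the tree.
  So reading off the crossed chords undoes the expansion; this is what will make the Schreier
  generators free.\<close>

lemma expand:
  assumes "set u \<subseteq> chords \<times> UNIV"
  shows "set (expand u) \<subseteq> S \<times> UNIV" "walk base (expand u) = base"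
    "cross tree_edge base (expand u) = u"
proof -
  have "set (expand u) \<subseteq> S \<times> UNIV \<and> walk base (expand u) = base \<and>
      cross tree_edge base (expand u) = u"
    using assms
  proof (induction u)
    case (Cons l u)
    have e: "fst l \<in> chords"
      using Cons.prems by auto
    note loop = chord_loop[OF e]
    have "walk base (inv_word (chord_loop (fst l))) = base"
      using walk_inv_word[of base "chord_loop (fst l)"] loop by simp
    moreover have "cross tree_edge base (inv_word (chord_loop (fst l))) = [(fst l, False)]"
      using cross_inv_word[OF undirected_tree_edge, of base "chord_loop (fst l)"] loop
      by (simp add: flip_def)
    moreover have "set (inv_word (chord_loop (fst l))) \<subseteq> S \<times> UNIV"
      using loop by simp
    ultimately show ?case
      using Cons loop by (cases l) (simp add: cross_append)
  qed simp
  then show "set (expand u) \<subseteq> S \<times> UNIV" "walk base (expand u) = base"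
    "cross tree_edge base (expand u) = u"
    by auto
qed

end

section \<open>The Magnus order and stackings\<close>

text \<open>\<open>magnus m w\<close> is the coefficient of the monomial \<open>m\<close> in the image of \<open>w\<close> under the Magnus
  embedding \<open>s \<mapsto> 1 + s\<close> of a free group into the noncommutative formal power series ring.\<close>

fun magnus :: "'a list \<Rightarrow> ('a \<times> bool) list \<Rightarrow> int"
  where
    "magnus m [] = (if m = [] then 1 else 0)"
  | "magnus [] (l # w) = magnus [] w"
  | "magnus (x # m) (l # w) =
      magnus (x # m) w + (if x = fst l then if snd l then magnus m w else - magnus m (l # w) else 0)"

lemma magnus_Nil [simp]: "magnus [] w = 1"
  by (induction w) auto

lemma magnus_cancel: "magnus m (l # flip l # w) = magnus m w"
  by (induction m) auto

lemma magnus_red: "magnus m (red w) = magnus m w"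
proof (rule fun_cong[OF red_invariant[of "\<lambda>w m. magnus m w"]])
  fix l and u v :: "('a \<times> bool) list"
  assume eq: "(\<lambda>m. magnus m u) = (\<lambda>m. magnus m v)"
  have "magnus m (l # u) = magnus m (l # v)" for m
    using eq by (induction m) (auto simp: fun_eq_iff)
  then show "(\<lambda>m. magnus m (l # u)) = (\<lambda>m. magnus m (l # v))" ..
qed (auto simp: magnus_cancel)

text \<open>The Cauchy product of noncommutative power series: a monomial is cut into a prefix and a
  suffix in all ways.\<close>

lemma magnus_append:
  "magnus m (u @ v) = (\<Sum>i\<le>length m. magnus (take i m) u * magnus (drop i m) v)"
proof (induction m u rule: magnus.induct)
  case (1 m)
  have "(\<Sum>i\<le>length m. magnus (take i m) [] * magnus (drop i m) v) =
      (\<Sum>i\<le>length m. if i = 0 then magnus m v else 0)"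
    by (rule sum.cong) auto
  then show ?case
    by simp
next
  case (3 x m l w)
  then show ?case
    by (cases "x = fst l"; cases "snd l")
       (simp_all add: sum.atMost_Suc_shift algebra_simps sum.distrib sum_subtractf
         del: sum.atMost_Suc)
qed simp

text \<open>The coefficient at the alternating monomial that lists the syllables of a reduced word is the
  product of their exponents, which is nonzero.\<close>

lemma magnus_vanish:
  assumes "reduced_word w" "successively (\<noteq>) m"
    and "length m > length (remdups_adj (map fst w)) \<or>
      length m = length (remdups_adj (map fst w)) \<and> m \<noteq> [] \<and> hd m \<noteq> fst (hd w)"
  shows "magnus m w = 0"
  using assms
proof (induction w arbitrary: m)
  case Nil
  then show ?case by auto
next
  case (Cons l w)
  show ?case
  proof (cases m)
    case Nil
    then show ?thesis using Cons.prems by auto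
  next
    case [simp]: (Cons z m')
    have alt: "successively (\<noteq>) m'" and hd': "m' \<noteq> [] \<Longrightarrow> hd m' \<noteq> z"
      using Cons.prems(2) by (auto simp: successively_Cons)
    show ?thesis
    proof (cases "w = []")
      case True
      then show ?thesis
        using Cons.prems hd' by (cases m') auto
    next
      case False
      then have rw: "reduced_word w"
        using Cons.prems(1) by (simp add: reduced_word_Cons)
      have len: "length (remdups_adj (map fst (l # w))) =
          (if fst l = fst (hd w) then 0 else 1) + length (remdups_adj (map fst w))"
        using False by (cases w) auto
      have pos: "length (remdups_adj (map fst w)) > 0"
        using False by simp
      have m'_l: "magnus m' (l # w) = magnus m' w" if "z = fst l"
        using that hd' by (cases m') auto
      have "magnus m w = 0"
        using Cons.prems rw len by (intro Cons.IH) (auto split: if_splits)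
      moreover have "magnus m' w = 0" if "z = fst l"
      proof -
        have len': "length m' \<ge> length (remdups_adj (map fst w))"
          using Cons.prems(3) that len by (auto split: if_splits)
        then have ne: "m' \<noteq> []"
          using pos by (metis list.size(3) not_le)
        then have "hd m' \<noteq> fst l"
          using hd' that by simp
        then show ?thesis
          using Cons.prems rw len len' alt that ne by (intro Cons.IH) (auto split: if_splits)
      qed
      ultimately show ?thesis
        using m'_l by auto
    qed
  qed
qed

text \<open>If the syllables have exponents e1, ..., ek, the two coefficients are e1 e2 ... ek and
  e2 ... ek, so with the sign of e1 the product is |e1| times a square. The sign is what the
  induction needs: a further letter in the first syllable adds a square, so nothing can
  cancel.\<close>

lemma magnus_syllables:
  assumes "reduced_word w" "w \<noteq> []"
  shows "magnus (remdups_adj (map fst w)) w * magnus (tl (remdups_adj (map fst w))) w *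
    (if snd (hd w) then 1 else -1) > 0"
  using assms
proof (induction w)
  case (Cons l w)
  show ?case
  proof (cases "w = []")
    case False
    then have rw: "reduced_word w" and hdw: "hd w \<noteq> flip l"
      using Cons.prems by (auto simp: reduced_word_Cons)
    let ?s = "remdups_adj (map fst w)" and ?e = "if snd l then 1 else -1 :: int"
    obtain m' where s: "?s = fst (hd w) # m'"
      using False by (cases w) (auto simp: neq_Nil_conv split: if_splits, metis remdups_adj_Cons_alt)
    have alt: "successively (\<noteq>) ?s"
      by (simp add: distinct_adj_def[symmetric])
    have IH: "magnus ?s w * magnus m' w * (if snd (hd w) then 1 else -1) > 0"
      using Cons.IH[OF rw False] s by simp
    show ?thesis
    proof (cases "fst (hd w) = fst l")
      case True
      then have sgn: "snd (hd w) = snd l"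
        using hdw by (auto simp: flip_def prod_eq_iff)
      have s': "remdups_adj (map fst (l # w)) = ?s"
        using True False by (cases w) auto
      have m': "magnus m' (l # w) = magnus m' w"
        using alt True s by (cases m') (auto simp: successively_Cons)
      have "magnus ?s (l # w) = magnus ?s w + ?e * magnus m' w"
        using True m' by (simp add: s)
      then have "magnus ?s (l # w) * magnus m' w * ?e =
          magnus ?s w * magnus m' w * ?e + magnus m' w * magnus m' w"
        by (simp add: algebra_simps)
      then show ?thesis
        using IH sgn m' s s' by (simp add: add_pos_nonneg del: magnus.simps)
    next
      case neq: False
      have s': "remdups_adj (map fst (l # w)) = fst l # ?s"
        using neq False by (cases w) auto
      have "magnus ?s (l # w) = magnus ?s w"
        using neq by (simp add: s)
      moreover have "magnus (fst l # ?s) w = 0"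
        using rw alt neq by (intro magnus_vanish) (auto simp: successively_Cons s)
      ultimately have "magnus (fst l # ?s) (l # w) = ?e * magnus ?s w"
        "magnus ?s (l # w) = magnus ?s w"
        by simp_all
      moreover have "magnus ?s w \<noteq> 0"
        using IH by auto
      then have "magnus ?s w * magnus ?s w > 0"
        by (metis linorder_neqE_linordered_idom mult_neg_neg mult_pos_pos)
      ultimately show ?thesis
        unfolding s' by (simp del: magnus.simps)
    qed
  qed simp
qed simp

text \<open>The series of u^-1 v is that of the empty word, whereas a nonempty reduced word has a
  nonzero coefficient at its own syllables.\<close>

lemma magnus_faithful:
  assumes "\<And>m. magnus m u = magnus m v"
  shows "red u = red v"
proof -
  have eq: "magnus m (inv_word u @ v) = magnus m []" for m
  proof -
    have "magnus m (inv_word u @ v) = magnus m (inv_word u @ u)"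
      by (simp add: magnus_append assms)
    also have "\<dots> = magnus m []"
      by (metis magnus_red red_inv_word_cancel(2))
    finally show ?thesis .
  qed
  have "red (inv_word u @ v) = []"
  proof (rule ccontr)
    let ?z = "red (inv_word u @ v)"
    assume z: "?z \<noteq> []"
    have "magnus (remdups_adj (map fst ?z)) ?z \<noteq> 0"
      using magnus_syllables[OF reduced_red z] by auto
    moreover have "magnus (remdups_adj (map fst ?z)) ?z = 0"
      using z by (subst magnus_red) (simp add: eq)
    ultimately show False by simp
  qed
  then show ?thesis
    by (rule red_inv_word_append_eq_Nil)
qed

text \<open>This order is invariant under multiplication on both sides, because multiplication by a series
  with constant term 1 does not change leading terms.\<close>

definition magnus_less :: "('a::wellorder \<times> bool) list \<Rightarrow> ('a \<times> bool) list \<Rightarrow> bool"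
  where "magnus_less u v \<longleftrightarrow> (\<exists>m. magnus m u < magnus m v \<and> (\<forall>m'<m. magnus m' u = magnus m' v))"

lemma magnus_less_irrefl: "\<not> magnus_less u u"
  by (auto simp: magnus_less_def)

lemma magnus_less_trans: "magnus_less u v \<Longrightarrow> magnus_less v w \<Longrightarrow> magnus_less u w"
  unfolding magnus_less_def
proof (elim exE conjE)
  fix m n assume *: "magnus m u < magnus m v" "\<forall>m'<m. magnus m' u = magnus m' v"
    "magnus n v < magnus n w" "\<forall>m'<n. magnus m' v = magnus m' w"
  show "\<exists>m. magnus m u < magnus m w \<and> (\<forall>m'<m. magnus m' u = magnus m' w)"
    by (rule exI[of _ "min m n"], cases m n rule: linorder_cases)
       (use * in \<open>auto simp: min_def intro: less_trans\<close>)
qed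

lemma magnus_less_total:
  assumes "\<not> magnus_less u v" "\<not> magnus_less v u"
  shows "red u = red v"
proof (rule magnus_faithful, rule ccontr)
  fix m assume "magnus m u \<noteq> magnus m v"
  then have ex: "\<exists>m. magnus m u \<noteq> magnus m v" by blast
  define n where "n = (LEAST m. magnus m u \<noteq> magnus m v)"
  have "magnus n u \<noteq> magnus n v"
    unfolding n_def using ex by (rule LeastI_ex)
  moreover have "\<forall>m'<n. magnus m' u = magnus m' v"
    using not_less_Least n_def by blast
  ultimately show False
    using assms unfolding magnus_less_def by (metis linorder_neqE_linordered_idom)
qed

lemma magnus_less_red: "magnus_less (red u) (red v) \<longleftrightarrow> magnus_less u v"
  by (simp add: magnus_less_def magnus_red)

lemma length_le_if_less: "xs < ys \<Longrightarrow> length xs \<le> length ys"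
  and less_if_length_less: "length xs < length ys \<Longrightarrow> xs < ys" for xs :: "'a::ord list"
  by (auto simp: list_less_def lenlex_conv)

lemma magnus_less_append:
  assumes "magnus_less u v"
  shows "magnus_less (w @ u) (w @ v)" "magnus_less (u @ w) (v @ w)"
proof -
  obtain m where m: "magnus m u < magnus m v" "\<And>m'. m' < m \<Longrightarrow> magnus m' u = magnus m' v"
    using assms by (auto simp: magnus_less_def)
  \<comment> \<open>Monomials are compared by length first, so proper prefixes and suffixes of a
    monomial up to \<open>m\<close> are shorter than \<open>m\<close>, and there \<open>u\<close>
    and \<open>v\<close> agree. Only the summand with the whole monomial survives, multiplied by the
    constant term 1 of \<open>w\<close>.\<close>
  have le: "magnus m' u = magnus m' v" if "length m' < length m" for m'
    using that by (intro m(2) less_if_length_less)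
  have len: "length m' \<le> length m" if "m' \<le> m" for m'
    using that length_le_if_less by (auto simp: list_le_def)
  have "magnus m' (w @ v) - magnus m' (w @ u) = magnus m' v - magnus m' u" if "m' \<le> m" for m'
  proof -
    have "magnus m' (w @ v) - magnus m' (w @ u) = (\<Sum>i\<le>length m'.
        magnus (take i m') w * (magnus (drop i m') v - magnus (drop i m') u))"
      by (simp add: magnus_append right_diff_distrib sum_subtractf)
    also have "\<dots> = (\<Sum>i\<le>length m'. if i = 0 then magnus m' v - magnus m' u else 0)"
      using len[OF that] le by (intro sum.cong) auto
    finally show ?thesis by simp
  qed
  then show "magnus_less (w @ u) (w @ v)"
    unfolding magnus_less_def using m by (intro exI[of _ m]) (smt (verit) less_imp_le order_refl)
  have "magnus m' (v @ w) - magnus m' (u @ w) = magnus m' v - magnus m' u" if "m' \<le> m" for m'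
  proof -
    have "magnus m' (v @ w) - magnus m' (u @ w) = (\<Sum>i\<le>length m'.
        (magnus (take i m') v - magnus (take i m') u) * magnus (drop i m') w)"
      by (simp add: magnus_append left_diff_distrib sum_subtractf)
    also have "\<dots> = (\<Sum>i\<le>length m'. if i = length m' then magnus m' v - magnus m' u else 0)"
      using len[OF that] le by (intro sum.cong) auto
    finally show ?thesis by simp
  qed
  then show "magnus_less (u @ w) (v @ w)"
    unfolding magnus_less_def using m by (intro exI[of _ m]) (smt (verit) less_imp_le order_refl)
qed

text \<open>Here u' and v' are the conjugates of u and v by w. With a letter for w this transports a
  comparison of two rotations of a cyclic word to the neighbouring rotations, and it needs
  invariance on both sides.\<close>

lemma magnus_less_conj:
  assumes "red (w @ u') = red (u @ w)" "red (w @ v') = red (v @ w)"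
  shows "magnus_less u' v' \<longleftrightarrow> magnus_less u v"
proof -
  have L: "magnus_less (w @ u) (w @ v) \<longleftrightarrow> magnus_less u v" for u v w :: "('a \<times> bool) list"
  proof
    assume "magnus_less (w @ u) (w @ v)"
    then have "magnus_less (inv_word w @ w @ u) (inv_word w @ w @ v)"
      by (rule magnus_less_append)
    moreover have "red (inv_word w @ w @ x) = red x" for x
      using red_append_red[of "inv_word w @ w" x] by (simp add: red_inv_word_cancel)
    ultimately show "magnus_less u v"
      by (metis magnus_less_red)
  qed (rule magnus_less_append)
  have R: "magnus_less (u @ w) (v @ w) \<longleftrightarrow> magnus_less u v" for u v w :: "('a \<times> bool) list"
  proof
    assume "magnus_less (u @ w) (v @ w)"
    then have "magnus_less ((u @ w) @ inv_word w) ((v @ w) @ inv_word w)"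
      by (rule magnus_less_append)
    moreover have "red ((x @ w) @ inv_word w) = red x" for x
      using red_cong_append[of "w @ inv_word w" "[]" x] by (simp add: red_inv_word_cancel)
    ultimately show "magnus_less u v"
      by (metis magnus_less_red)
  qed (rule magnus_less_append)
  show ?thesis
    by (metis L R assms magnus_less_red)
qed

section \<open>Periodic sequences and stackings of cyclic words\<close>

lemma periodic_mod:
  fixes f :: "int \<Rightarrow> 'b"
  assumes "\<And>p. f (p + L) = f p"
  shows "f (p + L * k) = f p" "f (p mod L) = f p"
proof -
  have *: "f (p + L * k) = f p" for p k
  proof (induction k arbitrary: p rule: int_induct[where k = 0])
    case (step1 k)
    then show ?case
      using assms[of "p + L * k"] by (simp add: algebra_simps)
  next
    case (step2 k)
    then show ?case
      using assms[of "p + L * (k - 1)"] by (simp add: algebra_simps)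
  qed simp
  show "f (p + L * k) = f p" by (rule *)
  show "f (p mod L) = f p"
    using *[of "p mod L" "p div L"] by simp
qed

lemma finite_range_periodic:
  fixes f :: "int \<Rightarrow> 'b"
  assumes "N > 0" "\<And>p. f (p + N) = f p"
  shows "finite (range f)"
proof -
  have "f p \<in> f ` {0..<N}" for p
  proof (rule image_eqI)
    show "f p = f (p mod N)"
      using periodic_mod(2)[of f N p, OF assms(2)] by (rule sym)
  qed (use assms(1) in simp)
  then have "range f \<subseteq> f ` {0..<N}"
    by (rule image_subsetI)
  then show ?thesis
    by (rule finite_subset) simp
qed

definition window :: "(int \<Rightarrow> 'b) \<Rightarrow> nat \<Rightarrow> int \<Rightarrow> 'b list"
  where "window l n p = map (\<lambda>t. l (p + int t)) [0..<n]"

lemma length_window [simp]: "length (window l n p) = n"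
  by (simp add: window_def)

lemma window_add: "window l (m + n) p = window l m p @ window l n (p + int m)"
  by (rule nth_equalityI) (auto simp: window_def nth_append algebra_simps)

lemma window_eq_iff: "window l n p = window k n q \<longleftrightarrow> (\<forall>t<n. l (p + int t) = k (q + int t))"
  by (auto simp: window_def)

lemma window_Cons: "window l (Suc n) p = l p # window l n (p + 1)"
  using window_add[of l 1 n p] by (simp add: window_def)

lemma window_snoc: "window l (Suc n) p = window l n p @ [l (p + int n)]"
  using window_add[of l n 1 p] by (simp add: window_def)

lemma reduced_window:
  assumes "\<And>p. l (p + 1) \<noteq> flip (l p)"
  shows "reduced_word (window l n p)"
proof -
  have "l (p + int (Suc t)) \<noteq> flip (l (p + int t))" for t
    using assms[of "p + int t"] by (simp add: algebra_simps)
  then show ?thesis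
    by (auto simp: reduced_word_iff successively_conv_nth window_def)
qed

lemma window_eq_imp_periodic:
  fixes l :: "int \<Rightarrow> 'b"
  assumes "L > 0" "\<And>p. l (p + int L) = l p" "window l L p = window l L q"
  shows "l (p + t) = l (q + t)"
proof -
  have "l (p + t) = l (p + t mod int L)"
    using periodic_mod(1)[of l "int L" "p + t mod int L" "t div int L"] assms(2)
    by (simp add: algebra_simps)
  also have "\<dots> = l (q + t mod int L)"
  proof -
    have "nat (t mod int L) < L"
      using assms(1) by (simp add: nat_less_iff)
    then have "l (p + int (nat (t mod int L))) = l (q + int (nat (t mod int L)))"
      using assms(3) unfolding window_eq_iff by blast
    then show ?thesis
      using assms(1) by simp
  qed
  also have "\<dots> = l (q + t)"
    using periodic_mod(1)[of l "int L" "q + t mod int L" "t div int L"] assms(2)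
    by (simp add: algebra_simps)
  finally show ?thesis .
qed

text \<open>The function \<open>h\<close> is a stacking of the cyclic word \<open>l\<close> in the sense of Louder and Wilton: it orders
  the cyclic rotations of \<open>l\<close> compatibly with reading a common letter, in either direction.\<close>

lemma stacking_exists:
  fixes l :: "int \<Rightarrow> 'a \<times> bool" and L :: nat
  assumes L: "L > 0" and per: "\<And>p. l (p + int L) = l p" and redd: "\<And>p. l (p + 1) \<noteq> flip (l p)"
    and prim: "\<And>p q. (\<And>t. l (p + t) = l (q + t)) \<Longrightarrow> int L dvd p - q"
  obtains h :: "int \<Rightarrow> nat" where "\<And>p q. h p = h q \<longleftrightarrow> int L dvd p - q"
    "\<And>p q. l p = l q \<Longrightarrow> h p < h q \<longleftrightarrow> h (p + 1) < h (q + 1)"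
    "\<And>p q. flip (l p) = l (q - 1) \<Longrightarrow> h p < h q \<longleftrightarrow> h (p + 1) < h (q - 1)"
proof -
  have "finite (range l)"
    by (rule finite_range_periodic[of "int L"]) (use L per in auto)
  then have "finite (range (fst \<circ> l))"
    by (metis finite_imageI image_comp)
  \<comment> \<open>The Magnus order needs well-ordered generators; the finitely many that occur are
    renamed to natural numbers.\<close>
  then obtain c :: "'a \<Rightarrow> nat" where c: "inj_on c (range (fst \<circ> l))"
    using finite_imp_inj_to_nat_seg by blast
  define k where "k p = map_prod c id (l p)" for p
  have k_eq: "k p = k q \<longleftrightarrow> l p = l q" for p q
    using c by (auto simp: k_def prod_eq_iff dest: inj_onD)
  have k_flip: "k p = flip (k q) \<longleftrightarrow> l p = flip (l q)" for p q
    using c by (auto simp: k_def prod_eq_iff dest: inj_onD)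
  define \<kappa> where "\<kappa> = window k L"
  have k_per: "k (p + int L) = k p" for p
    by (simp add: k_def per)
  have \<kappa>_red: "red (\<kappa> p) = \<kappa> p" for p
    unfolding \<kappa>_def by (intro red_reduced reduced_window) (simp add: k_flip redd)
  have \<kappa>_eq: "\<kappa> p = \<kappa> q \<longleftrightarrow> int L dvd p - q" for p q
  proof
    assume "\<kappa> p = \<kappa> q"
    then have "k (p + t) = k (q + t)" for t
      using window_eq_imp_periodic[of L k p q t] L k_per by (simp add: \<kappa>_def)
    then show "int L dvd p - q"
      by (intro prim) (simp add: k_eq)
  next
    assume "int L dvd p - q"
    then obtain j where "p - q = int L * j" ..
    then have "p = q + int L * j"
      by simp
    then have "k (p + t) = k (q + t)" for t
      using periodic_mod(1)[of k "int L" "q + t" j, OF k_per] by (simp add: algebra_simps)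
    then show "\<kappa> p = \<kappa> q"
      by (simp add: \<kappa>_def window_eq_iff)
  qed
  have step: "[k p] @ \<kappa> (p + 1) = \<kappa> p @ [k p]" for p
    using window_Cons[of k L p] window_snoc[of k L p] by (simp add: \<kappa>_def k_per)
  define less where "less p q \<longleftrightarrow> magnus_less (\<kappa> p) (\<kappa> q)" for p q
  have total: "less p q \<or> less q p \<or> \<kappa> p = \<kappa> q" for p q
    using magnus_less_total[of "\<kappa> p" "\<kappa> q"] by (auto simp: less_def \<kappa>_red)
  \<comment> \<open>The height of a rotation is its rank: the number of smaller rotations within one
    period.\<close>
  define h where "h p = card {q \<in> {0..<int L}. less q p}" for p
  have h_mono: "h p < h q" if "less p q" for p q
  proof -
    have "less (p mod int L) q" "\<not> less (p mod int L) p"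
      using that magnus_less_irrefl \<kappa>_eq[of "p mod int L" p]
      by (auto simp: less_def mod_eq_dvd_iff[symmetric])
    moreover have "p mod int L \<in> {0..<int L}"
      using L by simp
    moreover have "less r q" if "less r p" for r
      using that \<open>less p q\<close> magnus_less_trans by (auto simp: less_def)
    ultimately show ?thesis
      unfolding h_def
      by (intro psubset_card_mono finite_subset[of "{q \<in> {0..<int L}. less q _}" "{0..<int L}"]) auto
  qed
  have h_less: "h p < h q \<longleftrightarrow> less p q" for p q
  proof
    assume "h p < h q"
    moreover have "h p = h q" if "\<kappa> p = \<kappa> q"
      using that by (simp add: h_def less_def)
    ultimately show "less p q"
      using total[of p q] h_mono[of q p] by auto
  qed (rule h_mono)
  show thesis
  proof (rule that[of h])
    show "h p = h q \<longleftrightarrow> int L dvd p - q" for p q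
      using h_less[of p q] h_less[of q p] total[of p q] magnus_less_irrefl
      by (auto simp: \<kappa>_eq[symmetric] less_def linorder_neq_iff)
    show "h p < h q \<longleftrightarrow> h (p + 1) < h (q + 1)" if "l p = l q" for p q
    proof -
      have "red ([k p] @ \<kappa> (p + 1)) = red (\<kappa> p @ [k p])"
        "red ([k p] @ \<kappa> (q + 1)) = red (\<kappa> q @ [k p])"
        using step[of p] step[of q] that by (simp_all only: k_eq[symmetric])
      then show ?thesis
        unfolding h_less less_def using magnus_less_conj by blast
    qed
    show "h p < h q \<longleftrightarrow> h (p + 1) < h (q - 1)" if "flip (l p) = l (q - 1)" for p q
    proof -
      \<comment> \<open>Reading the letter backwards, \<kappa> (q - 1) is the conjugate of \<kappa>
        q by \<open>k p\<close>, just as \<kappa> (p + 1) is the conjugate of \<kappa> p by the same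
        letter. So the comparison is again transported by a single conjugation.\<close>
      have kf: "k (q - 1) = flip (k p)"
        using that by (simp add: k_flip)
      have st: "\<kappa> (q - 1) @ [flip (k p)] = [flip (k p)] @ \<kappa> q"
        using step[of "q - 1"] by (simp only: kf diff_add_cancel)
      have "red ([k p] @ \<kappa> (q - 1)) = red (([k p] @ \<kappa> (q - 1)) @ [flip (k p)] @ [k p])"
        using red_cong_append[of "[flip (k p)] @ [k p]" "[]" "[k p] @ \<kappa> (q - 1)"]
          red_inv_word_cancel(2)[of "[k p]"] by simp
      also have "\<dots> = red ([k p] @ (\<kappa> (q - 1) @ [flip (k p)]) @ [k p])"
        by simp
      also have "\<dots> = red ([k p] @ ([flip (k p)] @ \<kappa> q) @ [k p])"
        by (simp only: st)
      also have "\<dots> = red (\<kappa> q @ [k p])"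
        using red_append_red[of "[k p] @ [flip (k p)]" "\<kappa> q @ [k p]"]
          red_inv_word_cancel(1)[of "[k p]"] by simp
      finally have "red ([k p] @ \<kappa> (q - 1)) = red (\<kappa> q @ [k p])" .
      moreover have "red ([k p] @ \<kappa> (p + 1)) = red (\<kappa> p @ [k p])"
        by (simp only: step)
      ultimately show ?thesis
        unfolding h_less less_def using magnus_less_conj by blast
    qed
  qed
qed

section \<open>Stretches without branching\<close>

context schreier_graph
begin

text \<open>An Euler characteristic count of half-edges. A chord has two of them. A tree edge in
  \<E> is named by its endpoint farther from \<open>base\<close>; the vertex \<open>v0\<close>
  nearest to \<open>base\<close> is no such endpoint, as its parent lies outside \<open>W\<close>.
  So there are at most |W| - 1 tree edges.\<close>

lemma degree_sum:
  assumes fin: "finite \<E>" and ne: "\<E> \<noteq> {}" and sub: "\<E> \<subseteq> V \<times> (S \<times> UNIV)"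
    and sym: "\<And>v l. (v, l) \<in> \<E> \<Longrightarrow> (step v l, flip l) \<in> \<E>" and chords: "finite chords"
  shows "(\<Sum>v\<in>fst ` \<E>. card (\<E> `` {v})) + 2 \<le> 2 * card (fst ` \<E>) + 2 * card chords"
proof -
  define W where "W = fst ` \<E>"
  have W: "finite W" "W \<noteq> {}" "W \<subseteq> V"
    using fin ne sub by (auto simp: W_def)
  obtain v0 where v0: "v0 \<in> W" "\<And>v. v \<in> W \<Longrightarrow> dist v0 \<le> dist v"
    using ex_is_arg_min_if_finite[OF W(1,2), of dist] by (auto simp: is_arg_min_def not_less)
  define On where "On = {(v, l) \<in> \<E>. \<not> tree_edge v l}"
  define Ot where "Ot = {(v, l) \<in> \<E>. tree_edge v l}"
  have "\<E> = On \<union> Ot"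
    by (auto simp: On_def Ot_def)
  then have "card \<E> \<le> card On + card Ot"
    by (simp add: card_Un_le)
  moreover have "card On \<le> 2 * card chords"
  proof -
    have "edge v l \<in> chords \<times> UNIV" if "(v, l) \<in> On" for v l
    proof -
      have v: "v \<in> V" "set [l] \<subseteq> S \<times> UNIV" "edge v l \<in> set (cross tree_edge v [l])"
        using that sub by (auto simp: On_def)
      show ?thesis
        using set_cross[OF v(1,2) undirected_tree_edge v(3)]
        by (simp add: chords_def mem_Times_iff case_prod_beta)
    qed
    then have "edge (fst e) (snd e) \<in> chords \<times> UNIV" if "e \<in> On" for e
      using that by (cases e) simp
    then have "(\<lambda>e. edge (fst e) (snd e)) ` On \<subseteq> chords \<times> UNIV"
      by (rule image_subsetI)
    moreover have "inj_on (\<lambda>e. edge (fst e) (snd e)) On"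
    proof (rule inj_onI)
      fix e e' assume "edge (fst e) (snd e) = edge (fst e') (snd e')"
      then have "fst e = fst e'" "snd e = snd e'"
        by (simp_all only: edge_inj)
      then show "e = e'"
        by (rule prod_eqI)
    qed
    ultimately have "card On \<le> card (chords \<times> (UNIV :: bool set))"
      using chords by (intro card_inj_on_le[where f = "\<lambda>e. edge (fst e) (snd e)"]) simp_all
    then show ?thesis
      by (simp add: card_cartesian_product)
  qed
  moreover have "card Ot \<le> 2 * (card W - 1)"
  proof -
    let ?down = "\<lambda>v. (v, parent v)" and ?up = "\<lambda>v. (step v (parent v), flip (parent v))"
    have v0': "step v0 (parent v0) \<notin> W" if "v0 \<noteq> base"
    proof
      assume "step v0 (parent v0) \<in> W"
      then have "dist v0 \<le> dist (step v0 (parent v0))"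
        by (intro v0(2))
      moreover have "v0 \<in> V"
        using v0(1) W(3) by blast
      ultimately show False
        using parent(3)[of v0] that by simp
    qed
    have "Ot \<subseteq> ?down ` (W - {v0}) \<union> ?up ` (W - {v0})"
    proof
      fix e assume "e \<in> Ot"
      then obtain v l where e: "e = (v, l)" "(v, l) \<in> \<E>" "tree_edge v l"
        by (auto simp: Ot_def)
      have vW: "v \<in> W" "step v l \<in> W"
        using e(2) sym[OF e(2)] unfolding W_def by (metis fst_conv image_eqI)+
      consider "v \<noteq> base" "l = parent v" | "step v l \<noteq> base" "flip l = parent (step v l)"
        using e(3) by (auto simp: tree_edge_def)
      then show "e \<in> ?down ` (W - {v0}) \<union> ?up ` (W - {v0})"
      proof cases
        case 1
        then show ?thesis
          using e(1) vW v0' by blast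
      next
        case 2
        then have "e = ?up (step v l)"
          using e(1) by (simp flip: 2(2))
        moreover have "step v l \<noteq> v0"
          using v0' vW(1) 2 by (auto simp flip: 2(2))
        ultimately show ?thesis
          using vW by blast
      qed
    qed
    then have "card Ot \<le> card (?down ` (W - {v0}) \<union> ?up ` (W - {v0}))"
      using W(1) by (intro card_mono) auto
    also have "\<dots> \<le> card (W - {v0}) + card (W - {v0})"
      using W(1) by (intro order_trans[OF card_Un_le] add_mono card_image_le) auto
    finally show ?thesis
      using v0(1) W(1) by simp
  qed
  moreover have "card W \<ge> 1"
    using W(1,2) by (simp add: Suc_le_eq card_gt_0_iff)
  moreover have "card \<E> = (\<Sum>v\<in>W. card (\<E> `` {v}))"
  proof -
    have "\<E> = Sigma W (\<lambda>v. \<E> `` {v})"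
      by (force simp: W_def)
    then have "card \<E> = card (Sigma W (\<lambda>v. \<E> `` {v}))"
      by (rule arg_cong)
    also have "\<dots> = (\<Sum>v\<in>W. card (\<E> `` {v}))"
      using W(1) finite_Image[OF fin] by (intro card_SigmaI) auto
    finally show ?thesis .
  qed
  ultimately show ?thesis
    unfolding W_def[symmetric] by linarith
qed

text \<open>A closed path reading w^n, unrolled over the integers so that rotations and reversals
  become shifts and reflections. The third line says that w is no proper power, the last one that
  the path closes up after exactly n periods.\<close>

definition periodic_line :: "(int \<Rightarrow> 'v) \<Rightarrow> (int \<Rightarrow> 'a \<times> bool) \<Rightarrow> nat \<Rightarrow> nat \<Rightarrow> bool"
  where "periodic_line y l L n \<longleftrightarrow> L > 0 \<and> n > 0 \<and>
    (\<forall>p. y p \<in> V \<and> fst (l p) \<in> S \<and> y (p + 1) = step (y p) (l p)) \<and>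
    (\<forall>p. l (p + int L) = l p \<and> l (p + 1) \<noteq> flip (l p)) \<and>
    (\<forall>p q. (\<forall>t. l (p + t) = l (q + t)) \<longrightarrow> int L dvd p - q) \<and>
    (\<forall>p j. y (p + int L * j) = y p \<longleftrightarrow> int n dvd j)"

end

text \<open>\<E> is a set of half-edges that may contain further lines besides this one; the number
  of letters paired with v is the degree of v in the graph they form.\<close>

locale line_in_graph = schreier_graph S V step base
  for S :: "'a set" and V :: "'v set" and step base +
  fixes y :: "int \<Rightarrow> 'v" and l :: "int \<Rightarrow> 'a \<times> bool" and L n :: nat and \<E> :: "('v \<times> 'a \<times> bool) set"
  assumes line: "periodic_line y l L n"
    and edges_finite: "finite \<E>"
    and edges_sym: "(v, k) \<in> \<E> \<Longrightarrow> (step v k, flip k) \<in> \<E>"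
    and edges_line: "(y p, l p) \<in> \<E>"
begin

abbreviation N :: int where "N \<equiv> int n * int L"

abbreviation prev :: "int \<Rightarrow> 'a \<times> bool" where "prev p \<equiv> flip (l (p - 1))"

lemma line_simps: "L > 0" "n > 0" "y p \<in> V" "fst (l p) \<in> S" "y (p + 1) = step (y p) (l p)"
    "l (p + int L) = l p" "l (p + 1) \<noteq> flip (l p)" "y (p + int L * j) = y p \<longleftrightarrow> int n dvd j"
  using line by (auto simp: periodic_line_def)

lemma prev_neq: "prev p \<noteq> l p"
  using line_simps(7)[of "p - 1"] by auto

lemma y_prev: "step (y p) (prev p) = y (p - 1)"
  using line_simps(5)[of "p - 1"] by simp

lemma edges_prev: "(y p, prev p) \<in> \<E>"
  using edges_sym[OF edges_line[of "p - 1"]] line_simps(5)[of "p - 1"] by simp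

lemma y_mod: "y (p mod N) = y p"
proof -
  have "y (p + N) = y p" for p
    using line_simps(8)[of p "int n"] by (simp add: mult.commute)
  then show ?thesis
    by (rule periodic_mod)
qed

lemma N_pos: "N > 0"
  using line_simps(1,2) by simp

text \<open>Positions that agree modulo \<open>L\<close> have equal height in a stacking. This lemma
  therefore makes heights distinguish all visits of one turn to a given vertex.\<close>

lemma same_visit:
  assumes "y p = y q" "int L dvd p - q" "p \<in> {0..<N}" "q \<in> {0..<N}"
  shows "p = q"
proof -
  obtain j where j: "p - q = int L * j"
    using assms(2) by auto
  then have "int n dvd j"
    using assms(1) line_simps(8)[of q j] by (simp add: algebra_simps)
  then have "N dvd p - q"
    by (auto simp: j)
  moreover have "\<bar>p - q\<bar> < N"
    using assms(3,4) by auto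
  ultimately show "p = q"
    using zdvd_not_zless[of "\<bar>p - q\<bar>" N] by (cases "p = q") auto
qed

text \<open>A position \<open>p\<close> is regarded as a visit of the line to the vertex \<open>y p\<close>. It uses the two
  half-edges \<open>prev p\<close> and \<open>l p\<close> there.\<close>

definition top_at :: "(int \<Rightarrow> int) \<Rightarrow> 'a \<times> bool \<Rightarrow> int \<Rightarrow> bool"
  where "top_at h f p \<longleftrightarrow> (\<forall>q. y q = y p \<and> f \<in> {prev q, l q} \<longrightarrow> h q \<le> h p)"

definition stacking :: "(int \<Rightarrow> int) \<Rightarrow> bool"
  where "stacking h \<longleftrightarrow> (\<forall>p q. h p = h q \<longleftrightarrow> int L dvd p - q) \<and>
    (\<forall>p q. l p = l q \<longrightarrow> (h p < h q \<longleftrightarrow> h (p + 1) < h (q + 1))) \<and>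
    (\<forall>p q. flip (l p) = l (q - 1) \<longrightarrow> (h p < h q \<longleftrightarrow> h (p + 1) < h (q - 1)))"

text \<open>Turning the stack upside down makes the bottom the top, so every fact about tops serves
  twice. For this reason heights are integers here.\<close>

lemma stacking_uminus: 
  assumes "stacking h"
  shows "stacking (\<lambda>p. - h p)"
  unfolding stacking_def
proof (intro conjI allI impI)
  fix p q assume "flip (l p) = l (q - 1)"
  then have "flip (l (q - 1)) = l (p + 1 - 1)"
    by (metis add_diff_cancel_right' flip_flip)
  then have "h (q - 1) < h (p + 1) \<longleftrightarrow> h (q - 1 + 1) < h (p + 1 - 1)"
    using assms unfolding stacking_def by blast
  then show "- h p < - h q \<longleftrightarrow> - h (p + 1) < - h (q - 1)"
    by auto
next
  fix p q assume "l p = l q"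
  then have "h q < h p \<longleftrightarrow> h (q + 1) < h (p + 1)"
    using assms unfolding stacking_def by metis
  then show "- h p < - h q \<longleftrightarrow> - h (p + 1) < - h (q + 1)"
    by auto
next
  fix p q show "- h p = - h q \<longleftrightarrow> int L dvd p - q"
    using assms by (simp add: stacking_def)
qed

context
  fixes h assumes h: "stacking h"
begin

lemma h_eq: "h p = h q \<longleftrightarrow> int L dvd p - q"
  using h unfolding stacking_def by blast

lemma h_same: "l p = l q \<Longrightarrow> h q \<le> h p \<longleftrightarrow> h (q + 1) \<le> h (p + 1)"
  using h unfolding stacking_def by (meson not_le)

lemma h_opposite: "flip (l p) = l (q - 1) \<Longrightarrow> h q \<le> h p \<longleftrightarrow> h (q - 1) \<le> h (p + 1)"
  using h unfolding stacking_def by (meson not_le)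

lemma h_mod: "h (p mod N) = h p"
proof -
  have "int L dvd p mod N - p"
    by (metis dvd_mult_left dvd_triv_right mod_eq_dvd_iff mod_mod_trivial mult.commute)
  then show ?thesis
    by (simp add: h_eq)
qed

text \<open>Strands over one edge keep their order from one end to the other, whether they run in
  the same or in opposite directions. So being on top can change only inside a vertex.\<close>

lemma top_at_step: "top_at h (l p) p \<longleftrightarrow> top_at h (prev (p + 1)) (p + 1)"
proof
  assume top: "top_at h (l p) p"
  show "top_at h (prev (p + 1)) (p + 1)"
    unfolding top_at_def
  proof (intro allI impI, elim conjE)
    fix q assume q: "y q = y (p + 1)" "prev (p + 1) \<in> {prev q, l q}"
    show "h q \<le> h (p + 1)"
    proof (cases "l (q - 1) = l p")
      case True
      then have "y (q - 1) = y p"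
        using q(1) y_prev[of q] y_prev[of "p + 1"] by simp
      then have "h (q - 1) \<le> h p"
        using top True by (simp add: top_at_def)
      then show ?thesis
        using h_same[of p "q - 1"] True by simp
    next
      case False
      then have lq: "l q = flip (l p)"
        using q(2) by auto
      then have "y (q + 1) = y p"
        using q(1) line_simps(5)[of q] line_simps(5)[of p] by simp
      moreover have "l p = prev (q + 1)"
        using lq by simp
      ultimately have "h (q + 1) \<le> h p"
        using top by (auto simp: top_at_def)
      then show ?thesis
        using h_opposite[of p "q + 1"] lq by simp
    qed
  qed
next
  assume top: "top_at h (prev (p + 1)) (p + 1)"
  show "top_at h (l p) p"
    unfolding top_at_def
  proof (intro allI impI, elim conjE)
    fix q assume q: "y q = y p" "l p \<in> {prev q, l q}"
    show "h q \<le> h p"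
    proof (cases "l q = l p")
      case True
      then have "y (q + 1) = y (p + 1)"
        using q(1) line_simps(5) by simp
      then have "h (q + 1) \<le> h (p + 1)"
        using top True by (simp add: top_at_def)
      then show ?thesis
        using h_same[of p q] True by simp
    next
      case False
      then have lq: "flip (l p) = l (q - 1)"
        using q(2) by auto
      then have "y (q - 1) = y (p + 1)"
        using q(1) y_prev[of q] line_simps(5)[of p] by (metis flip_flip)
      then have "h (q - 1) \<le> h (p + 1)"
        using top lq by (simp add: top_at_def)
      then show ?thesis
        using h_opposite[of p q] lq by simp
    qed
  qed
qed

text \<open>Sending a visit where the line changes between being on top and not being on top to the
  half-edge where it is on top is injective, and misses both half-edges of the highest visit.\<close>

lemma card_top_changes:
  "card {p \<in> {0..<N}. y p = v \<and> top_at h (prev p) p \<noteq> top_at h (l p) p} \<le> card (\<E> `` {v}) - 2"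
    (is "card ?C \<le> _")
proof (cases "?C = {}")
  case False
  define P where "P = {p \<in> {0..<N}. y p = v}"
  have P: "finite P" "P \<noteq> {}" "?C \<subseteq> P"
    using False by (auto simp: P_def intro: finite_subset[of _ "{0..<N}"])
  then obtain m where m: "m \<in> P" "\<And>p. p \<in> P \<Longrightarrow> h p \<le> h m"
    using finite_argmax[of P h] by metis
  have max: "h q \<le> h m" if "y q = v" for q
    using m(2)[of "q mod N"] that N_pos h_mod by (simp add: P_def y_mod)
  have m_top: "top_at h f m" for f
    using max m(1) by (auto simp: top_at_def P_def)
  have uniq: "p = q" if "p \<in> P" "q \<in> P" "h p = h q" for p q
    using that same_visit by (auto simp: P_def h_eq)
  define g where "g p = (if top_at h (prev p) p then prev p else l p)" for p
  have g_top: "top_at h (g p) p" if "p \<in> ?C" for p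
    using that by (auto simp: g_def)
  have g_in: "g p \<in> {prev p, l p}" for p
    by (auto simp: g_def)
  have le: "h q \<le> h p" if "p \<in> ?C" "q \<in> P" "g p \<in> {prev q, l q}" for p q
    using g_top[OF that(1)] that P(3) unfolding top_at_def P_def by auto
  have "inj_on g ?C"
  proof (rule inj_onI)
    fix p q assume pq: "p \<in> ?C" "q \<in> ?C" "g p = g q"
    then have "h p = h q"
      using le[of p q] le[of q p] g_in[of p] g_in[of q] P(3) by (auto intro: antisym)
    then show "p = q"
      using uniq pq P(3) by blast
  qed
  moreover have "g p \<notin> {prev m, l m}" if "p \<in> ?C" for p
  proof
    assume "g p \<in> {prev m, l m}"
    then have "h p = h m"
      using le[OF that m(1)] m(2) that P(3) by (meson antisym subsetD)
    then have "p = m"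
      using uniq that m(1) P(3) by blast
    then show False
      using that m_top by auto
  qed
  then have "g ` ?C \<inter> {prev m, l m} = {}"
    by blast
  moreover have "finite ?C"
    using P(1,3) by (rule finite_subset[rotated])
  ultimately have "card (g ` ?C \<union> {prev m, l m}) = card ?C + 2"
    using prev_neq[of m] by (simp only: card_Un_disjoint finite_imageI finite.intros card_image) simp
  moreover have "g ` ?C \<union> {prev m, l m} \<subseteq> \<E> `` {v}"
  proof -
    have half: "{prev q, l q} \<subseteq> \<E> `` {v}" if "q \<in> P" for q
      using edges_line[of q] edges_prev[of q] that by (auto simp: P_def)
    have "g ` ?C \<subseteq> \<E> `` {v}"
    proof (rule image_subsetI)
      fix q assume "q \<in> ?C"
      then show "g q \<in> \<E> `` {v}"
        using half[of q] g_in[of q] P(3) by blast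
    qed
    then show ?thesis
      using half[OF m(1)] by blast
  qed
  then have "card (g ` ?C \<union> {prev m, l m}) \<le> card (\<E> `` {v})"
    by (rule card_mono[rotated]) (rule finite_Image[OF edges_finite])
  ultimately show ?thesis
    by linarith
next
  case True
  show ?thesis
    unfolding True by simp
qed

end

text \<open>A strand that is both on top and at the bottom of a half-edge is the only one there, so
  such visits use disjoint pairs of half-edges and number at most half the degree d. For d \<ge> 3
  the integer part of d/2 is at most d - 2.\<close>

lemma card_lonely_visits:
  assumes h: "stacking h" and deg: "card (\<E> `` {v}) \<ge> 3"
  shows "card {p \<in> {0..<N}. y p = v \<and> (\<forall>f\<in>{prev p, l p}. top_at h f p \<and> top_at (\<lambda>p. - h p) f p)}
    \<le> card (\<E> `` {v}) - 2" (is "card ?C \<le> _")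
proof -
  have uniq: "p = q" if pq: "p \<in> ?C" "q \<in> ?C" "{prev p, l p} \<inter> {prev q, l q} \<noteq> {}" for p q
  proof -
    obtain f where f: "f \<in> {prev p, l p}" "f \<in> {prev q, l q}"
      using pq(3) by (metis disjoint_iff)
    then have "h q \<le> h p" "- h q \<le> - h p"
      using pq(1,2) unfolding top_at_def by auto
    then show ?thesis
      using pq(1,2) same_visit h_eq[OF h, of p q] by auto
  qed
  have "inj_on l ?C"
  proof (rule inj_onI)
    fix p q assume pq: "p \<in> ?C" "q \<in> ?C" "l p = l q"
    show "p = q"
      by (rule uniq[OF pq(1,2)]) (simp add: pq(3))
  qed
  moreover have "inj_on prev ?C"
  proof (rule inj_onI)
    fix p q assume pq: "p \<in> ?C" "q \<in> ?C" "prev p = prev q"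
    show "p = q"
      by (rule uniq[OF pq(1,2)]) (use pq(3) in simp)
  qed
  moreover have "l p \<noteq> prev q" if pq: "p \<in> ?C" "q \<in> ?C" for p q
  proof
    assume eq: "l p = prev q"
    have "p = q"
      by (rule uniq[OF pq]) (simp add: eq)
    then show False
      using eq prev_neq by metis
  qed
  then have "l ` ?C \<inter> prev ` ?C = {}"
    by blast
  moreover have "finite ?C"
    by (rule finite_subset[of _ "{0..<N}"]) auto
  ultimately have "card (l ` ?C \<union> prev ` ?C) = 2 * card ?C"
    by (simp only: card_Un_disjoint finite_imageI card_image)
  moreover have "l ` ?C \<union> prev ` ?C \<subseteq> \<E> `` {v}"
    using edges_line edges_prev by auto
  then have "card (l ` ?C \<union> prev ` ?C) \<le> card (\<E> `` {v})"
    by (rule card_mono[rotated]) (rule finite_Image[OF edges_finite])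
  ultimately have "2 * card ?C \<le> card (\<E> `` {v})"
    by linarith
  then show ?thesis
    using deg by linarith
qed

lemma degree_ge_2: "card (\<E> `` {y p}) \<ge> 2"
proof -
  have "{prev p, l p} \<subseteq> \<E> `` {y p}"
    using edges_line edges_prev by auto
  then have "card {prev p, l p} \<le> card (\<E> `` {y p})"
    using edges_finite by (intro card_mono) auto
  then show ?thesis
    using prev_neq[of p] by simp
qed

lemma half_edges:
  assumes "card (\<E> `` {y p}) = 2"
  shows "\<E> `` {y p} = {prev p, l p}"
proof -
  have "{prev p, l p} \<subseteq> \<E> `` {y p}"
    using edges_line edges_prev by auto
  then show ?thesis
    using assms edges_finite prev_neq[of p] by (intro card_subset_eq[symmetric]) auto
qed

text \<open>\<open>P\<close> is the state on entering a visit and \<open>Q\<close> the state on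
  leaving it, which is also the state on entering the next. Without events a state once attained
  holds on the whole segment, before as well as after.\<close>

lemma constant_on_segment:
  fixes P Q :: "int \<Rightarrow> bool"
  assumes "\<And>t. t < m \<Longrightarrow> P (p + int t) = Q (p + int t)" and "\<And>q. Q q = P (q + 1)"
    and "t0 < m" "P (p + int t0)" "t < m"
  shows "P (p + int t)"
proof -
  have "P (p + int t) = P p" if "t < m" for t
    using that
  proof (induction t)
    case (Suc t)
    then show ?case
      using assms(1)[of t] assms(2)[of "p + int t"] by (simp add: algebra_simps)
  qed simp
  then show ?thesis
    using assms(3-5) by blast
qed

text \<open>A block of two periods without events: no change of being on top or at the bottom, and no
  branching where the line runs alone. As each period contains a highest and a lowest letter, the line
  is on top and at the bottom, that is alone, on the whole block, which therefore has no branching.\<close>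

lemma unbranched_stretch:
  assumes few: "3 * (\<Sum>v\<in>fst ` \<E>. card (\<E> `` {v}) - 2) < n div 2"
  obtains p where "\<And>t. t < 2 * L \<Longrightarrow> card (\<E> `` {y (p + int t)}) = 2"
proof -
  have "\<exists>h :: int \<Rightarrow> nat. (\<forall>p q. h p = h q \<longleftrightarrow> int L dvd p - q) \<and>
      (\<forall>p q. l p = l q \<longrightarrow> (h p < h q \<longleftrightarrow> h (p + 1) < h (q + 1))) \<and>
      (\<forall>p q. flip (l p) = l (q - 1) \<longrightarrow> (h p < h q \<longleftrightarrow> h (p + 1) < h (q - 1)))"
    by (rule stacking_exists[of L l]) (use line in \<open>auto simp: periodic_line_def\<close>)
  then obtain h0 :: "int \<Rightarrow> nat" where h0: "stacking (\<lambda>p. int (h0 p))"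
    unfolding stacking_def by auto
  define h where "h p = int (h0 p)" for p
  have h: "stacking h" "stacking (\<lambda>p. - h p)"
    using h0 stacking_uminus by (auto simp: h_def[abs_def])
  define C1 where "C1 v = {p \<in> {0..<N}. y p = v \<and> top_at h (prev p) p \<noteq> top_at h (l p) p}" for v
  define C2 where "C2 v = {p \<in> {0..<N}. y p = v \<and>
      top_at (\<lambda>p. - h p) (prev p) p \<noteq> top_at (\<lambda>p. - h p) (l p) p}" for v
  define C3 where "C3 v = {p \<in> {0..<N}. y p = v \<and> card (\<E> `` {v}) \<ge> 3 \<and>
      (\<forall>f\<in>{prev p, l p}. top_at h f p \<and> top_at (\<lambda>p. - h p) f p)}" for v
  define E where "E = (\<Union>v\<in>fst ` \<E>. C1 v \<union> C2 v \<union> C3 v)"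
  have "card E \<le> (\<Sum>v\<in>fst ` \<E>. card (C1 v \<union> C2 v \<union> C3 v))"
    unfolding E_def using edges_finite by (intro card_UN_le) auto
  also have "\<dots> \<le> (\<Sum>v\<in>fst ` \<E>. 3 * (card (\<E> `` {v}) - 2))"
  proof (rule sum_mono)
    fix v
    have "card (C3 v) \<le> card (\<E> `` {v}) - 2"
      using card_lonely_visits[OF h(1), of v] by (cases "card (\<E> `` {v}) \<ge> 3") (auto simp: C3_def)
    moreover have "card (C1 v) \<le> card (\<E> `` {v}) - 2" "card (C2 v) \<le> card (\<E> `` {v}) - 2"
      using card_top_changes[OF h(1)] card_top_changes[OF h(2)] by (auto simp: C1_def C2_def)
    moreover have "card (C1 v \<union> C2 v \<union> C3 v) \<le> card (C1 v) + card (C2 v) + card (C3 v)"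
      by (meson add_mono card_Un_le order_refl order_trans)
    ultimately show "card (C1 v \<union> C2 v \<union> C3 v) \<le> 3 * (card (\<E> `` {v}) - 2)"
      by linarith
  qed
  also have "\<dots> < n div 2"
    using few by (simp add: sum_distrib_left)
  finally have cardE: "card E < n div 2" .
  \<comment> \<open>One turn of n periods contains n div 2 blocks of two periods, and p div (2 L) is
    the number of the block around p. With fewer events than blocks some block is missed.\<close>
  have "\<exists>b < n div 2. \<forall>p\<in>E. p div (2 * int L) \<noteq> int b"
  proof (rule ccontr)
    assume "\<not> ?thesis"
    then have hit: "\<exists>p\<in>E. p div (2 * int L) = int b" if "b < n div 2" for b
      using that by blast
    have "int ` {..<n div 2} \<subseteq> (\<lambda>p. p div (2 * int L)) ` E"
    proof (rule image_subsetI)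
      fix b assume "b \<in> {..<n div 2}"
      then obtain p where p: "p \<in> E" "p div (2 * int L) = int b"
        using hit[of b] by auto
      then show "int b \<in> (\<lambda>p. p div (2 * int L)) ` E"
        by (intro image_eqI[of _ _ p]) simp_all
    qed
    moreover have "E \<subseteq> {0..<N}"
      unfolding E_def C1_def C2_def C3_def by blast
    then have "finite E"
      by (rule finite_subset) simp
    ultimately have "card (int ` {..<n div 2}) \<le> card E"
      by (rule surj_card_le[rotated])
    then show False
      using cardE by (simp add: card_image)
  qed
  then obtain b where b: "b < n div 2" "\<And>p. p \<in> E \<Longrightarrow> p div (2 * int L) \<noteq> int b"
    by blast
  define p0 where "p0 = 2 * int L * int b"
  have no_event: "p0 + int t \<notin> E" if "t < 2 * L" for t
    using b(2)[of "p0 + int t"] that line_simps(1) by (auto simp: p0_def)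
  have in_range: "p0 + int t \<in> {0..<N}" if "t < 2 * L" for t
  proof -
    have "2 * (b + 1) \<le> n"
      using b(1) by presburger
    then have "2 * (int b + 1) * int L \<le> int n * int L"
      by (intro mult_right_mono) auto
    then show ?thesis
      using that by (auto simp: p0_def algebra_simps)
  qed
  have yO: "y p \<in> fst ` \<E>" for p
    using edges_line by force
  have not_C: "p0 + int t \<notin> C1 (y (p0 + int t))" "p0 + int t \<notin> C2 (y (p0 + int t))"
    "p0 + int t \<notin> C3 (y (p0 + int t))" if "t < 2 * L" for t
    using no_event[OF that] yO[of "p0 + int t"] unfolding E_def by blast+
  have same1: "top_at h (prev (p0 + int t)) (p0 + int t) = top_at h (l (p0 + int t)) (p0 + int t)"
    if "t < 2 * L" for t
    using not_C(1)[OF that] in_range[OF that] by (simp add: C1_def)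
  have same2: "top_at (\<lambda>p. - h p) (prev (p0 + int t)) (p0 + int t) =
      top_at (\<lambda>p. - h p) (l (p0 + int t)) (p0 + int t)" if "t < 2 * L" for t
    using not_C(2)[OF that] in_range[OF that] by (simp add: C2_def)
  have alone: "card (\<E> `` {y (p0 + int t)}) < 3"
    if "t < 2 * L" and "\<forall>f\<in>{prev (p0 + int t), l (p0 + int t)}.
      top_at h f (p0 + int t) \<and> top_at (\<lambda>p. - h p) f (p0 + int t)" for t
    using not_C(3)[OF that(1)] in_range[OF that(1)] that(2) by (simp add: C3_def not_le)
  have ex: "\<exists>t<L. \<forall>q. k q \<le> k (p0 + int t)" if "stacking k" for k :: "int \<Rightarrow> int"
  proof -
    have ne: "finite {..<L}" "{..<L} \<noteq> {}"
      using line_simps(1) by auto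
    obtain t where t: "t < L" "\<And>s. s < L \<Longrightarrow> k (p0 + int s) \<le> k (p0 + int t)"
      using finite_argmax[OF ne, of "\<lambda>t. k (p0 + int t)"] by auto
    have "k q \<le> k (p0 + int t)" for q
    proof -
      define s where "s = nat ((q - p0) mod int L)"
      have s: "int s = (q - p0) mod int L" "s < L"
        using line_simps(1) by (auto simp: s_def nat_less_iff)
      have "int L dvd (q - p0) - (q - p0) mod int L"
        by (simp add: minus_mod_eq_mult_div)
      then have "k q = k (p0 + int s)"
        using h_eq[OF that] s(1) by (simp add: algebra_simps)
      then show ?thesis
        using t(2)[OF s(2)] by simp
    qed
    then show ?thesis
      using t(1) by blast
  qed
  have top: "top_at k (prev (p0 + int t)) (p0 + int t)"
    if t: "t < 2 * L" and k: "stacking k" and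
      same: "\<And>t. t < 2 * L \<Longrightarrow> top_at k (prev (p0 + int t)) (p0 + int t) = top_at k (l (p0 + int t)) (p0 + int t)"
    for t k
  proof -
    obtain t0 where "t0 < L" "\<forall>q. k q \<le> k (p0 + int t0)"
      using ex[OF k] by blast
    then have t0: "t0 < 2 * L" "top_at k (prev (p0 + int t0)) (p0 + int t0)"
      by (auto simp: top_at_def)
    show ?thesis
      by (rule constant_on_segment[where P = "\<lambda>p. top_at k (prev p) p" and Q = "\<lambda>p. top_at k (l p) p",
            OF same top_at_step[OF k] t0 t])
  qed
  have "card (\<E> `` {y (p0 + int t)}) = 2" if "t < 2 * L" for t
  proof -
    have "top_at h (prev (p0 + int t)) (p0 + int t)"
      "top_at (\<lambda>p. - h p) (prev (p0 + int t)) (p0 + int t)"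
      using top[OF that h(1) same1] top[OF that h(2) same2] by blast+
    then have "card (\<E> `` {y (p0 + int t)}) < 3"
      using same1[OF that] same2[OF that] by (intro alone[OF that]) auto
    then show ?thesis
      using degree_ge_2[of "p0 + int t"] by linarith
  qed
  then show thesis
    by (rule that)
qed

text \<open>At a vertex of degree two the only half-edges are the two used by the line. A reduced
  path that comes in along one of them cannot turn back, so it leaves by the other.\<close>

lemma follow:
  assumes deg: "\<And>t. t < m \<Longrightarrow> card (\<E> `` {y (p + int t)}) = 2"
    and y': "\<And>q. y' (q + 1) = step (y' q) (l' q)" and l': "\<And>q. l' (q + 1) \<noteq> flip (l' q)"
    and \<E>': "\<And>q. (y' q, l' q) \<in> \<E>" and start: "y' q = y p" "l' q = l p" and t: "t < m"
  shows "y' (q + int t) = y (p + int t) \<and> l' (q + int t) = l (p + int t)"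
  using t
proof (induction t)
  case (Suc t)
  let ?p = "p + int (Suc t)" and ?q = "q + int (Suc t)"
  have IH: "y' (q + int t) = y (p + int t)" "l' (q + int t) = l (p + int t)"
    using Suc by auto
  then have y_eq: "y' ?q = y ?p"
    using y'[of "q + int t"] line_simps(5)[of "p + int t"] by (simp add: algebra_simps)
  have "\<E> `` {y ?p} = {prev ?p, l ?p}"
    by (rule half_edges[OF deg[OF Suc.prems]])
  moreover have "l' ?q \<in> \<E> `` {y ?p}"
    using \<E>'[of ?q] y_eq by simp
  moreover have "l' ?q \<noteq> prev ?p"
    using l'[of "q + int t"] IH by (simp add: algebra_simps)
  ultimately show ?case
    using y_eq by blast
qed (use start in auto)

end

text \<open>The reflection j \<mapsto> p + q - j either fixes a position, whose letter would be its
  own inverse, or exchanges two neighbours, which would cancel.\<close>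

lemma no_self_reverse:
  fixes l :: "int \<Rightarrow> 'a \<times> bool"
  assumes L: "L > 0" and per: "\<And>p. l (p + int L) = l p" and redd: "\<And>p. l (p + 1) \<noteq> flip (l p)"
    and rev: "\<And>t. t < L \<Longrightarrow> l (q - int t) = flip (l (p + int t))"
  shows False
proof -
  have all: "l (q - t) = flip (l (p + t))" for t
  proof -
    have "nat (t mod int L) < L" "int (nat (t mod int L)) = t mod int L"
      using L by (simp_all add: nat_less_iff)
    then have "l (q - t mod int L) = flip (l (p + t mod int L))"
      using rev[of "nat (t mod int L)"] by simp
    moreover have "l (q - t mod int L) = l (q - t)"
    proof -
      have eq: "q - t mod int L = q - t + int L * (t div int L)"
        using mult_div_mod_eq[of "int L" t] by linarith
      show ?thesis
        unfolding eq by (rule periodic_mod(1)) (rule per)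
    qed
    moreover have "l (p + t) = l (p + t mod int L)"
      using periodic_mod(1)[of l "int L" "p + t mod int L" "t div int L", OF per] mult_div_mod_eq[of "int L" t]
      by (simp add: algebra_simps)
    ultimately show ?thesis by simp
  qed
  have all': "l (p + q - j) = flip (l j)" for j
    using all[of "j - p"] by (simp add: algebra_simps)
  show False
  proof (cases "even (p + q)")
    case True
    then obtain j where "p + q = 2 * j" ..
    then show False
      using all'[of j] by simp
  next
    case False
    then obtain j where "p + q = 2 * j + 1"
      by (rule oddE)
    then show False
      using all'[of j] redd[of j] by simp
  qed
qed

section \<open>Several lines in one graph\<close>

context schreier_graph
begin

text \<open>The edge is taken at the start of an unbranched stretch of line \<open>k\<close>, along
  which every line through that edge is forced to run. The first conclusion will keep the signed
  count of line \<open>k\<close> from cancelling; the second gives the zeros of the triangular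
  system. It is limited to L i \<le> L k because the stretch has length 2 L k and a contradiction
  needs L i + L k.\<close>

lemma private_edges:
  fixes y :: "'i \<Rightarrow> int \<Rightarrow> 'v" and l :: "'i \<Rightarrow> int \<Rightarrow> 'a \<times> bool" and L n :: "'i \<Rightarrow> nat"
  assumes I: "finite I" and chords: "finite chords"
    and line: "\<And>i. i \<in> I \<Longrightarrow> periodic_line (y i) (l i) (L i) (n i)"
    and n: "\<And>i. i \<in> I \<Longrightarrow> 12 * card chords \<le> n i"
    and no_overlap: "\<And>i k p q. i \<in> I \<Longrightarrow> k \<in> I \<Longrightarrow> i \<noteq> k \<Longrightarrow>
      \<not> (\<forall>t < L i + L k. l i (q + int t) = l k (p + int t))"
    and no_reverse_overlap: "\<And>i k p q. i \<in> I \<Longrightarrow> k \<in> I \<Longrightarrow> i \<noteq> k \<Longrightarrow>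
      \<not> (\<forall>t < L i + L k. l i (q - int t) = flip (l k (p + int t)))"
    and k: "k \<in> I"
  obtains p where "\<And>q. edge (y k q) (l k q) \<noteq> flip (edge (y k p) (l k p))"
    "\<And>i q. i \<in> I \<Longrightarrow> i \<noteq> k \<Longrightarrow> L i \<le> L k \<Longrightarrow>
      fst (edge (y i q) (l i q)) \<noteq> fst (edge (y k p) (l k p))"
proof -
  define \<E> where "\<E> = (\<Union>i\<in>I. range (\<lambda>p. (y i p, l i p)) \<union> range (\<lambda>p. (y i (p + 1), flip (l i p))))"
  have l_simps: "L i > 0" "n i > 0" "y i p \<in> V" "fst (l i p) \<in> S" "y i (p + 1) = step (y i p) (l i p)"
    "l i (p + int (L i)) = l i p" "l i (p + 1) \<noteq> flip (l i p)"
    "y i (p + int (L i) * j) = y i p \<longleftrightarrow> int (n i) dvd j" if "i \<in> I" for i p j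
    using line[OF that] by (auto simp: periodic_line_def)
  have "finite \<E>"
    unfolding \<E>_def
  proof (intro finite_UN_I I finite_UnI)
    fix i assume i: "i \<in> I"
    have N: "int (L i) * int (n i) > 0"
      using l_simps(1,2)[OF i] by simp
    have yN: "y i (p + int (L i) * int (n i)) = y i p" for p
      using l_simps(8)[OF i] by simp
    have lN: "l i (p + int (L i) * int (n i)) = l i p" for p
      by (rule periodic_mod(1)) (rule l_simps(6)[OF i])
    show "finite (range (\<lambda>p. (y i p, l i p)))"
      by (rule finite_range_periodic[OF N]) (simp add: yN lN)
    show "finite (range (\<lambda>p. (y i (p + 1), flip (l i p))))"
    proof (rule finite_range_periodic[OF N])
      fix p
      show "(y i (p + int (L i) * int (n i) + 1), flip (l i (p + int (L i) * int (n i)))) =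
          (y i (p + 1), flip (l i p))"
        using yN[of "p + 1"] lN[of p] by (simp add: algebra_simps)
    qed
  qed
  moreover have E_line: "(y i p, l i p) \<in> \<E>" if "i \<in> I" for i p
    using that by (auto simp: \<E>_def)
  moreover have E_rev: "(y i (p + 1), flip (l i p)) \<in> \<E>" if "i \<in> I" for i p
    using that by (auto simp: \<E>_def)
  moreover have E_D: "\<exists>i p. i \<in> I \<and> ((v, c) = (y i p, l i p) \<or> (v, c) = (y i (p + 1), flip (l i p)))"
    if "(v, c) \<in> \<E>" for v c
    using that unfolding \<E>_def by blast
  moreover have sym: "(step v c, flip c) \<in> \<E>" if "(v, c) \<in> \<E>" for v c
  proof -
    obtain i p where i: "i \<in> I" and "(v, c) = (y i p, l i p) \<or> (v, c) = (y i (p + 1), flip (l i p))"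
      using E_D[OF \<open>(v, c) \<in> \<E>\<close>] by blast
    then show ?thesis
      using E_line[OF i, of p] E_rev[OF i, of p] l_simps(5)[OF i, of p] by auto
  qed
  ultimately have graph: "line_in_graph S V step base (y i) (l i) (L i) (n i) \<E>" if "i \<in> I" for i
    using that line by unfold_locales
  interpret K: line_in_graph S V step base "y k" "l k" "L k" "n k" \<E>
    by (rule graph[OF k])
  define W where "W = fst ` \<E>"
  have deg: "card (\<E> `` {v}) \<ge> 2" if v: "v \<in> W" for v
  proof -
    obtain i p where "i \<in> I" "v = y i p"
      using v by (auto simp: W_def \<E>_def)
    then show ?thesis
      using line_in_graph.degree_ge_2[OF graph] by blast
  qed
  have W: "finite W"
    using K.edges_finite by (simp add: W_def)
  have "(\<Sum>v\<in>W. card (\<E> `` {v})) + 2 \<le> 2 * card W + 2 * card chords"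
    unfolding W_def
  proof (rule degree_sum[OF K.edges_finite _ _ sym chords])
    show "\<E> \<noteq> {}"
      using E_line[OF k] by auto
    have "v \<in> V \<and> fst c \<in> S" if "(v, c) \<in> \<E>" for v c
    proof -
      obtain i p where i: "i \<in> I" and "(v, c) = (y i p, l i p) \<or> (v, c) = (y i (p + 1), flip (l i p))"
        using E_D[OF \<open>(v, c) \<in> \<E>\<close>] by blast
      then show ?thesis
        using l_simps(3,4)[OF i] by auto
    qed
    then show "\<E> \<subseteq> V \<times> S \<times> UNIV"
      by fastforce
  qed
  moreover have "(\<Sum>v\<in>W. card (\<E> `` {v})) = (\<Sum>v\<in>W. (card (\<E> `` {v}) - 2) + 2)"
  proof (rule sum.cong[OF refl])
    fix v assume "v \<in> W"
    then show "card (\<E> `` {v}) = card (\<E> `` {v}) - 2 + 2"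
      using deg[of v] by linarith
  qed
  moreover have "(\<Sum>v\<in>W. (card (\<E> `` {v}) - 2) + 2) = (\<Sum>v\<in>W. card (\<E> `` {v}) - 2) + 2 * card W"
    by (subst sum.distrib) simp
  ultimately have "(\<Sum>v\<in>W. card (\<E> `` {v}) - 2) + 2 \<le> 2 * card chords"
    by linarith
  \<comment> \<open>With c chords there are at most 6c - 6 events, against at least 6c
    blocks.\<close>
  then have "3 * (\<Sum>v\<in>W. card (\<E> `` {v}) - 2) < n k div 2"
    using n[OF k] by linarith
  then obtain p where p: "\<And>t. t < 2 * L k \<Longrightarrow> card (\<E> `` {y k (p + int t)}) = 2"
    using K.unbranched_stretch unfolding W_def by blast
  have forward: "l i (q + int t) = l k (p + int t)"
    if "i \<in> I" "y i q = y k p" "l i q = l k p" "t < 2 * L k" for i q t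
    using K.follow[OF p l_simps(5)[OF that(1)] l_simps(7)[OF that(1)] E_line[OF that(1)]
        that(2,3,4)] by simp
  have backward: "l i (q - int t) = flip (l k (p + int t))"
    if i: "i \<in> I" and q: "y i q = step (y k p) (l k p)" "l i q = flip (l k p)" and t: "t < 2 * L k" for i q t
  proof -
    \<comment> \<open>Line \<open>i\<close> read backwards is again a reduced path in \<E>. Its
      letter at s undoes the letter from - s - 1 to - s, hence the shift by one.\<close>
    define y' where "y' s = y i (- s)" for s
    define l' where "l' s = flip (l i (- s - 1))" for s
    have y': "y' (s + 1) = step (y' s) (l' s)" for s
      using l_simps(5)[OF i, of "- s - 1"] by (simp add: y'_def l'_def)
    have l': "l' (s + 1) \<noteq> flip (l' s)" for s
    proof -
      have "- (s + 1) - 1 = - s - 2" "- s - 2 + 1 = - s - 1"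
        by linarith+
      then show ?thesis
        using l_simps(7)[OF i, of "- s - 2"] unfolding l'_def by (metis flip_flip)
    qed
    have E': "(y' s, l' s) \<in> \<E>" for s
      using E_rev[OF i, of "- s - 1"] by (simp add: y'_def l'_def)
    have "y' (- q - 1) = y k p" "l' (- q - 1) = l k p"
      using q l_simps(5)[OF i, of q] by (simp_all add: y'_def l'_def add.commute)
    from K.follow[of "2 * L k" p y' l', OF p y' l' E' this t]
    have "flip (l i (q - int t)) = l k (p + int t)"
      by (simp add: l'_def)
    then show ?thesis
      by (metis flip_flip)
  qed
  show thesis
  proof (rule that[of p])
    fix q
    show "edge (y k q) (l k q) \<noteq> flip (edge (y k p) (l k p))"
    proof
      assume "edge (y k q) (l k q) = flip (edge (y k p) (l k p))"
      then have "y k q = step (y k p) (l k p)" "l k q = flip (l k p)"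
        by (simp_all add: edge_flip_eq_iff)
      then have "l k (q - int t) = flip (l k (p + int t))" if "t < L k" for t
        using backward[OF k] that by simp
      then show False
        using no_self_reverse[OF l_simps(1)[OF k] l_simps(6)[OF k] l_simps(7)[OF k]] by blast
    qed
  next
    fix i q assume i: "i \<in> I" "i \<noteq> k" "L i \<le> L k"
    show "fst (edge (y i q) (l i q)) \<noteq> fst (edge (y k p) (l k p))"
    proof
      assume "fst (edge (y i q) (l i q)) = fst (edge (y k p) (l k p))"
      then consider "y i q = y k p" "l i q = l k p"
        | "y i q = step (y k p) (l k p)" "l i q = flip (l k p)"
        by (auto simp: fst_edge_eq_iff)
      then show False
      proof cases
        case 1
        then have "l i (q + int t) = l k (p + int t)" if "t < L i + L k" for t
          using forward[OF i(1) 1] that i(3) by simp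
        then show False
          using no_overlap[OF i(1) k i(2)] by blast
      next
        case 2
        then have "l i (q - int t) = flip (l k (p + int t))" if "t < L i + L k" for t
          using backward[OF i(1) 2] that i(3) by simp
        then show False
          using no_reverse_overlap[OF i(1) k i(2)] by blast
      qed
    qed
  qed
qed

end

section \<open>Homomorphisms to the integers\<close>

lemma red_map:
  assumes "inj_on f Y" "set u \<subseteq> Y \<times> UNIV"
  shows "red (map (apfst f) u) = map (apfst f) (red u)"
proof -
  define m where "m = (apfst f :: _ \<times> bool \<Rightarrow> _)"
  have m: "fst (m l) = f (fst l)" "snd (m l) = snd l" for l
    by (simp_all add: m_def)
  have "red (map m u) = map m (red u)"
    using assms(2)
  proof (induction u)
    case (Cons l u)
    have "hd (map m (red u)) = flip (m l) \<longleftrightarrow> hd (red u) = flip l" if "red u \<noteq> []"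
    proof -
      have "hd (red u) \<in> set u"
        using set_red[of u] hd_in_set[OF that] by blast
      then have "fst (hd (red u)) \<in> Y" "fst l \<in> Y"
        using Cons.prems by auto
      then show ?thesis
        using that assms(1) by (auto simp: hd_map flip_def prod_eq_iff m dest: inj_onD)
    qed
    then show ?case
      using Cons by (auto simp: push_def map_tl)
  qed simp
  then show ?thesis
    by (simp add: m_def)
qed

text \<open>Gaussian elimination without fractions: with a pivot \<open>a j t\<close> the other rows
  are multiplied by the pivot instead of being divided by it. The coefficient of row
  \<open>j\<close> is then chosen to clear column \<open>t\<close>.\<close>

lemma linear_relation_exists:
  fixes a :: "'i \<Rightarrow> 't \<Rightarrow> int"
  assumes "finite T" "finite I" "card T < card I"
  shows "\<exists>c. (\<exists>i\<in>I. c i \<noteq> 0) \<and> (\<forall>t\<in>T. (\<Sum>i\<in>I. c i * a i t) = 0)"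
  using assms
proof (induction T arbitrary: I a rule: finite_induct)
  case empty
  then show ?case
    by (intro exI[of _ "\<lambda>_. 1"]) (auto simp: card_gt_0_iff)
next
  case (insert t T)
  show ?case
  proof (cases "\<forall>i\<in>I. a i t = 0")
    case True
    then show ?thesis
      using insert.IH[of I a] insert by auto
  next
    case False
    then obtain j where j: "j \<in> I" "a j t \<noteq> 0" by blast
    define J where "J = I - {j}"
    have I: "I = insert j J" "j \<notin> J" "finite J"
      using j insert.prems by (auto simp: J_def)
    have "card T < card J"
      using insert I by simp
    then obtain c where c: "\<exists>i\<in>J. c i \<noteq> 0"
      "\<And>s. s \<in> T \<Longrightarrow> (\<Sum>i\<in>J. c i * (a j t * a i s - a i t * a j s)) = 0"
      using insert.IH[of J "\<lambda>i s. a j t * a i s - a i t * a j s"] I by blast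
    define d where "d i = (if i = j then - (\<Sum>i\<in>J. c i * a i t) else c i * a j t)" for i
    have d_sum: "(\<Sum>i\<in>I. d i * a i s) = (\<Sum>i\<in>J. c i * (a j t * a i s - a i t * a j s))" for s
    proof -
      have "(\<Sum>i\<in>J. d i * a i s) = (\<Sum>i\<in>J. c i * a j t * a i s)"
        using I by (intro sum.cong) (auto simp: d_def)
      then have "(\<Sum>i\<in>I. d i * a i s) =
          (\<Sum>i\<in>J. c i * a j t * a i s) - (\<Sum>i\<in>J. c i * a i t) * a j s"
        using I by (simp add: d_def)
      also have "\<dots> = (\<Sum>i\<in>J. c i * (a j t * a i s - a i t * a j s))"
        by (simp add: right_diff_distrib sum_subtractf sum_distrib_right mult.assoc)
      finally show ?thesis .
    qed
    show ?thesis
    proof (intro exI[of _ d] conjI ballI)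
      show "\<exists>i\<in>I. d i \<noteq> 0"
        using c(1) I j by (auto simp: d_def)
      show "(\<Sum>i\<in>I. d i * a i s) = 0" if "s \<in> insert t T" for s
        using that c(2) by (auto simp: d_sum)
    qed
  qed
qed

text \<open>With more rows than columns the rows of \<open>a\<close> satisfy a nontrivial relation.
  Among its nonzero coefficients take \<open>k\<close> with \<open>L k\<close> maximal; pairing the
  relation with column \<open>k\<close> of \<open>b\<close> leaves only the diagonal term. Ties are
  harmless, since \<open>off\<close> includes equal lengths.\<close>

lemma triangular_card_le:
  fixes a :: "'i \<Rightarrow> 't \<Rightarrow> int" and b :: "'t \<Rightarrow> 'i \<Rightarrow> int" and L :: "'i \<Rightarrow> nat"
  assumes T: "finite T" and I: "finite I"
    and diag: "\<And>k. k \<in> I \<Longrightarrow> (\<Sum>t\<in>T. a k t * b t k) \<noteq> 0"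
    and off: "\<And>i k. i \<in> I \<Longrightarrow> k \<in> I \<Longrightarrow> i \<noteq> k \<Longrightarrow> L i \<le> L k \<Longrightarrow> (\<Sum>t\<in>T. a i t * b t k) = 0"
  shows "card I \<le> card T"
proof (rule ccontr)
  assume "\<not> ?thesis"
  then obtain c where c: "\<exists>i\<in>I. c i \<noteq> 0" "\<And>t. t \<in> T \<Longrightarrow> (\<Sum>i\<in>I. c i * a i t) = 0"
    using linear_relation_exists[OF T I, of a] by force
  then have "finite {i \<in> I. c i \<noteq> 0}" "{i \<in> I. c i \<noteq> 0} \<noteq> {}"
    using I by auto
  then obtain k where "k \<in> {i \<in> I. c i \<noteq> 0}" "\<And>i. i \<in> {i \<in> I. c i \<noteq> 0} \<Longrightarrow> L i \<le> L k"
    by (rule finite_argmax[of _ L]) blast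
  then have k: "k \<in> I" "c k \<noteq> 0" "\<And>i. i \<in> I \<Longrightarrow> c i \<noteq> 0 \<Longrightarrow> L i \<le> L k"
    by auto
  have "0 = (\<Sum>t\<in>T. (\<Sum>i\<in>I. c i * a i t) * b t k)"
    using c(2) by simp
  also have "\<dots> = (\<Sum>i\<in>I. c i * (\<Sum>t\<in>T. a i t * b t k))"
    by (simp add: sum_distrib_left sum_distrib_right mult.assoc) (rule sum.swap)
  also have "\<dots> = (\<Sum>i\<in>I. if i = k then c k * (\<Sum>t\<in>T. a k t * b t k) else 0)"
  proof (rule sum.cong[OF refl])
    fix i assume "i \<in> I"
    then show "c i * (\<Sum>t\<in>T. a i t * b t k) =
        (if i = k then c k * (\<Sum>t\<in>T. a k t * b t k) else 0)"
      using off[of i k] k by (cases "c i = 0") auto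
  qed
  also have "\<dots> = c k * (\<Sum>t\<in>T. a k t * b t k)"
    using I k(1) by simp
  finally show False
    using diag[OF k(1)] k(2) by simp
qed

section \<open>Bounding families by homomorphisms to the integers\<close>

context group
begin

lemma additive_word_val:
  fixes f :: "'a \<Rightarrow> int"
  assumes f: "\<And>x y. x \<in> carrier G \<Longrightarrow> y \<in> carrier G \<Longrightarrow> f (x \<otimes> y) = f x + f y"
    and T: "finite T" "T \<subseteq> carrier G" and u: "set u \<subseteq> T \<times> UNIV"
  shows "f (word_val G u) = (\<Sum>t\<in>T. esum t u * f t)"
proof -
  have one: "f \<one> = 0"
    using f[of \<one> \<one>] by simp
  have inv: "f (inv x) = - f x" if "x \<in> carrier G" for x
    using f[of x "inv x"] one that by simp
  show ?thesis
    using u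
  proof (induction u)
    case (Cons l u)
    let ?e = "if snd l then 1 else -1 :: int"
    have l: "fst l \<in> T" "set u \<subseteq> carrier G \<times> UNIV"
      using Cons.prems T by auto
    have "f (letter_val G l) = ?e * f (fst l)"
      using l(1) T inv by (auto simp: letter_val_def)
    also have "\<dots> = (\<Sum>t\<in>T. if t = fst l then ?e * f t else 0)"
      using l(1) T by simp
    finally have "f (letter_val G l) = (\<Sum>t\<in>T. (if fst l = t then ?e else 0) * f t)"
      by (simp add: eq_commute if_distrib[of "\<lambda>x. x * _"] cong: if_cong)
    moreover have "f (word_val G (l # u)) = f (letter_val G l) + f (word_val G u)"
      using l T f by (simp add: letter_val_closed word_val_closed subset_iff)
    moreover have "f (word_val G u) = (\<Sum>t\<in>T. esum t u * f t)"
      using Cons by simp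
    ultimately have "f (word_val G (l # u)) =
        (\<Sum>t\<in>T. (if fst l = t then ?e else 0) * f t) + (\<Sum>t\<in>T. esum t u * f t)"
      by (simp only:)
    then show ?case
      by (simp only: esum_simps distrib_right sum.distrib)
  qed (use one in simp)
qed

text \<open>A homomorphism is determined on \<open>x i\<close> by its values on \<open>T\<close>,
  which turns the values f k (x i) into a product of matrices through \<open>T\<close>. This is used
  three times: for a basis and for the chords with constant \<open>L\<close>, and for the conjugacy
  classes with the lengths of their words.\<close>

lemma independent_card_le:
  fixes f :: "'i \<Rightarrow> 'a \<Rightarrow> int" and L :: "'i \<Rightarrow> nat"
  assumes T: "finite T" "T \<subseteq> carrier G" and I: "finite I"
    and gen: "\<And>i. i \<in> I \<Longrightarrow> \<exists>u. set u \<subseteq> T \<times> UNIV \<and> word_val G u = x i"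
    and f: "\<And>k x y. k \<in> I \<Longrightarrow> x \<in> carrier G \<Longrightarrow> y \<in> carrier G \<Longrightarrow> f k (x \<otimes> y) = f k x + f k y"
    and diag: "\<And>k. k \<in> I \<Longrightarrow> f k (x k) \<noteq> 0"
    and off: "\<And>i k. i \<in> I \<Longrightarrow> k \<in> I \<Longrightarrow> i \<noteq> k \<Longrightarrow> L i \<le> L k \<Longrightarrow> f k (x i) = 0"
  shows "card I \<le> card T"
proof -
  obtain u where u: "\<And>i. i \<in> I \<Longrightarrow> set (u i) \<subseteq> T \<times> UNIV \<and> word_val G (u i) = x i"
    using gen by metis
  have fx: "f k (x i) = (\<Sum>t\<in>T. esum t (u i) * f k t)" if "i \<in> I" "k \<in> I" for i k
    using additive_word_val[of "f k" T "u i"] f T u that by metis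
  show ?thesis
  proof (rule triangular_card_le[OF T(1) I, of "\<lambda>i t. esum t (u i)" "\<lambda>t k. f k t" L])
    show "(\<Sum>t\<in>T. esum t (u k) * f k t) \<noteq> 0" if "k \<in> I" for k
      using diag[OF that] fx[OF that that] by simp
    show "(\<Sum>t\<in>T. esum t (u i) * f k t) = 0" if "i \<in> I" "k \<in> I" "i \<noteq> k" "L i \<le> L k" for i k
      using off[OF that] fx[OF that(1,2)] by simp
  qed
qed

lemma generate_word:
  assumes "B \<subseteq> carrier G" "x \<in> generate G B"
  shows "\<exists>u. set u \<subseteq> B \<times> UNIV \<and> word_val G u = x"
  using assms(2)
proof induction
  case one
  show ?case by (intro exI[of _ "[]"]) auto
next
  case (incl h)
  then show ?case
    using assms(1) by (intro exI[of _ "[(h, True)]"]) (auto simp: letter_val_def)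
next
  case (inv h)
  then show ?case
    using assms(1) by (intro exI[of _ "[(h, False)]"]) (auto simp: letter_val_def subset_iff)
next
  case (eng h1 h2)
  then obtain u v where "set u \<subseteq> B \<times> UNIV" "word_val G u = h1" "set v \<subseteq> B \<times> UNIV" "word_val G v = h2"
    by blast
  moreover have "set w \<subseteq> carrier G \<times> UNIV" if "set w \<subseteq> B \<times> UNIV" for w :: "('a \<times> bool) list"
    using that assms(1) by auto
  ultimately show ?case
    by (intro exI[of _ "u @ v"]) (auto simp: word_val_append)
qed

lemma word_val_subgroup:
  assumes "subgroup H G" "set u \<subseteq> H \<times> UNIV"
  shows "word_val (G\<lparr>carrier := H\<rparr>) u = word_val G u"
  using assms(2)
proof (induction u)
  case (Cons l u)
  then show ?case
    using assms(1) by (auto simp: word_val_def letter_val_def)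
qed (simp add: word_val_def)

end

text \<open>The exponent sums are dual to the basis, so no finite part of it is larger than
  \<open>B\<close>. Without finiteness \<open>card\<close> would report the rank 0.\<close>

lemma (in free_on) finite_basis:
  assumes "finite B" "B \<subseteq> carrier F" "carrier F = generate F B"
  shows "finite S"
proof -
  have "card I \<le> card B" if I: "finite I" "I \<subseteq> S" for I
  proof (rule independent_card_le[where x = id and f = "\<lambda>t x. esum t (nf x)" and L = "\<lambda>_. 0"])
    show "\<exists>u. set u \<subseteq> B \<times> UNIV \<and> word_val F u = id i" if "i \<in> I" for i
      using that I assms S_subset by (intro generate_word) auto
    fix k x y assume xy: "x \<in> carrier F" "y \<in> carrier F"
    have "nf (x \<otimes> y) = red (nf x @ nf y)"
      using nf[OF xy(1)] nf[OF xy(2)] nf_word_val[of "nf x @ nf y"]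
      by (simp add: word_val_append bword_carrier)
    then show "esum k (nf (x \<otimes> y)) = esum k (nf x) + esum k (nf y)"
      by simp
  next
    fix i k :: 'a
    have nf_basis: "nf i = [(i, True)]" if "i \<in> I" for i
      using nf_word_val[of "[(i, True)]"] that I S_subset
      by (auto simp: letter_val_def push_def subset_iff)
    show "esum k (nf (id k)) \<noteq> 0" if "k \<in> I"
      using nf_basis[OF that] by simp
    show "esum k (nf (id i)) = 0" if "i \<in> I" "i \<noteq> k"
      using nf_basis[OF that(1)] that by simp
  qed (use I assms in auto)
  then show ?thesis
    by (metis finite_if_finite_subsets_card_bdd)
qed

section \<open>The Schreier graph of a subgroup of a free group\<close>

locale free_subgroup = free_on F S for F :: "('a, 'm) monoid_scheme" (structure) and S +
  fixes A :: "'a set"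
  assumes A: "subgroup A F"
begin

abbreviation cosets :: "'a set set" where "cosets \<equiv> rcosets A"

text \<open>Vertices are the right cosets A x. Outside the cosets and for letters outside
  \<open>S\<close> the step stays put, which keeps it invertible everywhere.\<close>

definition coset_step :: "'a set \<Rightarrow> 'a \<times> bool \<Rightarrow> 'a set"
  where "coset_step v l = (if fst l \<in> S \<and> v \<in> cosets then v #> letter_val F l else v)"

lemma A_sub: "A \<subseteq> carrier F"
  using A by (rule subgroup.subset)

lemma cosetE:
  assumes "v \<in> cosets"
  obtains x where "x \<in> carrier F" "v = A #> x"
  using assms unfolding RCOSETS_def by blast

lemma coset_mult:
  assumes "v \<in> cosets" "x \<in> carrier F"
  shows "v #> x \<in> cosets"
proof -
  obtain z where z: "z \<in> carrier F" "v = A #> z"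
    using cosetE[OF assms(1)] .
  have "v #> x = A #> (z \<otimes> x)"
    using coset_mult_assoc[OF A_sub z(1) assms(2)] z(2) by simp
  then show ?thesis
    using rcosetsI[OF A_sub m_closed[OF z(1) assms(2)]] by simp
qed

lemma coset_carrier:
  assumes "v \<in> cosets"
  shows "v \<subseteq> carrier F"
proof -
  obtain z where "z \<in> carrier F" "v = A #> z"
    using cosetE[OF assms] .
  then show ?thesis
    using r_coset_subset_G[OF A_sub] by simp
qed

lemma A_coset: "A \<in> cosets"
  using rcosetsI[OF A_sub one_closed] coset_mult_one[OF A_sub] by simp

lemma foldl_coset_step:
  assumes "v \<in> cosets" "bword w"
  shows "foldl coset_step v w = v #> word_val F w"
  using assms
proof (induction w arbitrary: v)
  case Nil
  then show ?case
    using coset_mult_one[OF coset_carrier] by simp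
next
  case (Cons l w)
  have w: "fst l \<in> S" "bword w"
    using Cons.prems(2) by auto
  have l: "letter_val F l \<in> carrier F" "word_val F w \<in> carrier F"
    using w S_subset letter_val_closed[of l] word_val_closed[OF bword_carrier[OF w(2)]] by auto
  have "foldl coset_step v (l # w) = foldl coset_step (v #> letter_val F l) w"
    using Cons.prems(1) w(1) by (simp add: coset_step_def)
  also have "\<dots> = v #> letter_val F l #> word_val F w"
    by (rule Cons.IH[OF coset_mult[OF Cons.prems(1) l(1)] w(2)])
  also have "\<dots> = v #> word_val F (l # w)"
    using coset_mult_assoc[OF coset_carrier[OF Cons.prems(1)] l] by simp
  finally show ?case .
qed

sublocale schreier_graph S cosets coset_step A
proof
  show "A \<in> cosets"
    by (rule A_coset)
  show "coset_step v l \<in> cosets" if "v \<in> cosets" for v l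
    using that coset_mult[OF that letter_val_closed, of l] S_subset
    by (cases "fst l \<in> S") (auto simp: coset_step_def)
  show "coset_step (coset_step v l) (flip l) = v" for v l
  proof (cases "fst l \<in> S \<and> v \<in> cosets")
    case True
    then have l: "fst l \<in> carrier F"
      using S_subset by auto
    note lv = letter_val_closed[OF l]
    have "coset_step (coset_step v l) (flip l) = v #> letter_val F l #> inv (letter_val F l)"
      using True l coset_mult[of v, OF _ lv] by (simp add: coset_step_def letter_val_flip)
    also have "\<dots> = v"
      using True coset_carrier[of v] lv by (simp add: coset_mult_assoc coset_mult_one)
    finally show ?thesis .
  qed (auto simp: coset_step_def)
  fix v assume "v \<in> cosets"
  then obtain x where x: "x \<in> carrier F" "v = A #> x"
    by (rule cosetE)
  then show "\<exists>w. bword w \<and> foldl coset_step A w = v"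
    using nf[OF x(1)] foldl_coset_step[OF A_coset nf(1)[OF x(1)]] by (intro exI[of _ "nf x"]) simp
qed

lemma walk_base: "bword w \<Longrightarrow> walk A w = A #> word_val F w"
  by (rule foldl_coset_step[OF base_in])

lemma walk_closed_iff:
  assumes "bword w"
  shows "walk A w = A \<longleftrightarrow> word_val F w \<in> A"
  using coset_join1[OF _ word_val_closed[OF bword_carrier[OF assms]] A]
    coset_join2[OF word_val_closed[OF bword_carrier[OF assms]] A] walk_base[OF assms]
  by auto

definition flow :: "('a set \<Rightarrow> 'a \<times> bool \<Rightarrow> bool) \<Rightarrow> 'a set \<times> 'a \<Rightarrow> 'a \<Rightarrow> int"
  where "flow D e x = esum e (cross D A (nf x))"

lemma flow_word_val:
  assumes "undirected D" "bword w"
  shows "flow D e (word_val F w) = esum e (cross D A w)"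
proof -
  have "esum e (cross D A (red w)) = esum e (red (cross D A (red w)))"
    by simp
  also have "\<dots> = esum e (cross D A w)"
    unfolding red_cross_red[OF assms(1)] by simp
  finally show ?thesis
    by (simp add: flow_def nf_word_val[OF assms(2)])
qed

text \<open>Elements of \<open>A\<close> are the closed walks at the vertex \<open>A\<close>, so the
  walk of y starts where the walk of x ends, and the crossings add up.\<close>

lemma flow_mult:
  assumes D: "undirected D" and xy: "x \<in> A" "y \<in> A"
  shows "flow D e (x \<otimes> y) = flow D e x + flow D e y"
proof -
  have x: "x \<in> carrier F" and y: "y \<in> carrier F"
    using xy A_sub by auto
  note nfx = nf[OF x] and nfy = nf[OF y]
  have "x \<otimes> y = word_val F (nf x @ nf y)"
    using nfx nfy by (simp add: word_val_append bword_carrier)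
  then have "flow D e (x \<otimes> y) = esum e (cross D A (nf x @ nf y))"
    using nfx nfy by (simp add: flow_word_val[OF D])
  moreover have "walk A (nf x) = A"
    using nfx xy by (simp add: walk_closed_iff)
  ultimately show ?thesis
    by (simp add: cross_append flow_def)
qed

section \<open>Schreier rewriting and the Nielsen-Schreier theorem\<close>

definition chord_val :: "'a set \<times> 'a \<Rightarrow> 'a"
  where "chord_val e = word_val F (chord_loop e)"

lemma chord_val_in: "e \<in> chords \<Longrightarrow> chord_val e \<in> A"
  using chord_loop walk_closed_iff by (auto simp: chord_val_def)

lemma word_val_expand:
  "set u \<subseteq> chords \<times> UNIV \<Longrightarrow> word_val F (map (apfst chord_val) u) = word_val F (expand u)"
proof (induction u)
  case (Cons l u)
  have e: "fst l \<in> chords" and u: "set u \<subseteq> chords \<times> UNIV"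
    using Cons.prems by auto
  have "letter_val F (apfst chord_val l) =
      word_val F (if snd l then chord_loop (fst l) else inv_word (chord_loop (fst l)))"
    using chord_loop(1)[OF e] by (auto simp: letter_val_def chord_val_def word_val_inv_word bword_carrier)
  then show ?case
    using Cons.IH[OF u] chord_loop(1)[OF e] expand(1)[OF u]
    by (simp add: word_val_append bword_carrier)
qed simp

text \<open>Each letter is replaced by the loop out along the tree, over the letter and back;
  consecutive tree paths cancel. The loop of a tree edge is trivial, that of a chord is its Schreier
  generator up to inversion. At the base vertex the outer tree paths are empty, so a closed walk
  becomes a product of generators.\<close>

lemma word_val_expand_cross:
  "v \<in> cosets \<Longrightarrow> bword w \<Longrightarrow> word_val F (expand (cross tree_edge v w)) =
    word_val F (tree_path v @ w @ inv_word (tree_path (walk v w)))"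
proof (induction w arbitrary: v)
  case Nil
  then show ?case
    using tree_path(1)[of v] by (simp add: word_val_append word_val_inv_word bword_carrier word_val_closed)
next
  case (Cons l w)
  let ?u = "coset_step v l" and ?val = "word_val F"
  have w: "bword w" "bword [l]" and u: "?u \<in> cosets"
    using Cons.prems step_in by auto
  have "walk v (l # w) \<in> cosets"
    using Cons.prems walk_in by blast
  then have paths: "bword (tree_path v)" "bword (tree_path ?u)" "bword (tree_path (walk v (l # w)))"
    using tree_path(1) Cons.prems u by auto
  have closed: "?val z \<in> carrier F" if "bword z" for z
    using that by (intro word_val_closed bword_carrier)
  have hom: "?val (z @ z') = ?val z \<otimes> ?val z'" if "bword z" "bword z'" for z z'
    using that by (intro word_val_append bword_carrier)
  have inv: "?val (inv_word z) = inv (?val z)" if "bword z" for z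
    using that by (intro word_val_inv_word bword_carrier)
  have first: "?val (expand (cross tree_edge v [l])) = ?val (tree_path v @ [l] @ inv_word (tree_path ?u))"
  proof (cases "tree_edge v l")
    case True
    have "?val (tree_path ?u) = ?val (tree_path v @ [l])"
    proof -
      consider "v \<noteq> A" "l = parent v" | "?u \<noteq> A" "flip l = parent ?u"
        using True by (auto simp: tree_edge_def)
      then show ?thesis
      proof cases
        case 1
        then have "tree_path v = tree_path ?u @ [flip l]"
          using Cons.prems(1) tree_path_step by simp
        then show ?thesis
          using paths w hom[of "tree_path ?u" "[flip l]"] hom[of "tree_path ?u @ [flip l]" "[l]"]
            inv[of "[l]"] closed[of "[l]"] closed[of "tree_path ?u"]
          by (simp add: m_assoc)
      next
        case 2
        then have "tree_path ?u = tree_path v @ [l]"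
          using u tree_path_step[of ?u] by (metis flip_flip step_flip)
        then show ?thesis by simp
      qed
    qed
    moreover have "?val (tree_path v @ [l] @ inv_word (tree_path ?u)) =
        ?val (tree_path v @ [l]) \<otimes> inv (?val (tree_path ?u))"
      using hom[of "tree_path v @ [l]" "inv_word (tree_path ?u)"] inv paths w by simp
    moreover have "?val (tree_path v @ [l]) \<in> carrier F"
      using closed[of "tree_path v @ [l]"] paths w by simp
    ultimately show ?thesis
      using True by simp
  next
    case False
    show ?thesis
    proof (cases "snd l")
      case True
      then have "l = (fst l, True)"
        by (metis prod.collapse)
      then show ?thesis
        using False True by (simp add: edge_def chord_loop_def)
    next
      case neg: False
      then have "flip l = (fst l, True)" "[(fst l, True)] = inv_word [l]"
        by (simp_all add: flip_def)
      moreover have "v = coset_step ?u (flip l)"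
        by simp
      ultimately have "chord_loop (?u, fst l) = tree_path ?u @ inv_word [l] @ inv_word (tree_path v)"
        by (simp add: chord_loop_def)
      then show ?thesis
        using False neg by (simp add: edge_def)
    qed
  qed
  have conj: "?val (x @ y @ inv_word z) = ?val x \<otimes> ?val y \<otimes> inv (?val z)"
    if "bword x" "bword y" "bword z" for x y z
  proof -
    have "?val (x @ y @ inv_word z) = ?val x \<otimes> (?val y \<otimes> inv (?val z))"
      using that hom[of x "y @ inv_word z"] hom[of y "inv_word z"] inv[of z] by simp
    then show ?thesis
      using that closed by (simp add: m_assoc)
  qed
  have cancel: "(a \<otimes> b \<otimes> inv c) \<otimes> (c \<otimes> d \<otimes> inv e) = a \<otimes> (b \<otimes> d) \<otimes> inv e"
    if "a \<in> carrier F" "b \<in> carrier F" "c \<in> carrier F" "d \<in> carrier F" "e \<in> carrier F"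
    for a b c d e
  proof -
    have "inv c \<otimes> (c \<otimes> (d \<otimes> inv e)) = d \<otimes> inv e"
      using that by (simp flip: m_assoc)
    then show ?thesis
      using that by (simp add: m_assoc)
  qed
  have exp: "bword (expand (cross tree_edge v z))" if "bword z" "v \<in> cosets" for z v
    using that set_cross[OF _ _ undirected_tree_edge, of v z] 
    by (intro expand(1)) (auto simp: chords_def)
  have "?val (expand (cross tree_edge v (l # w))) =
      ?val (expand (cross tree_edge v [l])) \<otimes> ?val (expand (cross tree_edge ?u w))"
    using hom[OF exp[OF w(2) Cons.prems(1)] exp[OF w(1) u]] by (simp del: expand_simps(2))
  also have "\<dots> = (?val (tree_path v) \<otimes> ?val [l] \<otimes> inv (?val (tree_path ?u))) \<otimes>
      (?val (tree_path ?u) \<otimes> ?val w \<otimes> inv (?val (tree_path (walk v (l # w)))))"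
    unfolding first Cons.IH[OF u w(1)] conj[OF paths(1) w(2) paths(2)]
    using conj[OF paths(2) w(1) paths(3)] by simp
  also have "\<dots> = ?val (tree_path v) \<otimes> (?val [l] \<otimes> ?val w) \<otimes> inv (?val (tree_path (walk v (l # w))))"
    using cancel closed paths w by presburger
  also have "?val [l] \<otimes> ?val w = ?val (l # w)"
    using hom[OF w(2,1)] by simp
  also have "?val (tree_path v) \<otimes> ?val (l # w) \<otimes> inv (?val (tree_path (walk v (l # w)))) =
      ?val (tree_path v @ (l # w) @ inv_word (tree_path (walk v (l # w))))"
    using conj[OF paths(1) Cons.prems(2) paths(3)] by simp
  finally show ?case .
qed

text \<open>Generation is Schreier rewriting; freeness holds because the crossed chords recover the
  reduced word in the generators. The theorem ensures that the choice in \<open>free_rank\<close>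
  really picks a basis.\<close>

theorem nielsen_schreier: "free_basis (F\<lparr>carrier := A\<rparr>) (chord_val ` chords)"
proof -
  let ?cv = "map (apfst chord_val)" and ?FA = "F\<lparr>carrier := A\<rparr>" and ?B = "chord_val ` chords"
  have val: "word_val ?FA (?cv u) = word_val F (expand u)" if "set u \<subseteq> chords \<times> UNIV" for u
  proof -
    have "set (?cv u) \<subseteq> A \<times> UNIV"
      using that chord_val_in by fastforce
    then show ?thesis
      using word_val_subgroup[OF A] word_val_expand[OF that] by simp
  qed
  have red_eq: "red u = red u'"
    if "set u \<subseteq> chords \<times> UNIV" "set u' \<subseteq> chords \<times> UNIV" "word_val ?FA (?cv u) = word_val ?FA (?cv u')"
    for u u'
  proof -
    have "red (expand u) = red (expand u')"
      using that by (simp add: val expand(1) word_val_eq_iff)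
    then have "red (cross tree_edge A (expand u)) = red (cross tree_edge A (expand u'))"
      using red_cross_red[OF undirected_tree_edge] by metis
    then show ?thesis
      using that by (simp add: expand(3))
  qed
  have inj: "inj_on chord_val chords"
  proof (rule inj_onI)
    fix e e' assume "e \<in> chords" "e' \<in> chords" "chord_val e = chord_val e'"
    then show "e = e'"
      using red_eq[of "[(e, True)]" "[(e', True)]"] by (simp add: push_def)
  qed
  have reduced: "reduced_word (?cv u) \<longleftrightarrow> reduced_word u" if "set u \<subseteq> chords \<times> UNIV" for u
  proof -
    have "chord_val (fst l) = chord_val (fst l') \<longleftrightarrow> fst l = fst l'"
      if "l \<in> set u" "l' \<in> set u" for l l'
      using that \<open>set u \<subseteq> chords \<times> UNIV\<close> by (intro inj_on_eq_iff[OF inj]) auto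
    then show ?thesis
      unfolding reduced_word_def successively_map
      by (intro successively_cong refl) simp
  qed
  have lift: "\<exists>u. set u \<subseteq> chords \<times> UNIV \<and> w = ?cv u" if "set w \<subseteq> ?B \<times> UNIV" for w
    using that
  proof (induction w)
    case (Cons l w)
    then obtain u e where "set u \<subseteq> chords \<times> UNIV" "w = ?cv u" "e \<in> chords" "fst l = chord_val e"
      by auto
    then show ?case
      by (intro exI[of _ "(e, snd l) # u"]) (auto simp: prod_eq_iff)
  qed auto
  have "bij_betw (word_val ?FA) {w. set w \<subseteq> ?B \<times> UNIV \<and> reduced_word w} A"
    unfolding bij_betw_def
  proof (intro conjI inj_onI equalityI subsetI)
    fix w w' assume w: "w \<in> {w. set w \<subseteq> ?B \<times> UNIV \<and> reduced_word w}"
      and w': "w' \<in> {w. set w \<subseteq> ?B \<times> UNIV \<and> reduced_word w}"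
      and eq: "word_val ?FA w = word_val ?FA w'"
    obtain u where u: "set u \<subseteq> chords \<times> UNIV" "w = ?cv u"
      using lift[of w] w by blast
    obtain u' where u': "set u' \<subseteq> chords \<times> UNIV" "w' = ?cv u'"
      using lift[of w'] w' by blast
    have "reduced_word u" "reduced_word u'"
      using w w' u u' reduced by auto
    then have "u = u'"
      using red_eq[OF u(1) u'(1)] eq u(2) u'(2) by (simp add: red_reduced)
    then show "w = w'"
      using u(2) u'(2) by simp
  next
    fix x assume "x \<in> word_val ?FA ` {w. set w \<subseteq> ?B \<times> UNIV \<and> reduced_word w}"
    then obtain w where "set w \<subseteq> ?B \<times> UNIV" "x = word_val ?FA w"
      by blast
    then obtain u where u: "set u \<subseteq> chords \<times> UNIV" "x = word_val ?FA (?cv u)"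
      using lift[of w] by blast
    then show "x \<in> A"
      using val[OF u(1)] walk_closed_iff[OF expand(1)[OF u(1)]] expand(2)[OF u(1)] by simp
  next
    fix x assume x: "x \<in> A"
    then have xc: "x \<in> carrier F"
      using A_sub by auto
    let ?c = "cross tree_edge A (nf x)"
    have c: "set ?c \<subseteq> chords \<times> UNIV"
      using set_cross[OF base_in nf(1)[OF xc] undirected_tree_edge] by (auto simp: chords_def)
    then have rc: "set (red ?c) \<subseteq> chords \<times> UNIV"
      using set_red by (rule subset_trans[rotated])
    have closed: "walk A (nf x) = A"
      using x nf[OF xc] by (simp add: walk_closed_iff)
    have "x = word_val F (expand ?c)"
      using word_val_expand_cross[OF base_in nf(1)[OF xc]] closed nf[OF xc] by simp
    also have "\<dots> = word_val F (?cv ?c)"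
      using c by (simp add: word_val_expand)
    also have "\<dots> = word_val F (red (?cv ?c))"
      using c chord_val_in A_sub by (intro word_val_red[symmetric]) fastforce
    also have "red (?cv ?c) = ?cv (red ?c)"
      using red_map[OF inj c] .
    also have "word_val F \<dots> = word_val ?FA (?cv (red ?c))"
      using rc by (simp add: val word_val_expand)
    finally have "x = word_val ?FA (?cv (red ?c))" .
    moreover have "set (?cv (red ?c)) \<subseteq> ?B \<times> UNIV"
      using rc by fastforce
    ultimately show "x \<in> word_val ?FA ` {w. set w \<subseteq> ?B \<times> UNIV \<and> reduced_word w}"
      using reduced[OF rc] by (intro image_eqI[of _ _ "?cv (red ?c)"]) auto
  qed
  then show ?thesis
    using chord_val_in by (auto simp: free_basis_def)
qed

lemma flow_tree_chord:
  assumes "e' \<in> chords"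
  shows "flow tree_edge e (chord_val e') = (if e = e' then 1 else 0)"
  unfolding chord_val_def flow_word_val[OF undirected_tree_edge chord_loop(1)[OF assms]]
  by (simp add: chord_loop(3)[OF assms])

text \<open>Signed crossings of the chords are dual to the Schreier generators. The result turns the
  excess bound, which counts chords, into one in terms of the rank.\<close>

lemma finite_chords:
  assumes B: "finite B" "B \<subseteq> A"
    and gen: "\<And>x. x \<in> A \<Longrightarrow> \<exists>u. set u \<subseteq> B \<times> UNIV \<and> word_val (F\<lparr>carrier := A\<rparr>) u = x"
  shows "finite chords" "card chords \<le> card B"
proof -
  interpret FA: group "F\<lparr>carrier := A\<rparr>"
    using A by (rule subgroup_imp_group)
  have "card I \<le> card B" if I: "finite I" "I \<subseteq> chords" for I
  proof (rule FA.independent_card_le[where x = chord_val and f = "flow tree_edge" and L = "\<lambda>_. 0"])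
    show "\<exists>u. set u \<subseteq> B \<times> UNIV \<and> word_val (F\<lparr>carrier := A\<rparr>) u = chord_val i" if "i \<in> I" for i
      using that I chord_val_in[of i] by (intro gen) auto
    show "flow tree_edge k (chord_val k) \<noteq> 0" if "k \<in> I" for k
      using that I flow_tree_chord[of k k] by auto
    show "flow tree_edge k (chord_val i) = 0" if "i \<in> I" "i \<noteq> k" for i k
      using that I flow_tree_chord[of i k] by auto
  qed (use I B flow_mult[OF undirected_tree_edge] in auto)
  then show "finite chords" "card chords \<le> card B"
    by (metis finite_if_finite_subsets_card_bdd order_refl)+
qed

end

section \<open>Cyclic subgroups and their axes\<close>

text \<open>Strip inverse letters from the two ends as long as possible. That w @ w is reduced
  expresses that w is cyclically reduced.\<close>

lemma cyclic_decomposition: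
  assumes "reduced_word z" "z \<noteq> []"
  shows "\<exists>u w. z = u @ w @ inv_word u \<and> w \<noteq> [] \<and> reduced_word (w @ w)"
  using assms
proof (induction "length z" arbitrary: z rule: less_induct)
  case less
  show ?case
  proof (cases "hd z = flip (last z)")
    case False
    then show ?thesis
      using less.prems by (intro exI[of _ "[]"] exI[of _ z]) (simp add: reduced_word_append)
  next
    case True
    obtain a v where z: "z = a # v"
      using less.prems(2) by (cases z) auto
    have "v \<noteq> []"
      using True z by auto
    then obtain x b where v: "v = x @ [b]"
      by (cases v rule: rev_cases) auto
    have b: "b = flip a"
      using True by (simp add: z v)
    have x: "reduced_word x" "x \<noteq> []"
      using less.prems(1) b by (auto simp: z v reduced_word_Cons reduced_word_append)
    then obtain u w where "x = u @ w @ inv_word u" "w \<noteq> []" "reduced_word (w @ w)"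
      using less.hyps[of x] by (auto simp: z v)
    then show ?thesis
      by (intro exI[of _ "a # u"] exI[of _ w]) (simp add: z v b)
  qed
qed

lemma reduced_word_wpow: "reduced_word (w @ w) \<Longrightarrow> reduced_word (wpow n w)"
proof (induction n)
  case (Suc n)
  have "hd (wpow n w) = hd w" if "w \<noteq> []" "wpow n w \<noteq> []"
    using that by (cases n) auto
  then show ?case
    using Suc by (auto simp: reduced_word_append)
qed simp

lemma esum_eq_0: "(\<And>l. l \<in> set w \<Longrightarrow> fst l \<noteq> x) \<Longrightarrow> esum x w = 0"
  by (induction w) auto

text \<open>All occurrences of the generator of c contribute with the same sign.\<close>

lemma esum_neq_0:
  assumes "c \<in> set w" "flip c \<notin> set w"
  shows "esum (fst c) w \<noteq> 0"
proof -
  define e where "e = (if snd c then 1 else -1 :: int)"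
  have bound: "flip c \<notin> set w \<Longrightarrow> 0 \<le> e * esum (fst c) w \<and> (c \<in> set w \<longrightarrow> 1 \<le> e * esum (fst c) w)" for w
  proof (induction w)
    case (Cons d w)
    have "d = c \<or> fst d \<noteq> fst c"
      using Cons.prems by (auto simp: flip_def prod_eq_iff)
    then have eq: "e * esum (fst c) (d # w) = (if d = c then 1 else 0) + e * esum (fst c) w"
      by (cases "snd c") (auto simp: e_def)
    have "0 \<le> e * esum (fst c) w \<and> (c \<in> set w \<longrightarrow> 1 \<le> e * esum (fst c) w)"
      using Cons by simp
    then show ?case
      unfolding eq by auto
  qed simp
  have "1 \<le> e * esum (fst c) w"
    using bound[OF assms(2)] assms(1) by blast
  then show ?thesis
    by auto
qed

section \<open>Powers, conjugates and index of cyclic subgroups\<close>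

context group
begin

definition powers :: "'a \<Rightarrow> 'a set"
  where "powers g = range (\<lambda>k::int. g [^] k)"

lemma powers_self: "g \<in> carrier G \<Longrightarrow> g \<in> powers g"
  unfolding powers_def by (rule range_eqI[of _ _ 1]) simp

lemma powers_subgroup: "g \<in> carrier G \<Longrightarrow> subgroup (powers g) G"
  using generate_is_subgroup[of "{g}"] generate_pow[of g] by (simp add: powers_def full_SetCompr_eq)

lemma powers_mono: "g \<in> carrier G \<Longrightarrow> h \<in> powers g \<Longrightarrow> powers h \<subseteq> powers g"
  by (auto simp: powers_def int_pow_pow)

lemma powers_inv:
  assumes "g \<in> carrier G"
  shows "powers (inv g) = powers g"
proof -
  have sub: "powers (inv g) \<subseteq> powers g" if "g \<in> carrier G" for g
  proof (rule powers_mono[OF that])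
    show "inv g \<in> powers g"
      unfolding powers_def using int_pow_neg[OF that, of 1] that
      by (intro range_eqI[of _ _ "-1"]) simp
  qed
  show ?thesis
    using sub[OF assms] sub[of "inv g"] assms by auto
qed

lemma cyclic_subgroup_iff: "cyclic_subgroup M G \<longleftrightarrow> subgroup M G \<and> (\<exists>g\<in>M. M = powers g)"
proof (cases "subgroup M G")
  case True
  interpret P: group "G\<lparr>carrier := M\<rparr>"
    using subgroup_imp_group[OF True] .
  have "range (\<lambda>n::int. g [^]\<^bsub>G\<lparr>carrier := M\<rparr>\<^esub> n) = powers g" if "g \<in> M" for g
    unfolding powers_def int_pow_consistent[OF True that] ..
  then show ?thesis
    using True by (auto simp: cyclic_subgroup_def P.cyclic_group)
qed (simp add: cyclic_subgroup_def)

lemma cyclic_subgroup_powers: "g \<in> carrier G \<Longrightarrow> cyclic_subgroup (powers g) G"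
  unfolding cyclic_subgroup_iff using powers_subgroup powers_self by blast

lemma cyclic_subgroup_imp_powers:
  assumes "cyclic_subgroup M G"
  obtains g where "g \<in> carrier G" "M = powers g"
proof -
  have "subgroup M G" "\<exists>g\<in>M. M = powers g"
    using assms unfolding cyclic_subgroup_iff by blast+
  then obtain g where "g \<in> M" "M = powers g"
    by blast
  then show thesis
    using that subgroup.mem_carrier[OF \<open>subgroup M G\<close>] by blast
qed

lemma conj_int_pow:
  assumes "x \<in> carrier G" "z \<in> carrier G"
  shows "(x \<otimes> z \<otimes> inv x) [^] (k::int) = x \<otimes> z [^] k \<otimes> inv x"
proof -
  have "(x \<otimes> a \<otimes> inv x) \<otimes> (x \<otimes> b \<otimes> inv x) = x \<otimes> (a \<otimes> b) \<otimes> inv x"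
    if "a \<in> carrier G" "b \<in> carrier G" for a b
  proof -
    have "inv x \<otimes> (x \<otimes> (b \<otimes> inv x)) = b \<otimes> inv x"
      using that assms by (simp flip: m_assoc)
    then show ?thesis
      using that assms by (simp add: m_assoc)
  qed
  then have "(\<lambda>z. x \<otimes> z \<otimes> inv x) \<in> hom G G"
    using assms by (intro homI) auto
  then show ?thesis
    using hom_int_pow[of "\<lambda>z. x \<otimes> z \<otimes> inv x" G G z k, OF _ assms(2) is_group is_group] by simp
qed

lemma powers_conj:
  assumes "x \<in> carrier G" "z \<in> carrier G"
  shows "powers (x \<otimes> z \<otimes> inv x) = (\<lambda>a. x \<otimes> a \<otimes> inv x) ` powers z"
  by (simp add: powers_def conj_int_pow[OF assms] image_image)

lemma coset_conj: "x <# M #> inv x = (\<lambda>a. x \<otimes> a \<otimes> inv x) ` M"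
  by (auto simp: l_coset_def r_coset_def)

lemma conj_class_powers:
  assumes "x \<in> carrier G" "z \<in> carrier G"
  shows "subgroup_conj_class G (powers (x \<otimes> z \<otimes> inv x)) = subgroup_conj_class G (powers z)"
proof -
  have cls: "subgroup_conj_class G (powers z) = (\<lambda>g. powers (g \<otimes> z \<otimes> inv g)) ` carrier G"
    if "z \<in> carrier G" for z
    using that by (auto simp: subgroup_conj_class_def orbit_def coset_conj powers_conj)
  have conj: "g \<otimes> (x \<otimes> z \<otimes> inv x) \<otimes> inv g = (g \<otimes> x) \<otimes> z \<otimes> inv (g \<otimes> x)"
    if "g \<in> carrier G" for g
    using that assms by (simp add: inv_mult_group m_assoc)
  have "g \<in> (\<lambda>g. g \<otimes> x) ` carrier G" if "g \<in> carrier G" for g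
    using that assms by (intro image_eqI[of _ _ "g \<otimes> inv x"]) (auto simp: m_assoc)
  then have "(\<lambda>g. g \<otimes> x) ` carrier G = carrier G"
    using assms by auto
  then have "(\<lambda>g. powers (g \<otimes> z \<otimes> inv g)) ` carrier G =
      (\<lambda>g. powers (g \<otimes> z \<otimes> inv g)) ` (\<lambda>g. g \<otimes> x) ` carrier G"
    by (rule arg_cong[OF sym])
  also have "\<dots> = (\<lambda>g. powers (g \<otimes> (x \<otimes> z \<otimes> inv x) \<otimes> inv g)) ` carrier G"
    unfolding image_image by (rule image_cong[OF refl]) (simp only: conj)
  finally show ?thesis
    using assms by (simp add: cls)
qed

text \<open>As there are finitely many cosets, two powers of g share one, so some positive power
  lies in \<open>A\<close>; n is the least such exponent. The inequality has the direction that
  carries a lower bound for the index over to n.\<close>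

lemma finite_index_powers:
  assumes A: "subgroup A G" and g: "g \<in> carrier G"
    and fin: "subgroup_index G (powers g) (A \<inter> powers g) < \<infinity>"
  obtains n where "n > 0" "\<And>j::int. g [^] j \<in> A \<longleftrightarrow> int n dvd j"
    "subgroup_index G (powers g) (A \<inter> powers g) \<le> enat n"
proof -
  define H where "H = A \<inter> powers g"
  have H: "subgroup H G"
    unfolding H_def using A powers_subgroup[OF g] by (rule subgroups_Inter_pair)
  have Hc: "H \<subseteq> carrier G"
    using H by (rule subgroup.subset)
  define C where "C = rcosets\<^bsub>G\<lparr>carrier := powers g\<rparr>\<^esub> H"
  have C: "C = (\<lambda>k::int. H #> g [^] k) ` UNIV"
    unfolding C_def RCOSETS_def powers_def by auto
  have finC: "finite C"
    using fin by (auto simp: subgroup_index_def Let_def C_def H_def split: if_splits)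
  have mem: "g [^] j \<in> H \<longleftrightarrow> g [^] j \<in> A" for j :: int
    by (auto simp: H_def powers_def)
  have "\<not> inj (\<lambda>k::int. H #> g [^] k)"
    using finC infinite_UNIV_int finite_imageD unfolding C by blast
  then obtain i j :: int where "i < j" "H #> g [^] i = H #> g [^] j"
    unfolding inj_def by (metis linorder_neqE_linordered_idom)
  then have "g [^] j \<in> H #> g [^] i"
    using rcos_self[OF int_pow_closed[OF g, of j] H] by (simp only:)
  then obtain a where a: "a \<in> H" "g [^] j = a \<otimes> g [^] i"
    by (auto simp: r_coset_def)
  have "g [^] (j - i) = a"
    using a Hc g by (auto simp: int_pow_diff m_assoc subset_iff)
  then have ex: "\<exists>n>0. g [^] (int n) \<in> A"
    using a(1) \<open>i < j\<close> by (intro exI[of _ "nat (j - i)"]) (auto simp: H_def)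
  define n where "n = (LEAST n. n > 0 \<and> g [^] (int n) \<in> A)"
  have n: "n > 0" "g [^] (int n) \<in> A"
    using LeastI_ex[OF ex] by (auto simp: n_def)
  have multiple: "g [^] (int n * k) \<in> A" for k :: int
    using subgroup_int_pow_closed[OF A n(2), of k] int_pow_pow[OF g] by simp
  have dvd: "g [^] j \<in> A \<longleftrightarrow> int n dvd j" for j :: int
  proof
    assume "g [^] j \<in> A"
    moreover have "g [^] (j mod int n) = g [^] j \<otimes> inv (g [^] (int n * (j div int n)))"
      using int_pow_diff[OF g, of j "int n * (j div int n)"] by (simp add: minus_mult_div_eq_mod)
    ultimately have "g [^] (j mod int n) \<in> A"
      using multiple A by (simp add: subgroup.m_closed subgroup.m_inv_closed)
    then have "g [^] (int (nat (j mod int n))) \<in> A"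
      using n(1) by simp
    moreover have "nat (j mod int n) < n"
      using n(1) by (simp add: nat_less_iff)
    ultimately have "nat (j mod int n) = 0"
      using not_less_Least[of "nat (j mod int n)" "\<lambda>n. n > 0 \<and> g [^] (int n) \<in> A"]
      by (auto simp: n_def)
    moreover have "j mod int n \<ge> 0"
      using n(1) by simp
    ultimately show "int n dvd j"
      by (simp add: dvd_eq_mod_eq_0)
  qed (use multiple in auto)
  have mod_n: "H #> g [^] k = H #> g [^] (k mod int n)" for k :: int
  proof -
    have m: "g [^] (int n * (k div int n)) \<in> H"
      using multiple mem by blast
    have "g [^] k = g [^] (int n * (k div int n)) \<otimes> g [^] (k mod int n)"
      using int_pow_mult[OF g, of "int n * (k div int n)" "k mod int n"] by simp
    then have "H #> g [^] k = H #> g [^] (int n * (k div int n)) #> g [^] (k mod int n)"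
      using coset_mult_assoc[OF Hc] g by simp
    also have "H #> g [^] (int n * (k div int n)) = H"
      using coset_join2[OF _ H m] g by simp
    finally show ?thesis .
  qed
  have "C \<subseteq> (\<lambda>k::int. H #> g [^] k) ` {0..<int n}"
    unfolding C
  proof (rule image_subsetI)
    fix k :: int
    show "H #> g [^] k \<in> (\<lambda>k::int. H #> g [^] k) ` {0..<int n}"
      by (rule image_eqI[of _ _ "k mod int n"]) (rule mod_n, use n(1) in simp)
  qed
  then have "card C \<le> card {0..<int n}"
    by (rule surj_card_le[rotated]) simp
  then have "card C \<le> n"
    by simp
  moreover have "subgroup_index G (powers g) (A \<inter> powers g) = enat (card C)"
    unfolding subgroup_index_def Let_def H_def[symmetric] C_def[symmetric] using finC by simp
  ultimately have "subgroup_index G (powers g) (A \<inter> powers g) \<le> enat n"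
    by simp
  then show thesis
    by (rule that[OF n(1) dvd])
qed

end

section \<open>Axes in the Cayley tree\<close>

context free_on
begin

text \<open>A bi-infinite path \<open>pos\<close> in the Cayley tree, reading the letters \<open>l\<close>, that \<open>g\<close> translates
  by \<open>L\<close>.\<close>

definition axis :: "'a \<Rightarrow> (int \<Rightarrow> 'a) \<Rightarrow> (int \<Rightarrow> 'a \<times> bool) \<Rightarrow> nat \<Rightarrow> bool"
  where "axis g pos l L \<longleftrightarrow> g \<in> carrier F \<and> L > 0 \<and>
    (\<forall>p. pos p \<in> carrier F \<and> fst (l p) \<in> S \<and> pos (p + 1) = pos p \<otimes> letter_val F (l p) \<and>
      pos (p + int L) = g \<otimes> pos p \<and> l (p + int L) = l p \<and> l (p + 1) \<noteq> flip (l p))"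

lemma axisD:
  assumes "axis g pos l L"
  shows "g \<in> carrier F" "L > 0" "pos p \<in> carrier F" "fst (l p) \<in> S"
    "pos (p + 1) = pos p \<otimes> letter_val F (l p)" "pos (p + int L) = g \<otimes> pos p"
    "l (p + int L) = l p" "l (p + 1) \<noteq> flip (l p)"
  using assms by (auto simp: axis_def)

text \<open>Write the normal form of g as u w u^-1 with w cyclically reduced. The axis passes
  through the points u w^k v with v a prefix of w; position p has k = p div L and v of length p mod
  L.\<close>

lemma axis_exists:
  assumes g: "g \<in> carrier F" "g \<noteq> \<one>"
  shows "\<exists>pos l L. axis g pos l L"
proof -
  have "nf g \<noteq> []"
    using nf(3)[OF g(1)] g(2) by auto
  then obtain u w where uw: "nf g = u @ w @ inv_word u" "w \<noteq> []" "reduced_word (w @ w)"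
    using cyclic_decomposition[OF nf(2)[OF g(1)]] by blast
  have bw: "bword u" "bword w"
    using nf(1)[OF g(1)] by (auto simp: uw(1))
  define U where "U = word_val F u"
  define W where "W = word_val F w"
  have UW: "U \<in> carrier F" "W \<in> carrier F"
    using bw by (auto simp: U_def W_def intro!: word_val_closed bword_carrier)
  have g_eq: "g = U \<otimes> W \<otimes> inv U"
    using nf(3)[OF g(1)] bw UW
    by (simp add: uw(1) word_val_append word_val_inv_word bword_carrier U_def W_def m_assoc)
  define L where "L = length w"
  have L: "L > 0"
    using uw(2) by (simp add: L_def)
  define m where "m p = nat (p mod int L)" for p
  define l where "l p = w ! m p" for p
  define pos where "pos p = U \<otimes> W [^] (p div int L) \<otimes> word_val F (take (m p) w)" for p
  have m: "m p < L" "p mod int L = int (m p)" for p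
    using L by (auto simp: m_def nat_less_iff)
  have btake: "bword (take k w)" for k
    using bw(2) set_take_subset[of k w] by blast
  have take_closed: "word_val F (take k w) \<in> carrier F" for k
    using btake by (intro word_val_closed bword_carrier)
  have l_in: "l p \<in> S \<times> UNIV" for p
  proof -
    have "l p \<in> set w"
      using m(1)[of p] unfolding l_def L_def by (rule nth_mem)
    then show ?thesis
      using bw(2) by blast
  qed
  have lS: "fst (l p) \<in> S" for p
    using l_in[of p] by (simp add: mem_Times_iff)
  have lval: "letter_val F (l p) \<in> carrier F" for p
    by (rule letter_val_closed[OF subsetD[OF S_subset lS]])
  have take_Suc: "word_val F (take (Suc (m p)) w) = word_val F (take (m p) w) \<otimes> letter_val F (l p)" for p
  proof -
    have "take (Suc (m p)) w = take (m p) w @ [l p]"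
      using m(1)[of p] by (simp add: l_def L_def take_Suc_conv_app_nth)
    then show ?thesis
      using word_val_append[OF bword_carrier[OF btake] bword_carrier, of "[l p]"] l_in lval by simp
  qed
  \<comment> \<open>A step either stays within a copy of w or completes it and enters the next
    one.\<close>
  have succ: "(Suc (m p) < L \<and> m (p + 1) = Suc (m p) \<and> (p + 1) div int L = p div int L) \<or>
      (Suc (m p) = L \<and> m (p + 1) = 0 \<and> (p + 1) div int L = p div int L + 1)" for p
  proof -
    have p: "p = int L * (p div int L) + int (m p)"
      using mult_div_mod_eq[of "int L" p] m(2)[of p] by simp
    show ?thesis
    proof (cases "Suc (m p) < L")
      case True
      have eq: "p + 1 = int L * (p div int L) + int (Suc (m p))"
        using p by simp
      have dm: "(p + 1) div int L = p div int L" "(p + 1) mod int L = int (Suc (m p))"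
        by (rule int_div_pos_eq[OF eq] int_mod_pos_eq[OF eq]; use True in simp)+
      have "m (p + 1) = Suc (m p)"
        unfolding m_def[of "p + 1"] dm(2) by simp
      then show ?thesis
        using True dm(1) by simp
    next
      case False
      then have "Suc (m p) = L"
        using m(1)[of p] by simp
      then have "p + 1 = int L * (p div int L) + int L"
        using p by linarith
      then have eq: "p + 1 = int L * (p div int L + 1) + 0"
        by (simp add: distrib_left)
      have "(p + 1) div int L = p div int L + 1" "(p + 1) mod int L = 0"
        by (rule int_div_pos_eq[OF eq] int_mod_pos_eq[OF eq]; use L in simp)+
      then show ?thesis
        using \<open>Suc (m p) = L\<close> by (simp add: m_def)
    qed
  qed
  have "axis g pos l L"
    unfolding axis_def
  proof (intro conjI allI)
    fix p
    show "pos p \<in> carrier F"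
      using UW take_closed by (simp add: pos_def)
    show "fst (l p) \<in> S"
      by (rule lS)
    show "pos (p + 1) = pos p \<otimes> letter_val F (l p)"
    proof (cases "Suc (m p) < L")
      case True
      then have "pos (p + 1) = U \<otimes> W [^] (p div int L) \<otimes> word_val F (take (Suc (m p)) w)"
        using succ[of p] by (simp add: pos_def)
      then show ?thesis
        using UW take_closed lval by (simp add: take_Suc pos_def m_assoc)
    next
      case False
      then have s: "Suc (m p) = L" "m (p + 1) = 0" "(p + 1) div int L = p div int L + 1"
        using succ[of p] by auto
      have "W = word_val F (take (Suc (m p)) w)"
        unfolding s(1) by (simp add: W_def L_def)
      then have W: "W = word_val F (take (m p) w) \<otimes> letter_val F (l p)"
        by (simp only: take_Suc)
      have "pos (p + 1) = U \<otimes> (W [^] (p div int L) \<otimes> W)"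
        using UW s(2,3) int_pow_mult[OF UW(2), of "p div int L" 1] by (simp add: pos_def)
      also have "\<dots> = U \<otimes> (W [^] (p div int L) \<otimes> (word_val F (take (m p) w) \<otimes> letter_val F (l p)))"
        using W by (simp only:)
      also have "\<dots> = pos p \<otimes> letter_val F (l p)"
        using UW take_closed lval by (simp add: pos_def m_assoc)
      finally show ?thesis .
    qed
    have mL: "m (p + int L) = m p" "(p + int L) div int L = 1 + p div int L"
      using L by (simp_all add: m_def)
    then show "l (p + int L) = l p"
      by (simp add: l_def)
    have "pos (p + int L) = U \<otimes> (W \<otimes> W [^] (p div int L)) \<otimes> word_val F (take (m p) w)"
      using mL UW int_pow_mult[OF UW(2), of 1 "p div int L"] by (simp add: pos_def)
    also have "\<dots> = (U \<otimes> W \<otimes> inv U) \<otimes> pos p"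
    proof -
      have "inv U \<otimes> (U \<otimes> z) = z" if "z \<in> carrier F" for z
        using that UW by (simp flip: m_assoc)
      then show ?thesis
        using UW take_closed by (simp add: pos_def m_assoc)
    qed
    finally show "pos (p + int L) = g \<otimes> pos p"
      by (simp only: g_eq)
    show "l (p + 1) \<noteq> flip (l p)"
    proof (cases "Suc (m p) < L")
      case True
      have "successively (\<lambda>l l'. l' \<noteq> flip l) w"
        using uw(3) by (simp add: reduced_word_append flip: reduced_word_iff)
      then show ?thesis
        using successively_nth[of _ w "m p"] True succ[of p] by (auto simp: l_def L_def)
    next
      case False
      then have "Suc (m p) = L" "m (p + 1) = 0"
        using succ[of p] by auto
      then have "m p = length w - 1" "m (p + 1) = 0"
        by (auto simp: L_def)
      then have "l (p + 1) = hd w" "l p = last w"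
        using uw(2) unfolding l_def by (simp_all add: hd_conv_nth last_conv_nth)
      then show ?thesis
        using uw(2,3) by (simp add: reduced_word_append)
    qed
  qed (use g L in auto)
  then show ?thesis
    by blast
qed

text \<open>Turning an axis around reduces overlaps in opposite directions to overlaps in the same
  direction. The letter at p leads from \<open>pos (- p)\<close> to \<open>pos (- p - 1)\<close>,
  hence the index - p - 1.\<close>

lemma axis_reverse:
  assumes "axis g pos l L"
  shows "axis (inv g) (\<lambda>p. pos (- p)) (\<lambda>p. flip (l (- p - 1))) L"
  unfolding axis_def
proof (intro conjI allI)
  note ax = axisD[OF assms]
  fix p
  have lc: "fst (l q) \<in> carrier F" for q
    using ax(4) S_subset by blast
  show "inv g \<in> carrier F" "L > 0" "pos (- p) \<in> carrier F" "fst (flip (l (- p - 1))) \<in> S"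
    using ax by simp_all
  have "pos (- p) = pos (- p - 1) \<otimes> letter_val F (l (- p - 1))"
    using ax(5)[of "- p - 1"] by simp
  then have "pos (- p) \<otimes> letter_val F (flip (l (- p - 1))) = pos (- p - 1)"
    using ax(3) lc by (simp add: letter_val_flip letter_val_closed m_assoc)
  moreover have "- (p + 1) = - p - 1"
    by linarith
  ultimately show "pos (- (p + 1)) = pos (- p) \<otimes> letter_val F (flip (l (- p - 1)))"
    by (simp only:)
  have "pos (- p) = g \<otimes> pos (- p - int L)"
    using ax(6)[of "- p - int L"] by simp
  then have "inv g \<otimes> pos (- p) = pos (- p - int L)"
    using ax(1,3) by (simp flip: m_assoc)
  moreover have "- (p + int L) = - p - int L"
    by linarith
  ultimately show "pos (- (p + int L)) = inv g \<otimes> pos (- p)"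
    by (simp only:)
  have "- (p + int L) - 1 = - p - 1 - int L" "- p - 1 - int L + int L = - p - 1"
    by linarith+
  then show "flip (l (- (p + int L) - 1)) = flip (l (- p - 1))"
    using ax(7)[of "- p - 1 - int L"] by (simp only:)
  have "- (p + 1) - 1 = - p - 2" "- p - 2 + 1 = - p - 1"
    by linarith+
  then show "flip (l (- (p + 1) - 1)) \<noteq> flip (flip (l (- p - 1)))"
    using ax(8)[of "- p - 2"] by (metis flip_flip)
qed

lemma bword_window:
  assumes "axis g pos l L"
  shows "bword (window l m p)"
proof -
  have "l q \<in> S \<times> UNIV" for q
    using axisD(4)[OF assms] by (simp add: mem_Times_iff)
  then show ?thesis
    by (simp add: window_def image_subset_iff del: mem_Times_iff)
qed

lemma pos_window:
  assumes "axis g pos l L"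
  shows "pos (p + int m) = pos p \<otimes> word_val F (window l m p)"
proof (induction m)
  case 0
  then show ?case
    using axisD(3)[OF assms] by (simp add: window_def)
next
  case (Suc m)
  note ax = axisD[OF assms]
  have l: "bword [l (p + int m)]" "letter_val F (l (p + int m)) \<in> carrier F"
    using ax(4)[of "p + int m"] S_subset by (auto simp: mem_Times_iff intro!: letter_val_closed)
  have "word_val F (window l (Suc m) p) = word_val F (window l m p) \<otimes> letter_val F (l (p + int m))"
    using word_val_append[OF bword_carrier bword_carrier, OF bword_window[OF assms] l(1)] l(2)
    by (simp add: window_snoc)
  moreover have "pos (p + int (Suc m)) = pos (p + int m) \<otimes> letter_val F (l (p + int m))"
    using ax(5)[of "p + int m"] by (simp add: algebra_simps)
  ultimately show ?case
    using Suc ax(3) l(2) word_val_closed[OF bword_carrier[OF bword_window[OF assms]]]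
    by (simp add: m_assoc)
qed

lemma pos_pow:
  assumes "axis g pos l L"
  shows "pos (p + int L * j) = g [^] j \<otimes> pos p"
proof -
  note ax = axisD[OF assms]
  define f where "f j = inv (g [^] j) \<otimes> pos (p + int L * j)" for j
  have "f (j + 1) = f j" for j
  proof -
    have "pos (p + int L * (j + 1)) = g \<otimes> pos (p + int L * j)"
      using ax(6)[of "p + int L * j"] by (simp add: algebra_simps)
    moreover have "g [^] (j + 1) = g \<otimes> g [^] j"
      using int_pow_mult[OF ax(1), of 1 j] ax(1) by (simp add: add.commute)
    ultimately have "f (j + 1) = inv (g [^] j) \<otimes> (inv g \<otimes> (g \<otimes> pos (p + int L * j)))"
      using ax by (simp add: f_def inv_mult_group m_assoc)
    also have "\<dots> = f j"
      using ax by (simp add: f_def flip: m_assoc[of "inv g"])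
    finally show ?thesis .
  qed
  \<comment> \<open>A function of period 1 is constant, which covers negative exponents as
    well.\<close>
  then have "f (0 + 1 * j) = f 0"
    by (rule periodic_mod(1))
  then have "inv (g [^] j) \<otimes> pos (p + int L * j) = pos p"
    using ax(3) by (simp add: f_def)
  then have "g [^] j \<otimes> (inv (g [^] j) \<otimes> pos (p + int L * j)) = g [^] j \<otimes> pos p"
    by (rule arg_cong)
  then show ?thesis
    using ax by (simp flip: m_assoc)
qed

lemma window_val:
  assumes "axis g pos l L"
  shows "g = pos p \<otimes> word_val F (window l L p) \<otimes> inv (pos p)"
proof -
  note ax = axisD[OF assms]
  have "pos p \<otimes> word_val F (window l L p) = g \<otimes> pos p"
    using pos_window[OF assms, of p L] ax(6)[of p] by simp
  then show ?thesis
    using ax by (simp add: m_assoc)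
qed

text \<open>As g is a power of the conjugate of z by \<open>pos p\<close>, maximality leaves no room
  between the two cyclic groups. So a root of the period word already determines the conjugacy
  class.\<close>

lemma root_generates:
  assumes ax: "axis g pos l L" and max: "maximal_cyclic_subgroup (powers g) F"
    and z: "bword z" "window l L p = wpow a z"
  shows "powers g = powers (pos p \<otimes> word_val F z \<otimes> inv (pos p))"
    "g = (pos p \<otimes> word_val F z \<otimes> inv (pos p)) [^] (int a)"
proof -
  let ?\<zeta> = "pos p \<otimes> word_val F z \<otimes> inv (pos p)"
  have zc: "word_val F z \<in> carrier F" "pos p \<in> carrier F"
    using z axisD(3)[OF ax] by (auto intro!: word_val_closed bword_carrier)
  have "word_val F (window l L p) = word_val F z [^] int a"
    using z word_val_wpow[OF bword_carrier[OF z(1)], of a] by (simp add: int_pow_int)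
  then have "g = pos p \<otimes> word_val F z [^] int a \<otimes> inv (pos p)"
    using window_val[OF ax, of p] by simp
  then show g: "g = ?\<zeta> [^] int a"
    using conj_int_pow[OF zc(2,1)] by simp
  have \<zeta>: "?\<zeta> \<in> carrier F"
    using zc by simp
  have "g \<in> powers ?\<zeta>"
    unfolding powers_def using g by (rule range_eqI)
  then have "powers g \<subseteq> powers ?\<zeta>"
    by (rule powers_mono[OF \<zeta>])
  then show "powers g = powers ?\<zeta>"
    using max cyclic_subgroup_powers[OF \<zeta>] unfolding maximal_cyclic_subgroup_def by blast
qed

text \<open>Two axes that read the same letters along the sum of their periods: the two period words
  starting there commute, hence are powers of a common word.\<close>

lemma overlap_imp_conj:
  assumes ax: "axis g pos l L" and max: "maximal_cyclic_subgroup (powers g) F"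
    and ax': "axis g' pos' l' L'" and max': "maximal_cyclic_subgroup (powers g') F"
    and overlap: "\<And>t. t < L + L' \<Longrightarrow> l (q + int t) = l' (p + int t)"
  shows "subgroup_conj_class F (powers g) = subgroup_conj_class F (powers g')"
proof -
  note a = axisD[OF ax] and a' = axisD[OF ax']
  let ?w = "window l L q" and ?w' = "window l' L' p"
  have "?w @ ?w' = window l (L + L') q"
  proof -
    have "l (q + int L + int t) = l' (p + int t)" if "t < L'" for t
      using overlap[of t] that a(7)[of "q + int t"] by (simp add: algebra_simps)
    then have "window l L' (q + int L) = ?w'"
      by (simp add: window_eq_iff)
    then show ?thesis
      by (simp add: window_add)
  qed
  also have "\<dots> = window l' (L' + L) p"
    using overlap by (auto simp: window_def add.commute)
  also have "\<dots> = ?w' @ ?w"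
  proof -
    have "l' (p + int L' + int t) = l (q + int t)" if "t < L" for t
      using overlap[of t] that a'(7)[of "p + int t"] by (simp add: algebra_simps)
    then have "window l' L (p + int L') = ?w"
      by (simp add: window_eq_iff)
    then show ?thesis
      by (simp add: window_add)
  qed
  finally obtain m n z where mn: "wpow m z = ?w" "wpow n z = ?w'"
    using comm_append_are_replicate[of ?w ?w'] unfolding wpow_def by blast
  have "?w \<noteq> []"
    using a(2) by (metis length_window less_not_refl list.size(3))
  then have "m \<noteq> 0"
    using mn(1) by (cases m) auto
  then have "set z \<subseteq> set ?w"
    unfolding mn(1)[symmetric] by (cases m) auto
  then have z: "bword z"
    using bword_window[OF ax] by blast
  have closed: "pos q \<in> carrier F" "pos' p \<in> carrier F" "word_val F z \<in> carrier F"
    using a(3) a'(3) z by (auto intro!: word_val_closed bword_carrier)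
  show ?thesis
    using root_generates(1)[OF ax max z mn(1)[symmetric]] root_generates(1)[OF ax' max' z mn(2)[symmetric]]
      conj_class_powers[OF closed(1,3)] conj_class_powers[OF closed(2,3)] by simp
qed

lemma reverse_overlap_imp_conj:
  assumes ax: "axis g pos l L" and max: "maximal_cyclic_subgroup (powers g) F"
    and ax': "axis g' pos' l' L'" and max': "maximal_cyclic_subgroup (powers g') F"
    and overlap: "\<And>t. t < L + L' \<Longrightarrow> l (q - int t) = flip (l' (p + int t))"
  shows "subgroup_conj_class F (powers g) = subgroup_conj_class F (powers g')"
proof -
  have inv: "powers (inv g) = powers g"
    by (rule powers_inv[OF axisD(1)[OF ax]])
  have "flip (l (- (- q - 1 + int t) - 1)) = l' (p + int t)" if "t < L + L'" for t
  proof -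
    have "- (- q - 1 + int t) - 1 = q - int t"
      by linarith
    then show ?thesis
      using overlap[OF that] by simp
  qed
  then show ?thesis
    using overlap_imp_conj[OF axis_reverse[OF ax] _ ax' max', of "- q - 1" p] max by (simp add: inv)
qed

text \<open>A shift by less than a period splits the period word as x y = y x, so it is a proper
  power of some z. By maximality the corresponding root \<zeta> of g is itself a power of g, so
  \<zeta> equals its own power with exponent (m + n) c where m + n \<ge> 2, which torsion-freeness
  forbids.\<close>

lemma axis_primitive:
  assumes ax: "axis g pos l L" and max: "maximal_cyclic_subgroup (powers g) F"
    and shift: "\<And>t. l (p + t) = l (q + t)"
  shows "int L dvd p - q"
proof (rule ccontr)
  assume not_dvd: "\<not> int L dvd p - q"
  note a = axisD[OF ax]
  define d where "d = nat ((p - q) mod int L)"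
  have d: "int d = (p - q) mod int L" "d < L" "d > 0"
    using not_dvd a(2) by (auto simp: d_def nat_less_iff dvd_eq_mod_eq_0 le_neq_trans)
  have shift_d: "l (s + int d) = l s" for s
  proof -
    have eq: "s + (p - q) = s + int d + int L * ((p - q) div int L)"
      using mult_div_mod_eq[of "int L" "p - q"] d(1) by linarith
    have "l (s + (p - q)) = l (s + int d)"
      unfolding eq by (rule periodic_mod(1)) (rule a(7))
    moreover have "l (s + (p - q)) = l s"
      using shift[of "s - q"] by (simp add: algebra_simps)
    ultimately show ?thesis by simp
  qed
  let ?x = "window l d 0" and ?y = "window l (L - d) 0"
  have w1: "window l L 0 = ?x @ ?y"
  proof -
    have "window l (L - d) (0 + int d) = ?y"
      using shift_d by (auto simp: window_def add.commute)
    then show ?thesis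
      using window_add[of l d "L - d" 0] d(2) by simp
  qed
  have w2: "window l L 0 = ?y @ ?x"
  proof -
    have "l (int (L - d) + int t) = l (int t)" for t
      using shift_d[of "int (L - d) + int t"] a(7)[of "int t"] d(2) by (simp add: of_nat_diff algebra_simps)
    then have "window l d (0 + int (L - d)) = ?x"
      by (auto simp: window_def)
    then show ?thesis
      using window_add[of l "L - d" d 0] d(2) by simp
  qed
  obtain m n z where mn: "wpow m z = ?x" "wpow n z = ?y"
    using comm_append_are_replicate[of ?x ?y] w1 w2 unfolding wpow_def by metis
  have ne: "?x \<noteq> []" "?y \<noteq> []"
    using d by (auto simp: window_def)
  have m: "m > 0" "n > 0" "z \<noteq> []"
    using mn ne by (auto intro!: Nat.gr0I)
  have w: "window l L 0 = wpow (m + n) z"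
    by (simp add: w1 mn wpow_add)
  have "set z \<subseteq> set ?x"
    unfolding mn(1)[symmetric] using m(1) by (cases m) auto
  then have z: "bword z"
    using bword_window[OF ax] by blast
  have "m + n = Suc (Suc (m + n - 2))"
    using m by simp
  then have "window l L 0 = (z @ z) @ wpow (m + n - 2) z"
    unfolding w by (metis append_assoc wpow_simps(2))
  then have "reduced_word ((z @ z) @ wpow (m + n - 2) z)"
    using reduced_window[of l L 0, OF a(8)] by (simp only:)
  then have "reduced_word (z @ z)"
    unfolding reduced_word_append[of "z @ z"] by blast
  let ?\<zeta> = "pos 0 \<otimes> word_val F z \<otimes> inv (pos 0)"
  have closed: "pos 0 \<in> carrier F" "word_val F z \<in> carrier F" "?\<zeta> \<in> carrier F"
    using a(3)[of 0] z by (auto intro!: word_val_closed bword_carrier)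
  \<comment> \<open>The word z is cyclically reduced, since z z occurs in a reduced window. Hence
    its powers are reduced as written and nonempty.\<close>
  have torsion_free: "k = 0" if "?\<zeta> [^] (k::int) = \<one>" for k
  proof -
    have nat: "j = 0" if "?\<zeta> [^] (int j) = \<one>" for j
    proof -
      have "pos 0 \<otimes> word_val F z [^] int j \<otimes> inv (pos 0) = \<one>"
        using that conj_int_pow[OF closed(1,2)] by simp
      then have "word_val F z [^] int j = \<one>"
      proof -
        let ?y = "word_val F z [^] int j"
        have y: "?y \<in> carrier F"
          using closed by simp
        have "pos 0 \<otimes> ?y = pos 0"
          using \<open>pos 0 \<otimes> ?y \<otimes> inv (pos 0) = \<one>\<close> closed(1) y inv_solve_right[of \<one> "pos 0 \<otimes> ?y" "pos 0"]
          by simp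
        then show ?thesis
          using closed(1) y by simp
      qed
      then have "word_val F (wpow j z) = word_val F []"
        using word_val_wpow[OF bword_carrier[OF z]] by (simp add: int_pow_int)
      then have "red (wpow j z) = []"
        using word_val_eq_iff[of "wpow j z" "[]"] z set_wpow[of j z] by auto
      then have "wpow j z = []"
        using red_reduced[OF reduced_word_wpow[OF \<open>reduced_word (z @ z)\<close>]] by simp
      then show "j = 0"
        using m(3) by (cases j) auto
    qed
    show ?thesis
    proof (cases "k \<ge> 0")
      case True
      then show ?thesis
        using nat[of "nat k"] that by simp
    next
      case False
      have "?\<zeta> [^] (- k) = \<one>"
        using that int_pow_neg[OF closed(3)] by simp
      then show ?thesis
        using nat[of "nat (- k)"] False by simp
    qed
  qed
  note root = root_generates[OF ax max z w]
  obtain c :: int where "?\<zeta> = g [^] c"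
    using root(1) powers_self[OF closed(3)] by (auto simp: powers_def)
  also have "\<dots> = ?\<zeta> [^] (int (m + n) * c)"
    using root(2) int_pow_pow[OF closed(3)] by simp
  finally have "?\<zeta> [^] (int (m + n) * c - 1) = \<one>"
    using int_pow_diff[OF closed(3), of "int (m + n) * c" 1] closed by simp
  then have "int (m + n) * c = 1"
    using torsion_free by force
  then have "int (m + n) = 1"
    unfolding zmult_eq_1_iff by linarith
  then show False
    using m by simp
qed

end

section \<open>Counting conjugacy classes\<close>

context free_subgroup
begin

lemma coset_eq_iff:
  assumes "h \<in> carrier F" "x \<in> carrier F"
  shows "A #> (h \<otimes> x) = A #> x \<longleftrightarrow> h \<in> A"
proof
  assume "A #> (h \<otimes> x) = A #> x"
  then have "A #> (h \<otimes> x) #> inv x = A #> x #> inv x"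
    by (rule arg_cong)
  then have "A #> h = A"
    using assms A_sub by (simp add: coset_mult_assoc m_assoc)
  then show "h \<in> A"
    using coset_join1[OF _ assms(1) A] by blast
next
  assume "h \<in> A"
  then have "A #> h = A"
    using coset_join2[OF assms(1) A] by blast
  then show "A #> (h \<otimes> x) = A #> x"
    using coset_mult_assoc[OF A_sub assms] by simp
qed

text \<open>The axis is projected from the Cayley tree to the Schreier graph. The point at p + L j
  is g^j times the point at p, so its coset recurs exactly when g^j lies in
  \<open>A\<close>.\<close>

lemma axis_periodic_line:
  assumes ax: "axis g pos l L" and max: "maximal_cyclic_subgroup (powers g) F"
    and n: "n > 0" "\<And>j::int. g [^] j \<in> A \<longleftrightarrow> int n dvd j"
  shows "periodic_line (\<lambda>p. A #> pos p) l L n"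
  unfolding periodic_line_def
proof (intro conjI allI impI)
  note a = axisD[OF ax]
  show "L > 0" "n > 0"
    using a n by auto
  fix p
  show coset: "A #> pos p \<in> cosets"
    by (rule rcosetsI[OF A_sub a(3)])
  show "fst (l p) \<in> S" "l (p + int L) = l p" "l (p + 1) \<noteq> flip (l p)"
    by (rule a)+
  have "fst (l p) \<in> carrier F"
    using a(4) S_subset by blast
  then show "A #> pos (p + 1) = coset_step (A #> pos p) (l p)"
    unfolding a(5) using coset a(4) coset_mult_assoc[OF A_sub a(3) letter_val_closed]
    by (simp add: coset_step_def)
  show "A #> pos (p + int L * j) = A #> pos p \<longleftrightarrow> int n dvd j" for j
    unfolding pos_pow[OF ax] n(2)[symmetric] using a by (intro coset_eq_iff) auto
  show "int L dvd p - q" if "\<forall>t. l (p + t) = l (q + t)" for q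
    using axis_primitive[OF ax max, of p q] that by blast
qed

abbreviation all_edges :: "'a set \<Rightarrow> 'a \<times> bool \<Rightarrow> bool"
  where "all_edges \<equiv> \<lambda>_ _. False"

lemma undirected_all_edges: "undirected all_edges"
  by (simp add: undirected_def)

lemma cross_window:
  assumes "\<And>p. y (p + 1) = coset_step (y p) (l p)"
  shows "cross all_edges (y p) (window l m p) = window (\<lambda>p. edge (y p) (l p)) m p"
proof (induction m arbitrary: p)
  case (Suc m)
  then show ?case
    by (simp add: window_Cons flip: assms)
qed (simp add: window_def)

text \<open>The loop of g^n goes from the base vertex to the line along u, once around the line, and
  back along u. In the signed count the two passages of u cancel.\<close>

lemma flow_axis:
  assumes ax: "axis g pos l L" and line: "periodic_line (\<lambda>p. A #> pos p) l L n"
    and g: "g [^] (int n) \<in> A"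
  shows "flow all_edges e (g [^] (int n)) =
    esum e (window (\<lambda>p. edge (A #> pos p) (l p)) (L * n) 0)"
proof -
  note a = axisD[OF ax]
  let ?u = "nf (pos 0)" and ?W = "window l (L * n) 0"
  note u = nf[OF a(3), of 0]
  have W: "bword ?W"
    by (rule bword_window[OF ax])
  have pos_n: "pos 0 \<otimes> word_val F ?W = g [^] int n \<otimes> pos 0"
    using pos_window[OF ax, of 0 "L * n"] pos_pow[OF ax, of 0 "int n"] by simp
  have "word_val F (?u @ ?W @ inv_word ?u) = pos 0 \<otimes> word_val F ?W \<otimes> inv (pos 0)"
    using u W a(3) by (simp add: word_val_append word_val_inv_word bword_carrier word_val_closed m_assoc)
  also have "\<dots> = g [^] int n"
    unfolding pos_n using a(1,3) by (simp add: m_assoc)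
  finally have val: "g [^] int n = word_val F (?u @ ?W @ inv_word ?u)" ..
  have y0: "walk A ?u = A #> pos 0"
    using walk_base[OF u(1)] u(3) by simp
  have closed: "walk (A #> pos 0) ?W = A #> pos 0"
  proof -
    have "walk (A #> pos 0) ?W = A #> (pos 0 \<otimes> word_val F ?W)"
      using foldl_coset_step[OF rcosetsI[OF A_sub a(3)] W] coset_mult_assoc[OF A_sub a(3)]
        word_val_closed[OF bword_carrier[OF W]] by simp
    also have "\<dots> = A #> pos 0"
      unfolding pos_n using g a by (simp add: coset_eq_iff)
    finally show ?thesis .
  qed
  have "esum e (cross all_edges (A #> pos 0) (inv_word ?u)) = - esum e (cross all_edges A ?u)"
    using cross_inv_word[OF undirected_all_edges, of A ?u] y0 by simp
  moreover have "flow all_edges e (g [^] int n) = esum e (cross all_edges A (?u @ ?W @ inv_word ?u))"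
    unfolding val using u(1) W by (intro flow_word_val[OF undirected_all_edges]) simp
  ultimately have "flow all_edges e (g [^] int n) = esum e (cross all_edges (A #> pos 0) ?W)"
    by (simp add: cross_append y0 closed)
  moreover have "A #> pos (p + 1) = coset_step (A #> pos p) (l p)" for p
    using line by (simp add: periodic_line_def)
  ultimately show ?thesis
    using cross_window[of "\<lambda>p. A #> pos p" l 0 "L * n"] by simp
qed

text \<open>Each class contributes the element g^n of \<open>A\<close> and the net crossing count of
  its private edge. On its own element the count is nonzero, as all crossings go one way; on
  elements of other classes with words no longer it vanishes.\<close>

lemma card_conj_classes_le:
  assumes B: "finite B" "B \<subseteq> A"
    and gen: "\<And>x. x \<in> A \<Longrightarrow> \<exists>u. set u \<subseteq> B \<times> UNIV \<and> word_val (F\<lparr>carrier := A\<rparr>) u = x"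
    and I: "finite I"
    and classes: "\<And>c. c \<in> I \<Longrightarrow> \<exists>M. c = subgroup_conj_class F M \<and> maximal_cyclic_subgroup M F \<and>
      enat (12 * card B) \<le> subgroup_index F M (A \<inter> M) \<and> subgroup_index F M (A \<inter> M) < \<infinity>"
  shows "card I \<le> card B"
proof -
  have "\<exists>g pos l L n. c = subgroup_conj_class F (powers g) \<and> maximal_cyclic_subgroup (powers g) F \<and>
      axis g pos l L \<and> n > 0 \<and> (\<forall>j::int. g [^] j \<in> A \<longleftrightarrow> int n dvd j) \<and> 12 * card B \<le> n"
    if c: "c \<in> I" for c
  proof -
    obtain M where M: "c = subgroup_conj_class F M" "maximal_cyclic_subgroup M F"
      "enat (12 * card B) \<le> subgroup_index F M (A \<inter> M)" "subgroup_index F M (A \<inter> M) < \<infinity>"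
      using classes[OF c] by blast
    then have "cyclic_subgroup M F" "M \<noteq> {\<one>}"
      by (auto simp: maximal_cyclic_subgroup_def)
    then obtain g where g: "g \<in> carrier F" "M = powers g"
      by (metis cyclic_subgroup_imp_powers)
    have "g \<noteq> \<one>"
      using g(2) \<open>M \<noteq> {\<one>}\<close> by (auto simp: powers_def)
    then obtain pos l L where ax: "axis g pos l L"
      using axis_exists[OF g(1)] by blast
    obtain n where n: "n > 0" "\<And>j::int. g [^] j \<in> A \<longleftrightarrow> int n dvd j"
      "subgroup_index F (powers g) (A \<inter> powers g) \<le> enat n"
      using finite_index_powers[OF A g(1)] M(4) g(2) by blast
    have "enat (12 * card B) \<le> enat n"
      using M(3) n(3) unfolding g(2) by (rule order_trans)
    then have "12 * card B \<le> n"
      by simp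
    then show ?thesis
      using M(1,2) ax n(1,2) unfolding g(2) by blast
  qed
  then obtain g pos l L n where data: "\<And>c. c \<in> I \<Longrightarrow> c = subgroup_conj_class F (powers (g c)) \<and>
      maximal_cyclic_subgroup (powers (g c)) F \<and> axis (g c) (pos c) (l c) (L c) \<and> n c > 0 \<and>
      (\<forall>j::int. g c [^] j \<in> A \<longleftrightarrow> int (n c) dvd j) \<and> 12 * card B \<le> n c"
    by metis
  then have cls: "\<And>c. c \<in> I \<Longrightarrow> subgroup_conj_class F (powers (g c)) = c"
    and max: "\<And>c. c \<in> I \<Longrightarrow> maximal_cyclic_subgroup (powers (g c)) F"
    and ax: "\<And>c. c \<in> I \<Longrightarrow> axis (g c) (pos c) (l c) (L c)"
    and n: "\<And>c. c \<in> I \<Longrightarrow> n c > 0" "\<And>c j. c \<in> I \<Longrightarrow> g c [^] (j::int) \<in> A \<longleftrightarrow> int (n c) dvd j"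
    and big: "\<And>c. c \<in> I \<Longrightarrow> 12 * card B \<le> n c"
    by blast+
  define y where "y c p = A #> pos c p" for c p
  have line: "periodic_line (y c) (l c) (L c) (n c)" if "c \<in> I" for c
    unfolding y_def using axis_periodic_line[OF ax[OF that] max[OF that] n(1)[OF that] n(2)[OF that]] .
  note chords = finite_chords[OF B gen]
  have "\<exists>p. (\<forall>q. edge (y k q) (l k q) \<noteq> flip (edge (y k p) (l k p))) \<and>
      (\<forall>i\<in>I. \<forall>q. i \<noteq> k \<longrightarrow> L i \<le> L k \<longrightarrow> fst (edge (y i q) (l i q)) \<noteq> fst (edge (y k p) (l k p)))"
    if k: "k \<in> I" for k
  proof -
    have 1: "12 * card chords \<le> n i" if "i \<in> I" for i
      using big[OF that] chords(2) by linarith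
    \<comment> \<open>The lines are indexed by the classes themselves, so distinct indices belong to
      non-conjugate subgroups and an overlap is impossible.\<close>
    have 2: "\<not> (\<forall>t < L i + L j. l i (q + int t) = l j (p + int t))"
      if "i \<in> I" "j \<in> I" "i \<noteq> j" for i j p q
      using overlap_imp_conj[OF ax[OF that(1)] max[OF that(1)] ax[OF that(2)] max[OF that(2)], of q p]
        cls that by auto
    have 3: "\<not> (\<forall>t < L i + L j. l i (q - int t) = flip (l j (p + int t)))"
      if "i \<in> I" "j \<in> I" "i \<noteq> j" for i j p q
      using reverse_overlap_imp_conj[OF ax[OF that(1)] max[OF that(1)] ax[OF that(2)] max[OF that(2)], of q p]
        cls that by auto
    show ?thesis
      by (rule private_edges[OF I chords(1) line 1 2 3 k]) blast+
  qed
  then obtain p where p: "\<And>k q. k \<in> I \<Longrightarrow> edge (y k q) (l k q) \<noteq> flip (edge (y k (p k)) (l k (p k)))"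
    "\<And>i k q. k \<in> I \<Longrightarrow> i \<in> I \<Longrightarrow> i \<noteq> k \<Longrightarrow> L i \<le> L k \<Longrightarrow>
      fst (edge (y i q) (l i q)) \<noteq> fst (edge (y k (p k)) (l k (p k)))"
    by metis
  define e where "e k = edge (y k (p k)) (l k (p k))" for k
  define x where "x k = g k [^] int (n k)" for k
  have x: "x k \<in> A" if "k \<in> I" for k
    using n(2)[OF that] by (simp add: x_def)
  have flow_x: "flow all_edges f (x k) = esum f (window (\<lambda>p. edge (y k p) (l k p)) (L k * n k) 0)"
    if "k \<in> I" for k f
    using flow_axis[OF ax[OF that], of "n k" f] line[OF that] x[OF that] by (simp add: x_def y_def[abs_def])
  interpret FA: group "F\<lparr>carrier := A\<rparr>"
    using A by (rule subgroup_imp_group)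
  show ?thesis
  proof (rule FA.independent_card_le[where x = x and f = "\<lambda>k. flow all_edges (fst (e k))" and L = L])
    show "\<exists>u. set u \<subseteq> B \<times> UNIV \<and> word_val (F\<lparr>carrier := A\<rparr>) u = x i" if "i \<in> I" for i
      by (rule gen[OF x[OF that]])
    show "flow all_edges (fst (e k)) (x k) \<noteq> 0" if k: "k \<in> I" for k
      unfolding flow_x[OF k]
    proof (rule esum_neq_0)
      let ?N = "int (L k) * int (n k)"
      have pl: "L k > 0" "n k > 0" "l k (q + int (L k)) = l k q"
        "y k (q + int (L k) * j) = y k q \<longleftrightarrow> int (n k) dvd j" for q j
        using line[OF k] by (auto simp: periodic_line_def)
      have "edge (y k (q + ?N)) (l k (q + ?N)) = edge (y k q) (l k q)" for q
      proof -
        have "l k (q + ?N) = l k q"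
          by (rule periodic_mod(1)) (rule pl(3))
        moreover have "y k (q + ?N) = y k q"
          using pl(4) by simp
        ultimately show ?thesis by simp
      qed
      then have "edge (y k (p k mod ?N)) (l k (p k mod ?N)) = e k"
        unfolding e_def by (rule periodic_mod(2))
      moreover have "nat (p k mod ?N) < L k * n k" "int (nat (p k mod ?N)) = p k mod ?N"
        using pl(1,2) by (simp_all add: nat_less_iff)
      ultimately show "e k \<in> set (window (\<lambda>p. edge (y k p) (l k p)) (L k * n k) 0)"
        by (auto simp: window_def intro!: image_eqI[of _ _ "nat (p k mod ?N)"])
      show "flip (e k) \<notin> set (window (\<lambda>p. edge (y k p) (l k p)) (L k * n k) 0)"
      proof
        assume "flip (e k) \<in> set (window (\<lambda>p. edge (y k p) (l k p)) (L k * n k) 0)"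
        then obtain q where "flip (e k) = edge (y k q) (l k q)"
          by (auto simp: window_def)
        then show False
          using p(1)[OF k, of q] by (simp add: e_def)
      qed
    qed
    show "flow all_edges (fst (e k)) (x i) = 0" if "i \<in> I" "k \<in> I" "i \<noteq> k" "L i \<le> L k" for i k
      unfolding flow_x[OF that(1)]
      using p(2)[OF that(2,1,3,4)] by (intro esum_eq_0) (auto simp: window_def e_def)
  qed (use B I flow_mult[OF undirected_all_edges] in auto)
qed

end

theorem theorem6p4:
  fixes F :: "('a, 'm) monoid_scheme" and A :: "'a set"
  assumes "free_group F" and "fin_gen_subgroup A F"
  shows "let r = free_rank (F\<lparr>carrier := A\<rparr>);
             \<C> = {subgroup_conj_class F M | M. maximal_cyclic_subgroup M F \<and>
                   enat (12 * r) \<le> subgroup_index F M (A \<inter> M) \<and>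
                   subgroup_index F M (A \<inter> M) < \<infinity>}
         in finite \<C> \<and> card \<C> \<le> r"
proof -
  obtain S where "group F" "free_basis F S"
    using assms(1) by (auto simp: free_group_def)
  moreover obtain B0 where A: "subgroup A F" and B0: "finite B0" "B0 \<subseteq> carrier F" "A = generate F B0"
    using assms(2) by (auto simp: fin_gen_subgroup_def)
  ultimately interpret free_subgroup F S A
    by (simp add: free_subgroup_def free_subgroup_axioms_def free_on_def free_on_axioms_def)
  let ?FA = "F\<lparr>carrier := A\<rparr>"
  interpret FA: group ?FA
    using A by (rule subgroup_imp_group)
  \<comment> \<open>This is the basis chosen in \<open>free_rank\<close>, so the rank is
    \<open>card B\<close> by definition.\<close>
  define B where "B = (SOME B. free_basis ?FA B)"
  have "free_basis ?FA B"
    unfolding B_def using nielsen_schreier by (rule someI)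
  then interpret FB: free_on ?FA B
    by unfold_locales
  have "B0 \<subseteq> A"
    using B0(3) generate.incl by fast
  then have finB: "finite B"
    using FB.finite_basis[OF B0(1)] generate_consistent[OF _ A] B0(3) by simp
  have subB: "B \<subseteq> A"
    using FB.S_subset by simp
  have genB: "\<exists>u. set u \<subseteq> B \<times> UNIV \<and> word_val ?FA u = x" if "x \<in> A" for x
  proof -
    have "x \<in> carrier ?FA"
      using that by simp
    then obtain u where "set u \<subseteq> B \<times> UNIV" "word_val ?FA u = x"
      by (rule FB.word_exists)
    then show ?thesis by blast
  qed
  let ?C = "{subgroup_conj_class F M | M. maximal_cyclic_subgroup M F \<and>
      enat (12 * card B) \<le> subgroup_index F M (A \<inter> M) \<and> subgroup_index F M (A \<inter> M) < \<infinity>}"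
  \<comment> \<open>A uniform bound on finite subsets gives finiteness and the bound for the whole
    set.\<close>
  have "card I \<le> card B" if "I \<subseteq> ?C" "finite I" for I
  proof (rule card_conj_classes_le[OF finB subB genB that(2)])
    fix c assume "c \<in> I"
    then show "\<exists>M. c = subgroup_conj_class F M \<and> maximal_cyclic_subgroup M F \<and>
        enat (12 * card B) \<le> subgroup_index F M (A \<inter> M) \<and> subgroup_index F M (A \<inter> M) < \<infinity>"
      using that(1) by blast
  qed
  then have "finite ?C \<and> card ?C \<le> card B"
    by (rule finite_if_finite_subsets_card_bdd)
  moreover have "free_rank ?FA = card B"
    by (simp add: free_rank_def B_def)
  ultimately show ?thesis
    by (simp add: Let_def)
qed

end
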